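(* Let $S$ be a finite set. The map $\delta\colon\mathcal A^w(S)\to\mathcal A^w(S;S)$ is an isomorphism of vector spaces (in general not multiplicative). Its inverse on $D\in\mathcal A^w(S;S)$ is given by the following process: (1) write $D$ with only arrow heads on the head strands and only arrow tails on the tail strands; this produces a well-defined element $D'$ of $\mathcal A^w(hS\sqcup tS)$; (2) stitch all the head-tail pairs of strands in $D'$, putting each head strand ahead of (below) its corresponding tail strand: $\delta^{-1}(D)=\big(\prod_{a\in S}dm^{ha,ta}_a\big)(D')$.
   Context: **The space $\mathcal A^w(S)$.** Everything is over $\mathbb Q$. An arrow diagram on a finite set $S$ consists of vertical upward-oriented strands labelled by $S$ (the skeleton) and a finite directed graph whose univalent vertices (ends) are attached at distinct points of the strands (a source end is a "tail", a sink end is a "head"), whose other vertices are trivalent with two incoming edges and one outgoing edge and with an ordering (left, right) of the incoming edges, and each of whose connected components has at least one end on the skeleton. Its degree is half the total number of vertices (ends and trivalent). A trivalent vertex with left input $p$ and right input $q$ is thought of as outputting the bracket $[p,q]$. $\mathcal A^w(S)$ is the degree completion of the span of arrow diagrams modulo: (AS) exchanging the two inputs of a trivalent vertex negates the diagram; (IHX) the Jacobi identity $[[p,q],r]+[[q,r],p]+[[r,p],q]=0$ applied locally; (STU$_1$) if the heads of edges $p,q$ are adjacent on a strand, ($p$ below $q$) $-$ ($q$ below $p$) $=$ the diagram with a single head there, on the edge output by a new vertex $[p,q]$; (STU$_2$) if the head of an edge $p$ and the tail of an edge $e$ are adjacent on a strand, (head below tail) $-$ (tail below head) $=$ the diagram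 with a single tail there, feeding as the left input of a new vertex whose right input is $p$ and whose output continues along $e$; (TC) adjacent tails on a strand may be exchanged. Multiplication on $\mathcal A^w(S)$ is stacking: $D_1\ast D_2$ is $D_2$ on top of $D_1$. **Operations.** $d\Delta^a_{bc}$ replaces strand $a$ by two parallel strands $b,c$ and sums over all ways of lifting each end on $a$ to $b$ or $c$. $dm^{ab}_c$ stitches strand $a$ to strand $b$, with $a$ before (below) $b$, and calls the resulting strand $c$. **The space $\mathcal A^w(H;T)$.** For finite sets $H$ (head labels) and $T$ (tail labels), possibly overlapping, $\mathcal A^w(H;T)$ is $\mathcal A^w(H\sqcup T)$ (disjoint union made by force; strands from $H$ are head strands, from $T$ tail strands) modulo: a diagram with a tail on a head strand is $0$; (CP) a diagram in which a head is the lowest vertex on some tail strand is $0$. It is isomorphic to the space spanned by diagrams with only heads on head strands and only tails on tail strands, modulo AS, IHX, STU$_1$ and TC (slide heads on tail strands to the bottom using STU$_2$, where they vanish by CP). Multiplication $D_1\#D_2$ on $\mathcal A^w(H;T)$: with $D_1,D_2$ in this form, stitch equally labelled head strands ($D_1$ below $D_2$) and merge all tails on equally labelled tail strands onto one strand. **The map $\delta$.** With $ha$, $ta$ denoting the head and tail copies of the label $a\in S$, and $hS=\{ha\}$, $tS=\{ta\}$, $\delta$ is the composition of the "double every strand" map $\prod_{a\in S}d\Delta^a_{ha,ta}\colon\mathcal A^w(S)\to\mathcal A^w(hS\sqcup tS)$ with the projection $\mathcal A^w(hS\sqcup tS)\to\mathcal A^w(S;S)$. *)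

theory Defs
  imports "HOL-Library.Multiset" "HOL-Library.Function_Algebras" Complex_Main
begin

section \<open>Arrow diagrams\<close>

text \<open>
  A diagram is encoded through its edges, which are named by natural numbers. A strand is the list
  of the ends on it, from bottom to top: \<open>Head e\<close> is the end at which the edge \<open>e\<close> arrives,
  \<open>Tail e\<close> the end from which \<open>e\<close> departs. A trivalent vertex is the triple
  \<open>(p, q, r)\<close> of its left input, its right input and its output, i.e. \<open>r\<close> carries
  the bracket \<open>[p,q]\<close>. As every trivalent vertex has its own output edge, a set of triples
  loses no information.
\<close>

datatype endpoint = Head nat | Tail nat

datatype 'l diag = Diag (strands: "'l \<Rightarrow> endpoint list") (verts: "(nat \<times> nat \<times> nat) set")

definition on_skeleton :: "'l diag \<Rightarrow> nat set" where
  "on_skeleton D = {e. \<exists>l. Head e \<in> set (strands D l) \<or> Tail e \<in> set (strands D l)}"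

definition edges :: "'l diag \<Rightarrow> nat set" where
  "edges D = on_skeleton D \<union> (\<Union>(p, q, r)\<in>verts D. {p, q, r})"

definition departures :: "'l set \<Rightarrow> 'l diag \<Rightarrow> nat \<Rightarrow> nat" where
  "departures S D e = (\<Sum>l\<in>S. count_list (strands D l) (Tail e)) + card {(p, q, r) \<in> verts D. r = e}"

definition arrivals :: "'l set \<Rightarrow> 'l diag \<Rightarrow> nat \<Rightarrow> nat" where
  "arrivals S D e = (\<Sum>l\<in>S. count_list (strands D l) (Head e))
     + card {(p, q, r) \<in> verts D. p = e} + card {(p, q, r) \<in> verts D. q = e}"

definition adjacent_edges :: "'l diag \<Rightarrow> (nat \<times> nat) set" where
  "adjacent_edges D = (\<Union>(p, q, r)\<in>verts D. {p, q, r} \<times> {p, q, r})"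

text \<open>
  \<open>arrow_diagram S D\<close>: \<open>D\<close> is an arrow diagram on the (finite) skeleton \<open>S\<close>. The
  third clause says that every edge has exactly one source and one target, the last one that every
  connected component has an end on the skeleton.
\<close>

definition arrow_diagram :: "'l set \<Rightarrow> 'l diag \<Rightarrow> bool" where
  "arrow_diagram S D \<longleftrightarrow>
     (\<forall>l. l \<notin> S \<longrightarrow> strands D l = []) \<and>
     finite (verts D) \<and>
     (\<forall>e\<in>edges D. departures S D e = 1 \<and> arrivals S D e = 1) \<and>
     (\<forall>e\<in>edges D. \<exists>e'\<in>on_skeleton D. (e, e') \<in> (adjacent_edges D)\<^sup>*)"

definition degree :: "'l diag \<Rightarrow> nat" where
  "degree D = ((\<Sum>l | strands D l \<noteq> []. length (strands D l)) + card (verts D)) div 2"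

fun rename_end :: "(nat \<Rightarrow> nat) \<Rightarrow> endpoint \<Rightarrow> endpoint" where
  "rename_end f (Head e) = Head (f e)"
| "rename_end f (Tail e) = Tail (f e)"

text \<open>
  Two diagrams are isomorphic iff they differ by \<open>rename f\<close> for some injective \<open>f\<close>.
\<close>

definition rename :: "(nat \<Rightarrow> nat) \<Rightarrow> 'l diag \<Rightarrow> 'l diag" where
  "rename f D = Diag (\<lambda>l. map (rename_end f) (strands D l)) ((\<lambda>(p, q, r). (f p, f q, f r)) ` verts D)"


section \<open>Degree-completed chains\<close>

text \<open>
  A formal combination of diagrams is its coefficient function. A chain may be infinite, but
  has only finitely many terms in each degree.
\<close>

type_synonym 'l comb = "'l diag \<Rightarrow> rat"

definition basis :: "'l diag \<Rightarrow> 'l comb" where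
  "basis D = (\<lambda>E. if E = D then 1 else 0)"

definition scale :: "rat \<Rightarrow> 'l comb \<Rightarrow> 'l comb" where
  "scale c x = (\<lambda>D. c * x D)"

interpretation comb: vector_space "scale :: rat \<Rightarrow> 'l comb \<Rightarrow> 'l comb"
  by unfold_locales (auto simp: scale_def fun_eq_iff algebra_simps)

definition chains :: "'l set \<Rightarrow> 'l comb set" where
  "chains S = {x. (\<forall>D. x D \<noteq> 0 \<longrightarrow> arrow_diagram S D) \<and> (\<forall>d. finite {D. x D \<noteq> 0 \<and> degree D = d})}"

definition degree_part :: "nat \<Rightarrow> 'l comb \<Rightarrow> 'l comb" where
  "degree_part d x = (\<lambda>D. if degree D = d then x D else 0)"

text \<open>
  For a set \<open>G\<close> of homogeneous relators, \<open>mod_relators S G\<close> is congruence modulo the degree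
  completion of their span, so that \<open>chains S // mod_relators S G\<close> is the product over \<open>d\<close>
  of the degree \<open>d\<close> parts of the span of the diagrams modulo \<open>G\<close>.
\<close>

definition mod_relators :: "'l set \<Rightarrow> 'l comb set \<Rightarrow> ('l comb \<times> 'l comb) set" where
  "mod_relators S G =
     {(x, y). x \<in> chains S \<and> y \<in> chains S \<and> (\<forall>d. degree_part d (x - y) \<in> comb.span G)}"

text \<open>
  Linear extension of an operation that sends a diagram to a finite sum of diagrams. On chains
  the sum below is finite for operations that preserve the degree.
\<close>

definition lin_ext :: "('l diag \<Rightarrow> 'm diag multiset) \<Rightarrow> 'l comb \<Rightarrow> 'm comb" where
  "lin_ext F x = (\<lambda>E. \<Sum>D | x D \<noteq> 0 \<and> E \<in># F D. x D * of_nat (count (F D) E))"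

text \<open>Vector space operations on, and isomorphisms between, quotients by congruences \<open>r\<close>.\<close>

definition class_add :: "('l comb \<times> 'l comb) set \<Rightarrow> 'l comb set \<Rightarrow> 'l comb set \<Rightarrow> 'l comb set" where
  "class_add r X Y = (\<Union>x\<in>X. \<Union>y\<in>Y. r `` {x + y})"

definition class_scale :: "('l comb \<times> 'l comb) set \<Rightarrow> rat \<Rightarrow> 'l comb set \<Rightarrow> 'l comb set" where
  "class_scale r c X = (\<Union>x\<in>X. r `` {scale c x})"

definition vector_space_iso ::
  "'l comb set set \<Rightarrow> ('l comb \<times> 'l comb) set \<Rightarrow> 'm comb set set \<Rightarrow> ('m comb \<times> 'm comb) set
     \<Rightarrow> ('l comb set \<Rightarrow> 'm comb set) \<Rightarrow> bool" where
  "vector_space_iso A r B s f \<longleftrightarrow>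
     bij_betw f A B \<and>
     (\<forall>X\<in>A. \<forall>Y\<in>A. f (class_add r X Y) = class_add s (f X) (f Y)) \<and>
     (\<forall>c. \<forall>X\<in>A. f (class_scale r c X) = class_scale s c (f X))"


section \<open>The space \<open>A\<^sup>w(S)\<close>\<close>

text \<open>
  Besides the defining relations, \<open>iso\<close> identifies isomorphic diagrams. The edges named
  in a local picture may coincide where they leave it (e.g. \<open>p = e\<close> in \<open>STU2\<close>);
  \<open>m \<noteq> e\<close> in \<open>IHX\<close> says that the two vertices are distinct.
\<close>

inductive_set relators :: "'l set \<Rightarrow> 'l comb set" for S where
  iso: "\<lbrakk>arrow_diagram S D; inj f\<rbrakk> \<Longrightarrow> basis D - basis (rename f D) \<in> relators S"
| AS: "\<lbrakk>arrow_diagram S (Diag w (insert (p, q, r) V)); (p, q, r) \<notin> V\<rbrakk> \<Longrightarrow>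
    basis (Diag w (insert (p, q, r) V)) + basis (Diag w (insert (q, p, r) V)) \<in> relators S"
| IHX: "\<lbrakk>arrow_diagram S (Diag w ({(p, q, m), (m, r, e)} \<union> V)); m \<noteq> e;
      (p, q, m) \<notin> V; (m, r, e) \<notin> V\<rbrakk> \<Longrightarrow>
    basis (Diag w ({(p, q, m), (m, r, e)} \<union> V)) + basis (Diag w ({(q, r, m), (m, p, e)} \<union> V))
      + basis (Diag w ({(r, p, m), (m, q, e)} \<union> V)) \<in> relators S"
| STU1: "\<lbrakk>arrow_diagram S (Diag w V); w a = us @ [Head p, Head q] @ vs; r \<notin> edges (Diag w V)\<rbrakk> \<Longrightarrow>
    basis (Diag w V) - basis (Diag (w(a := us @ [Head q, Head p] @ vs)) V)
      - basis (Diag (w(a := us @ [Head r] @ vs)) (insert (p, q, r) V)) \<in> relators S"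
| STU2: "\<lbrakk>arrow_diagram S (Diag w V); w a = us @ [Head p, Tail e] @ vs; f \<notin> edges (Diag w V)\<rbrakk> \<Longrightarrow>
    basis (Diag w V) - basis (Diag (w(a := us @ [Tail e, Head p] @ vs)) V)
      - basis (Diag (w(a := us @ [Tail f] @ vs)) (insert (f, p, e) V)) \<in> relators S"
| TC: "\<lbrakk>arrow_diagram S (Diag w V); w a = us @ [Tail d, Tail e] @ vs\<rbrakk> \<Longrightarrow>
    basis (Diag w V) - basis (Diag (w(a := us @ [Tail e, Tail d] @ vs)) V) \<in> relators S"

definition aw_rel :: "'l set \<Rightarrow> ('l comb \<times> 'l comb) set" where
  "aw_rel S = mod_relators S (relators S)"

definition Aw :: "'l set \<Rightarrow> 'l comb set set" where
  "Aw S = chains S // aw_rel S"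

text \<open>\<open>stack D1 D2\<close> is \<open>D2\<close> on top of \<open>D1\<close>; the renamings keep the edges apart.\<close>

definition stack :: "'l diag \<Rightarrow> 'l diag \<Rightarrow> 'l diag" where
  "stack D1 D2 =
     (let D1' = rename (\<lambda>e. 2 * e) D1; D2' = rename (\<lambda>e. 2 * e + 1) D2
      in Diag (\<lambda>l. strands D1' l @ strands D2' l) (verts D1' \<union> verts D2'))"

definition stack_comb :: "'l comb \<Rightarrow> 'l comb \<Rightarrow> 'l comb" where
  "stack_comb x y = (\<lambda>E. \<Sum>(D1, D2) | x D1 \<noteq> 0 \<and> y D2 \<noteq> 0 \<and> stack D1 D2 = E. x D1 * y D2)"

definition aw_mult :: "'l set \<Rightarrow> 'l comb set \<Rightarrow> 'l comb set \<Rightarrow> 'l comb set" where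
  "aw_mult S X Y = (\<Union>x\<in>X. \<Union>y\<in>Y. aw_rel S `` {stack_comb x y})"


section \<open>Doubling and stitching\<close>

text \<open>
  The label type contains a label \<open>a\<close> together with its disjoint head and tail copies
  \<open>ha\<close> and \<open>ta\<close>.
\<close>

datatype 'a label = Str 'a | HStr 'a | TStr 'a

definition ht :: "'a set \<Rightarrow> 'a set \<Rightarrow> 'a label set" where
  "ht H T = HStr ` H \<union> TStr ` T"

text \<open>
  \<open>dDelta a b c D\<close> is the multiset of all diagrams obtained by lifting the ends at the positions
  \<open>I\<close> of the strand \<open>a\<close> to \<open>b\<close> and the others to \<open>c\<close>.
\<close>

definition dDelta :: "'l \<Rightarrow> 'l \<Rightarrow> 'l \<Rightarrow> 'l diag \<Rightarrow> 'l diag multiset" where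
  "dDelta a b c D =
     {# Diag ((strands D)(a := [], b := nths (strands D a) I, c := nths (strands D a) (- I))) (verts D).
        I \<in># mset_set (Pow {..<length (strands D a)}) #}"

definition dm :: "'l \<Rightarrow> 'l \<Rightarrow> 'l \<Rightarrow> 'l diag \<Rightarrow> 'l diag" where
  "dm a b c D = Diag ((strands D)(a := [], b := [], c := strands D a @ strands D b)) (verts D)"

text \<open>
  The products over \<open>a \<in> S\<close> of \<open>dDelta\<close> and \<open>dm\<close>. They are well-defined for finite
  \<open>S\<close> since operations on different strands commute.
\<close>

definition double_step :: "'a \<Rightarrow> 'a label diag multiset \<Rightarrow> 'a label diag multiset" where
  "double_step a M = (\<Sum>D\<in>#M. dDelta (Str a) (HStr a) (TStr a) D)"

definition double_diag :: "'a set \<Rightarrow> 'a label diag \<Rightarrow> 'a label diag multiset" where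
  "double_diag S D = Finite_Set.fold double_step {#D#} S"

definition stitch_diag :: "'a set \<Rightarrow> 'a label diag \<Rightarrow> 'a label diag" where
  "stitch_diag S D = Finite_Set.fold (\<lambda>a. dm (HStr a) (TStr a) (Str a)) D S"

lemma sum_mset_UN_mset: "sum_mset (image_mset g (sum_mset M)) = (\<Sum>N\<in>#M. sum_mset (image_mset g N))"
  for g :: "'b \<Rightarrow> 'c multiset"
  by (induction M) auto

lemma double_step_dDelta_commute:
  assumes "a \<noteq> b"
  shows "double_step b (dDelta (Str a) (HStr a) (TStr a) D) =
    (\<Sum>I\<in>#mset_set (Pow {..<length (strands D (Str a))}).
      \<Sum>J\<in>#mset_set (Pow {..<length (strands D (Str b))}).
        {#Diag ((strands D)(Str a := [], HStr a := nths (strands D (Str a)) I,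
                            TStr a := nths (strands D (Str a)) (- I),
                            Str b := [], HStr b := nths (strands D (Str b)) J,
                            TStr b := nths (strands D (Str b)) (- J))) (verts D)#})"
  using assms by (simp add: double_step_def dDelta_def multiset.map_comp comp_def)

lemma double_step_commute: "double_step a \<circ> double_step b = double_step b \<circ> double_step a"
proof (cases "a = b")
  case False
  have *: "double_step a (dDelta (Str b) (HStr b) (TStr b) D) =
           double_step b (dDelta (Str a) (HStr a) (TStr a) D)" for D :: "'a label diag"
  proof -
    have "(f(Str b := x1, HStr b := x2, TStr b := x3, Str a := y1, HStr a := y2, TStr a := y3)) =
          (f(Str a := y1, HStr a := y2, TStr a := y3, Str b := x1, HStr b := x2, TStr b := x3))"
      for f :: "'a label \<Rightarrow> endpoint list" and x1 x2 x3 y1 y2 y3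
      using False by (auto simp: fun_eq_iff)
    then show ?thesis
      unfolding double_step_dDelta_commute[OF False] double_step_dDelta_commute[OF False[symmetric]]
      by (subst sum_mset.swap) simp
  qed
  show ?thesis
  proof
    fix M :: "'a label diag multiset"
    show "(double_step a \<circ> double_step b) M = (double_step b \<circ> double_step a) M"
      using * unfolding double_step_def comp_def
      by (simp add: sum_mset_UN_mset multiset.map_comp comp_def)
  qed
qed simp

lemma double_diag_insert:
  assumes "finite S" "a \<notin> S"
  shows "double_diag (insert a S) D = double_step a (double_diag S D)"
proof -
  interpret comp_fun_commute double_step
    by unfold_locales (rule double_step_commute)
  show ?thesis using assms by (simp add: double_diag_def)
qed

lemma stitch_diag_insert:
  assumes "finite S" "a \<notin> S"
  shows "stitch_diag (insert a S) D = dm (HStr a) (TStr a) (Str a) (stitch_diag S D)"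
proof -
  interpret comp_fun_commute "\<lambda>a::'a. dm (HStr a) (TStr a) (Str a)"
    by unfold_locales (auto simp: dm_def fun_eq_iff)
  show ?thesis using assms by (simp add: stitch_diag_def)
qed

text \<open>
  The induced maps between \<open>A\<^sup>w(S)\<close> and \<open>A\<^sup>w(hS \<squnion> tS)\<close>.
\<close>

definition double :: "'a set \<Rightarrow> 'a label comb set \<Rightarrow> 'a label comb set" where
  "double S X = (\<Union>x\<in>X. aw_rel (ht S S) `` {lin_ext (double_diag S) x})"

definition stitch :: "'a set \<Rightarrow> 'a label comb set \<Rightarrow> 'a label comb set" where
  "stitch S X = (\<Union>x\<in>X. aw_rel (Str ` S) `` {lin_ext (\<lambda>D. {#stitch_diag S D#}) x})"


section \<open>The space \<open>A\<^sup>w(H;T)\<close>\<close>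

inductive_set ht_relators :: "'a set \<Rightarrow> 'a set \<Rightarrow> 'a label comb set" for H T where
  aw: "x \<in> relators (ht H T) \<Longrightarrow> x \<in> ht_relators H T"
| tail_on_head_strand:
    "\<lbrakk>arrow_diagram (ht H T) D; Tail e \<in> set (strands D (HStr a))\<rbrakk> \<Longrightarrow> basis D \<in> ht_relators H T"
| CP: "\<lbrakk>arrow_diagram (ht H T) D; strands D (TStr a) = Head e # us\<rbrakk> \<Longrightarrow> basis D \<in> ht_relators H T"

definition ht_rel :: "'a set \<Rightarrow> 'a set \<Rightarrow> ('a label comb \<times> 'a label comb) set" where
  "ht_rel H T = mod_relators (ht H T) (ht_relators H T)"

definition Aw_ht :: "'a set \<Rightarrow> 'a set \<Rightarrow> 'a label comb set set" where
  "Aw_ht H T = chains (ht H T) // ht_rel H T"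

definition ht_proj :: "'a set \<Rightarrow> 'a set \<Rightarrow> 'a label comb set \<Rightarrow> 'a label comb set" where
  "ht_proj H T X = (\<Union>x\<in>X. ht_rel H T `` {x})"

definition sorted_diag :: "'a label diag \<Rightarrow> bool" where
  "sorted_diag D \<longleftrightarrow>
     (\<forall>a e. Tail e \<notin> set (strands D (HStr a))) \<and> (\<forall>a e. Head e \<notin> set (strands D (TStr a)))"

definition sorted_chains :: "'a set \<Rightarrow> 'a set \<Rightarrow> 'a label comb set" where
  "sorted_chains H T = {x \<in> chains (ht H T). \<forall>D. x D \<noteq> 0 \<longrightarrow> sorted_diag D}"

text \<open>
  The product \<open>#\<close>, computed on sorted representatives. On these, stacking stitches the head
  strands and merges the tail strands (the order of the tails being immaterial by \<open>TC\<close>).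
\<close>

definition ht_mult :: "'a set \<Rightarrow> 'a set \<Rightarrow> 'a label comb set \<Rightarrow> 'a label comb set \<Rightarrow> 'a label comb set" where
  "ht_mult H T X Y =
     (\<Union>x\<in>X \<inter> sorted_chains H T. \<Union>y\<in>Y \<inter> sorted_chains H T. ht_rel H T `` {stack_comb x y})"

definition delta :: "'a set \<Rightarrow> 'a label comb set \<Rightarrow> 'a label comb set" where
  "delta S = ht_proj S S \<circ> double S"

text \<open>
  The elements of \<open>A\<^sup>w(hS \<squnion> tS)\<close> obtained by writing \<open>X\<close>, an element of
  \<open>A\<^sup>w(S;S)\<close>, with only heads on head strands and only tails on tail strands.
\<close>

definition sorted_forms :: "'a set \<Rightarrow> 'a label comb set \<Rightarrow> 'a label comb set set" where
  "sorted_forms S X = (\<lambda>x. aw_rel (ht S S) `` {x}) ` (X \<inter> sorted_chains S S)"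

end

(*
Let rho send a diagram on the doubled skeleton with no tail on a head strand to the signed sum, over
all subsets of the heads on the tail strands, of moving these heads in reversed order to the bottom
of their strand, followed by stitching; the other diagrams go to zero. This is the antipode of the
shuffle Hopf algebra: rho kills the CP diagrams on the nose (the lowest head is either moved or not,
with opposite signs), it respects STU because reversing with signs preserves brackets, and
rho o delta = id already on diagrams by the antipode identity. So delta is injective. Conversely STU2
slides all heads on tail strands to the bottom, where they vanish by CP, and doubling the stitching
of a sorted diagram gives back this diagram plus diagrams killed by CP or by having a tail on a head
strand. The same signed sum without stitching shows that the sorted form is well-defined.

For arrows 0 -> 1 and 1 -> 0 the images of the product and the product of the images differ by a tree
with two tails, which an explicit functional on diagrams of degree 2 detects.
*)
theory Submission
  imports Defs
begin

section \<open>Linear extension\<close>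

lemma sum_fun_apply: "(sum f A) x = (\<Sum>i\<in>A. f i x)"
  for f :: "'i \<Rightarrow> 'b \<Rightarrow> rat"
  by (induction A rule: infinite_finite_induct) auto

definition lin :: "('l diag \<Rightarrow> 'b \<Rightarrow> rat) \<Rightarrow> 'l comb \<Rightarrow> 'b \<Rightarrow> rat" where
  "lin F x = (\<lambda>E. \<Sum>D | x D \<noteq> 0 \<and> F D E \<noteq> 0. x D * F D E)"

definition finsupp :: "'l comb \<Rightarrow> bool" where
  "finsupp x \<longleftrightarrow> finite {D. x D \<noteq> 0}"

definition locfin :: "('l diag \<Rightarrow> 'b \<Rightarrow> rat) \<Rightarrow> 'l comb \<Rightarrow> bool" where
  "locfin F x \<longleftrightarrow> (\<forall>E. finite {D. x D \<noteq> 0 \<and> F D E \<noteq> 0})"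

lemma lin_eval:
  assumes "finite A" "{D. x D \<noteq> 0 \<and> F D E \<noteq> 0} \<subseteq> A"
  shows "lin F x E = (\<Sum>D\<in>A. x D * F D E)"
  unfolding lin_def using assms by (intro sum.mono_neutral_left) auto

lemma locfin_finsupp: "finsupp x \<Longrightarrow> locfin F x"
  unfolding finsupp_def locfin_def by (auto elim: rev_finite_subset)

lemma scale_apply [simp]: "scale c x D = c * x D"
  by (simp add: scale_def)

lemma lin_add:
  assumes "locfin F x" "locfin F y"
  shows "lin F (x + y) = lin F x + lin F y"
proof
  fix E
  let ?A = "{D. x D \<noteq> 0 \<and> F D E \<noteq> 0} \<union> {D. y D \<noteq> 0 \<and> F D E \<noteq> 0}"
  have "finite ?A" using assms by (auto simp: locfin_def)
  then show "lin F (x + y) E = (lin F x + lin F y) E"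
    by (subst plus_fun_apply, subst (1 2 3) lin_eval[where A = ?A])
       (auto simp: sum.distrib[symmetric] algebra_simps)
qed

lemma lin_scale: "lin F (scale c x) = (\<lambda>E. c * lin F x E)"
proof (cases "c = 0")
  case True
  then show ?thesis by (simp add: lin_def)
next
  case False
  then show ?thesis by (auto simp: lin_def sum_distrib_left mult.assoc)
qed

lemma lin_uminus: "lin F (- x) = - lin F x"
  by (auto simp: lin_def fun_eq_iff sum_negf)

lemma locfin_uminus: "locfin F x \<Longrightarrow> locfin F (- x)"
  by (simp add: locfin_def)

lemma lin_diff:
  assumes "locfin F x" "locfin F y"
  shows "lin F (x - y) = lin F x - lin F y"
  using lin_add[OF assms(1) locfin_uminus[OF assms(2)]] by (simp add: lin_uminus)

lemma lin_zero [simp]: "lin F 0 = 0"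
  by (auto simp: lin_def fun_eq_iff)

lemma lin_basis [simp]: "lin F (basis D) = F D"
proof
  fix E show "lin F (basis D) E = F D E"
    by (subst lin_eval[where A = "{D}"]) (auto simp: basis_def split: if_splits)
qed

lemma finsupp_zero [simp]: "finsupp 0"
  by (simp add: finsupp_def)

lemma finsupp_basis [simp]: "finsupp (basis D)"
  by (simp add: finsupp_def basis_def)

lemma finsupp_add [simp]: "finsupp x \<Longrightarrow> finsupp y \<Longrightarrow> finsupp (x + y)"
  unfolding finsupp_def by (rule finite_subset[of _ "{D. x D \<noteq> 0} \<union> {D. y D \<noteq> 0}"]) auto

lemma finsupp_diff [simp]: "finsupp x \<Longrightarrow> finsupp y \<Longrightarrow> finsupp (x - y)"
  unfolding finsupp_def by (rule finite_subset[of _ "{D. x D \<noteq> 0} \<union> {D. y D \<noteq> 0}"]) auto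

lemma finsupp_scale [simp]: "finsupp x \<Longrightarrow> finsupp (scale c x)"
  unfolding finsupp_def by (rule finite_subset[of _ "{D. x D \<noteq> 0}"]) auto

lemma finsupp_sum [simp]: "(\<And>i. i \<in> A \<Longrightarrow> finsupp (f i)) \<Longrightarrow> finsupp (sum f A)"
  by (induction A rule: infinite_finite_induct) auto

lemma finsupp_sum_mset [simp]: "(\<And>i. i \<in># M \<Longrightarrow> finsupp (f i)) \<Longrightarrow> finsupp (\<Sum>i\<in>#M. f i)"
  by (induction M) auto

lemma lin_sum_mset:
  "(\<And>i. i \<in># M \<Longrightarrow> finsupp (f i)) \<Longrightarrow> lin F (\<Sum>i\<in>#M. f i) = (\<Sum>i\<in>#M. lin F (f i))"
  by (induction M) (simp_all add: lin_add locfin_finsupp)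

lemma comb_expand:
  assumes "finsupp x"
  shows "x = (\<Sum>D | x D \<noteq> 0. scale (x D) (basis D))"
proof
  fix E
  have "(\<Sum>D | x D \<noteq> 0. scale (x D) (basis D)) E = (\<Sum>D | x D \<noteq> 0. if E = D then x E else 0)"
    by (auto simp: sum_fun_apply basis_def intro: sum.cong)
  then show "x E = (\<Sum>D | x D \<noteq> 0. scale (x D) (basis D)) E"
    using assms by (auto simp: finsupp_def)
qed

text \<open>The target of \<open>F\<close> may be any function space, so that the lemma also covers functionals.\<close>

lemma lin_span:
  assumes "x \<in> comb.span G" "\<And>g. g \<in> G \<Longrightarrow> finsupp g \<and> T (lin F g)"
    and "T 0" "\<And>a b. T a \<Longrightarrow> T b \<Longrightarrow> T (a + b)" "\<And>c a. T a \<Longrightarrow> T (\<lambda>E. c * a E)"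
  shows "finsupp x \<and> T (lin F x)"
  using assms(1)
proof (induction rule: comb.span_induct_alt)
  case base
  show ?case using assms(3) by (simp flip: zero_fun_def)
next
  case (step c g y)
  then have "lin F (scale c g + y) = (\<lambda>E. c * lin F g E) + lin F y"
    using assms(2) by (simp add: lin_add locfin_finsupp lin_scale)
  moreover have "T ((\<lambda>E. c * lin F g E) + lin F y)"
    by (rule assms(4)[OF assms(5)]) (use assms(2) step in blast)+
  moreover have "finsupp (scale c g + y)" using step assms(2) by simp
  moreover have "(\<lambda>a. c * g a + y a) = scale c g + y" by auto
  ultimately show ?case by (simp only: simp_thms)
qed

lemma lin_span_span:
  assumes "x \<in> comb.span G" "\<And>g. g \<in> G \<Longrightarrow> finsupp g" "\<And>g. g \<in> G \<Longrightarrow> lin F g \<in> comb.span G'"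
  shows "lin F x \<in> comb.span G'"
proof -
  have *: "(\<lambda>E. c * a E) = scale c a" for c and a :: "'b comb" by (simp add: scale_def)
  show ?thesis
    using lin_span[of x G "\<lambda>y. y \<in> comb.span G'" F] assms
    by (auto simp: * comb.span_zero comb.span_add comb.span_scale)
qed

lemma lin_expand:
  assumes "finsupp x"
  shows "lin F x = (\<Sum>D | x D \<noteq> 0. scale (x D) (F D))"
proof
  fix E
  have "lin F x E = (\<Sum>D | x D \<noteq> 0. x D * F D E)"
    using assms by (intro lin_eval) (auto simp: finsupp_def)
  then show "lin F x E = (\<Sum>D | x D \<noteq> 0. scale (x D) (F D)) E"
    by (simp add: sum_fun_apply)
qed

lemma finsupp_lin:
  assumes "finsupp x" "\<And>D. x D \<noteq> 0 \<Longrightarrow> finsupp (F D)"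
  shows "finsupp (lin F x)"
  unfolding lin_expand[OF assms(1)] using assms(2) by (intro finsupp_sum finsupp_scale) auto

lemma lin_sum:
  "(\<And>i. i \<in> A \<Longrightarrow> finsupp (f i)) \<Longrightarrow> lin F (sum f A) = (\<Sum>i\<in>A. lin F (f i))"
  by (induction A rule: infinite_finite_induct) (simp_all add: lin_add locfin_finsupp)

lemma lin_lin:
  assumes "finsupp x" "\<And>D. x D \<noteq> 0 \<Longrightarrow> finsupp (G D)"
  shows "lin F (lin G x) = lin (\<lambda>D. lin F (G D)) x"
proof
  fix E
  have "lin F (lin G x) E = (\<Sum>D | x D \<noteq> 0. lin F (scale (x D) (G D)) E)"
    unfolding lin_expand[OF assms(1), of G] using assms(2)
    by (subst lin_sum) (auto simp: sum_fun_apply)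
  also have "\<dots> = (\<Sum>D | x D \<noteq> 0. x D * lin F (G D) E)" by (simp add: lin_scale)
  also have "\<dots> = lin (\<lambda>D. lin F (G D)) x E"
    using assms by (intro lin_eval[symmetric]) (auto simp: finsupp_def)
  finally show "lin F (lin G x) E = \<dots>" .
qed

lemma lin_diff_fun:
  assumes "finsupp x"
  shows "lin F x - lin G x = lin (\<lambda>D. F D - G D) x"
proof
  fix E
  have "finite {D. x D \<noteq> 0}" using assms by (simp add: finsupp_def)
  then show "(lin F x - lin G x) E = lin (\<lambda>D. F D - G D) x E"
    by (subst fun_diff_def, subst (1 2 3) lin_eval[where A = "{D. x D \<noteq> 0}"])
       (auto simp: sum_subtractf[symmetric] algebra_simps)
qed

lemma lin_id:
  assumes "finsupp x" "\<And>D. x D \<noteq> 0 \<Longrightarrow> F D = basis D"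
  shows "lin F x = x"
  using comb_expand[OF assms(1)] assms by (auto simp: lin_expand intro: trans[OF sum.cong])

lemma lin_in_span:
  assumes "finsupp x" "\<And>D. x D \<noteq> 0 \<Longrightarrow> F D \<in> comb.span G"
  shows "lin F x \<in> comb.span G"
  using assms by (auto simp: lin_expand intro!: comb.span_sum comb.span_scale)

definition total :: "'l diag multiset \<Rightarrow> 'l comb" where
  "total M = (\<Sum>D\<in>#M. basis D)"

lemma total_apply: "total M E = of_nat (count M E)"
  by (induction M) (auto simp: total_def basis_def)

lemma finsupp_total [simp]: "finsupp (total M)"
  by (simp add: total_def)

lemma lin_ext_eq_lin: "lin_ext F = lin (\<lambda>D. total (F D))"
  by (auto simp: lin_ext_def lin_def total_apply fun_eq_iff intro!: sum.cong)

lemma total_single [simp]: "total {#D#} = basis D"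
  by (simp add: total_def)

lemma lin_total: "lin F (total M) = (\<Sum>D\<in>#M. F D)"
  by (simp add: total_def lin_sum_mset)

lemma total_sum_mset: "total (\<Sum>i\<in>#M. f i) = (\<Sum>i\<in>#M. total (f i))"
  by (induction M) (auto simp: total_def)

section \<open>Quotients of chains\<close>

lemma degree_part_zero [simp]: "degree_part d 0 = 0"
  by (auto simp: degree_part_def fun_eq_iff)

lemma degree_part_add: "degree_part d (x + y) = degree_part d x + degree_part d y"
  and degree_part_diff: "degree_part d (x - y) = degree_part d x - degree_part d y"
  and degree_part_uminus: "degree_part d (- x) = - degree_part d x"
  and degree_part_scale: "degree_part d (scale c x) = scale c (degree_part d x)"
  by (auto simp: degree_part_def fun_eq_iff)

lemma chains_add: "x \<in> chains L \<Longrightarrow> y \<in> chains L \<Longrightarrow> x + y \<in> chains L"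
  unfolding chains_def
  by (auto intro: finite_subset[of _ "{D. x D \<noteq> 0 \<and> degree D = d} \<union> {D. y D \<noteq> 0 \<and> degree D = d}" for d])
     (metis add.right_neutral)

lemma chains_scale: "x \<in> chains L \<Longrightarrow> scale c x \<in> chains L"
  unfolding chains_def
  by (auto intro: finite_subset[of _ "{D. x D \<noteq> 0 \<and> degree D = d}" for d])

lemma chains_diff: "x \<in> chains L \<Longrightarrow> y \<in> chains L \<Longrightarrow> x - y \<in> chains L"
  using chains_add[of x L "scale (- 1) y"] chains_scale[of y L "- 1"]
  by (simp add: scale_def fun_diff_def plus_fun_def)

lemma finsupp_degree_part: "x \<in> chains L \<Longrightarrow> finsupp (degree_part d x)"
  unfolding chains_def finsupp_def degree_part_def
  by (auto elim!: allE[of _ d] rev_finite_subset)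

lemma degree_part_arrow: "x \<in> chains L \<Longrightarrow> degree_part d x D \<noteq> 0 \<Longrightarrow> arrow_diagram L D \<and> degree D = d"
  by (auto simp: chains_def degree_part_def split: if_splits)

lemma chains_basis: "arrow_diagram L D \<Longrightarrow> basis D \<in> chains L"
  by (auto simp: chains_def basis_def)

lemma equiv_mod_relators: "equiv (chains L) (mod_relators L G)"
proof (rule equivI)
  show "mod_relators L G \<subseteq> chains L \<times> chains L" by (auto simp: mod_relators_def)
  show "refl_on (chains L) (mod_relators L G)"
    by (auto simp: refl_on_def mod_relators_def comb.span_zero)
  show "sym (mod_relators L G)"
  proof (rule symI)
    fix x y assume "(x, y) \<in> mod_relators L G"
    then show "(y, x) \<in> mod_relators L G"
      using comb.span_neg[of "degree_part d (x - y)" for d]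
      by (auto simp: mod_relators_def degree_part_uminus[symmetric])
  qed
  show "trans (mod_relators L G)"
  proof (rule transI)
    fix x y z assume "(x, y) \<in> mod_relators L G" "(y, z) \<in> mod_relators L G"
    then show "(x, z) \<in> mod_relators L G"
      using comb.span_add[of "degree_part d (x - y)" _ "degree_part d (y - z)" for d]
      by (auto simp: mod_relators_def degree_part_add[symmetric])
  qed
qed

lemma mod_relators_add:
  "(x, x') \<in> mod_relators L G \<Longrightarrow> (y, y') \<in> mod_relators L G \<Longrightarrow> (x + y, x' + y') \<in> mod_relators L G"
  using comb.span_add[of "degree_part d (x - x')" _ "degree_part d (y - y')" for d]
  by (auto simp: mod_relators_def chains_add degree_part_add degree_part_diff algebra_simps)

lemma mod_relators_scale:
  "(x, x') \<in> mod_relators L G \<Longrightarrow> (scale c x, scale c x') \<in> mod_relators L G"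
  using comb.span_scale[of "degree_part d (x - x')" _ c for d]
  by (auto simp: mod_relators_def chains_scale degree_part_scale[symmetric] comb.scale_right_diff_distrib)

definition homogeneous :: "'l set \<Rightarrow> 'm set \<Rightarrow> ('l diag \<Rightarrow> 'm comb) \<Rightarrow> bool" where
  "homogeneous L L' F \<longleftrightarrow>
     (\<forall>D. arrow_diagram L D \<longrightarrow> finsupp (F D) \<and>
        (\<forall>E. F D E \<noteq> 0 \<longrightarrow> arrow_diagram L' E \<and> degree E = degree D))"

lemma locfin_chains:
  assumes "homogeneous L L' F" "x \<in> chains L"
  shows "locfin F x"
  unfolding locfin_def
proof
  fix E
  have "{D. x D \<noteq> 0 \<and> F D E \<noteq> 0} \<subseteq> {D. x D \<noteq> 0 \<and> degree D = degree E}"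
    using assms by (fastforce simp: homogeneous_def chains_def)
  then show "finite {D. x D \<noteq> 0 \<and> F D E \<noteq> 0}"
    by (rule finite_subset) (use assms(2) in \<open>simp add: chains_def\<close>)
qed

lemma lin_degree_part:
  assumes "homogeneous L L' F" "x \<in> chains L"
  shows "degree_part d (lin F x) = lin F (degree_part d x)"
proof
  fix E
  have *: "x D \<noteq> 0 \<Longrightarrow> F D E \<noteq> 0 \<Longrightarrow> degree D = degree E" for D
    using assms by (fastforce simp: homogeneous_def chains_def)
  show "degree_part d (lin F x) E = lin F (degree_part d x) E"
  proof (cases "degree E = d")
    case True
    then have "{D. degree_part d x D \<noteq> 0 \<and> F D E \<noteq> 0} = {D. x D \<noteq> 0 \<and> F D E \<noteq> 0}"
      using * by (auto simp: degree_part_def)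
    then show ?thesis using True *
      by (auto simp: degree_part_def lin_def intro!: sum.cong)
  next
    case False
    have "\<not> (degree_part d x D \<noteq> 0 \<and> F D E \<noteq> 0)" for D
    proof
      assume "degree_part d x D \<noteq> 0 \<and> F D E \<noteq> 0"
      then have "degree D = d" "x D \<noteq> 0" "F D E \<noteq> 0"
        by (auto simp: degree_part_def split: if_splits)
      with *[of D] False show False by simp
    qed
    then have "{D. degree_part d x D \<noteq> 0 \<and> F D E \<noteq> 0} = {}" by blast
    then have "lin F (degree_part d x) E = 0" unfolding lin_def by (simp only: sum.empty)
    then show ?thesis using False by (simp add: degree_part_def)
  qed
qed

lemma lin_chains:
  assumes "homogeneous L L' F" "x \<in> chains L"
  shows "lin F x \<in> chains L'"
proof -
  have "arrow_diagram L' E" if "lin F x E \<noteq> 0" for E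
  proof -
    have "{D. x D \<noteq> 0 \<and> F D E \<noteq> 0} \<noteq> {}"
      using that unfolding lin_def by (metis (no_types, lifting) sum.empty)
    then obtain D where "x D \<noteq> 0" "F D E \<noteq> 0" by auto
    then show ?thesis using assms by (auto simp: homogeneous_def chains_def)
  qed
  moreover have "finite {E. lin F x E \<noteq> 0 \<and> degree E = d}" for d
  proof -
    have "finsupp (lin F (degree_part d x))"
      using assms(1) degree_part_arrow[OF assms(2), of d]
      by (intro finsupp_lin finsupp_degree_part[OF assms(2)]) (auto simp: homogeneous_def)
    then have "finsupp (degree_part d (lin F x))" using lin_degree_part[OF assms] by simp
    then show ?thesis by (auto simp: finsupp_def degree_part_def elim: rev_finite_subset)
  qed
  ultimately show ?thesis by (auto simp: chains_def)
qed

lemma lin_mod_relators: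
  assumes "homogeneous L L' F" "(x, y) \<in> mod_relators L G"
    and "\<And>z. z \<in> comb.span G \<Longrightarrow> lin F z \<in> comb.span G'"
  shows "(lin F x, lin F y) \<in> mod_relators L' G'"
  using assms
  by (auto simp: mod_relators_def lin_chains lin_diff[symmetric, OF locfin_chains locfin_chains]
      lin_degree_part[OF assms(1)] chains_diff)

lemma mod_relatorsI_lin:
  assumes "homogeneous L L' F" "homogeneous L L' F'" "x \<in> chains L"
    and "\<And>D. arrow_diagram L D \<Longrightarrow> x D \<noteq> 0 \<Longrightarrow> F D - F' D \<in> comb.span G"
  shows "(lin F x, lin F' x) \<in> mod_relators L' G"
proof -
  have "degree_part d (lin F x - lin F' x) \<in> comb.span G" for d
  proof -
    have "degree_part d (lin F x - lin F' x) = lin (\<lambda>D. F D - F' D) (degree_part d x)"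
      using assms by (simp add: degree_part_diff lin_degree_part lin_diff_fun finsupp_degree_part)
    also have "\<dots> \<in> comb.span G"
      using assms(3,4)
      by (intro lin_in_span finsupp_degree_part) (auto simp: chains_def degree_part_def split: if_splits)
    finally show ?thesis .
  qed
  then show ?thesis using assms by (auto simp: mod_relators_def lin_chains)
qed

lemmas pointwise = plus_fun_apply zero_fun_apply minus_apply uminus_apply scale_apply

text \<open>With these as simp rules, sums of combinations get eta-expanded and escape the span rules.\<close>

declare pointwise [simp del]

lemma sum_mset_diff: "(\<Sum>x\<in>#M. f x) - (\<Sum>x\<in>#M. g x) = (\<Sum>x\<in>#M. f x - g x)"
  for f g :: "'z \<Rightarrow> 'l comb"
  by (induction M) (simp_all add: algebra_simps)

lemma homogeneous_basis: "homogeneous L L basis"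
  unfolding homogeneous_def using finsupp_basis by (auto simp: basis_def)

section \<open>Ends of a diagram\<close>

definition ends :: "'l set \<Rightarrow> ('l \<Rightarrow> endpoint list) \<Rightarrow> endpoint multiset" where
  "ends L w = (\<Sum>l\<in>L. mset (w l))"

definition vanishing :: "'l set \<Rightarrow> ('l \<Rightarrow> endpoint list) \<Rightarrow> bool" where
  "vanishing L w \<longleftrightarrow> (\<forall>l. l \<notin> L \<longrightarrow> w l = [])"

lemma vanishing_simps [simp]:
  "vanishing L w \<Longrightarrow> l \<notin> L \<Longrightarrow> w l = []"
  "arrow_diagram L D \<Longrightarrow> vanishing L (strands D)"
  by (auto simp: vanishing_def arrow_diagram_def)

lemma in_ends: "finite L \<Longrightarrow> vanishing L w \<Longrightarrow> x \<in># ends L w \<longleftrightarrow> (\<exists>l. x \<in> set (w l))"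
  unfolding ends_def vanishing_def by (auto simp: set_mset_sum)

lemma on_skeleton_ends:
  "finite L \<Longrightarrow> vanishing L w \<Longrightarrow>
     on_skeleton (Diag w V) = {e. Head e \<in># ends L w \<or> Tail e \<in># ends L w}"
  by (auto simp: on_skeleton_def in_ends)

lemma count_list_ends: "(\<Sum>l\<in>L. count_list (w l) x) = count (ends L w) x"
  by (simp add: ends_def count_sum count_mset)

lemma degree_ends:
  assumes "finite L" "vanishing L w"
  shows "degree (Diag w V) = (size (ends L w) + card V) div 2"
proof -
  have "{l. w l \<noteq> []} \<subseteq> L" using assms(2) by (auto simp: vanishing_def)
  then have "(\<Sum>l | w l \<noteq> []. length (w l)) = (\<Sum>l\<in>L. length (w l))"
    using assms(1) by (intro sum.mono_neutral_left) auto
  then show ?thesis by (simp add: degree_def ends_def size_multiset_sum)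
qed

context
  fixes L :: "'l set" and L' :: "'m set" and w w'
  assumes fin: "finite L" "finite L'" and van: "vanishing L w" "vanishing L' w'"
    and eq: "ends L' w' = ends L w"
begin

lemma edges_cong_ends: "edges (Diag w' V) = edges (Diag w V)"
  using on_skeleton_ends[OF fin(1) van(1)] on_skeleton_ends[OF fin(2) van(2)] eq
  by (simp add: edges_def)

lemma arrow_diagram_cong_ends: "arrow_diagram L' (Diag w' V) \<longleftrightarrow> arrow_diagram L (Diag w V)"
  using on_skeleton_ends[OF fin(1) van(1), of V] on_skeleton_ends[OF fin(2) van(2), of V] eq van
    edges_cong_ends[of V]
  by (simp add: arrow_diagram_def departures_def arrivals_def count_list_ends vanishing_def
      adjacent_edges_def)

lemma degree_cong_ends: "degree (Diag w' V) = degree (Diag w V)"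
  using fin van eq by (simp add: degree_ends)

end

lemma ends_insert [simp]: "finite L \<Longrightarrow> l \<notin> L \<Longrightarrow> ends (insert l L) w = mset (w l) + ends L w"
  by (simp add: ends_def)

lemma ends_update [simp]: "l \<notin> L \<Longrightarrow> ends L (w(l := m)) = ends L w"
  unfolding ends_def by (intro sum.cong) auto

lemma ends_update_perm:
  assumes "mset m = mset (w l)"
  shows "ends L (w(l := m)) = ends L w"
  using assms unfolding ends_def by (intro sum.cong) auto

lemma vanishing_update: "vanishing L w \<Longrightarrow> l \<in> L \<Longrightarrow> vanishing L (w(l := m))"
  by (auto simp: vanishing_def)

lemma edges_update_perm:
  assumes "mset m = mset (w l)"
  shows "edges (Diag (w(l := m)) V) = edges (Diag w V)"
proof -
  have "set m = set (w l)" using assms by (metis set_mset_mset)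
  then have "set ((w(l := m)) l') = set (w l')" for l' by auto
  then show ?thesis by (simp add: edges_def on_skeleton_def)
qed

lemma arrow_diagram_update_perm:
  assumes "mset m = mset (w l)"
  shows "arrow_diagram L (Diag (w(l := m)) V) \<longleftrightarrow> arrow_diagram L (Diag w V)"
proof -
  have 1: "set m = set (w l)" using assms by (metis set_mset_mset)
  then have "set ((w(l := m)) l') = set (w l')" for l' by auto
  moreover have "count_list ((w(l := m)) l') x = count_list (w l') x" for l' x
    using assms by (auto simp flip: count_mset)
  moreover have "(w(l := m)) l' = [] \<longleftrightarrow> w l' = []" for l'
    using assms by (auto)
  ultimately show ?thesis
    using edges_update_perm[where w = w and l = l, OF assms, of V]
    by (simp add: arrow_diagram_def departures_def arrivals_def adjacent_edges_def on_skeleton_def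
        del: fun_upd_apply)
qed

lemma degree_update_perm:
  assumes "mset m = mset (w l)"
  shows "degree (Diag (w(l := m)) V) = degree (Diag w V)"
proof -
  have "(w(l := m)) l' = [] \<longleftrightarrow> w l' = []" for l' using assms by auto
  moreover have "length ((w(l := m)) l') = length (w l')" for l'
    using assms by (auto dest: mset_eq_length)
  ultimately show ?thesis by (simp add: degree_def del: fun_upd_apply)
qed

section \<open>Relators with heads and tails killed on some strands\<close>

definition gen_relators :: "'l set \<Rightarrow> 'l set \<Rightarrow> 'l set \<Rightarrow> 'l comb set" where
  "gen_relators L Hs Ts = relators L
     \<union> {basis D |D h e. arrow_diagram L D \<and> h \<in> Hs \<and> Tail e \<in> set (strands D h)}
     \<union> {basis D |D t e us. arrow_diagram L D \<and> t \<in> Ts \<and> strands D t = Head e # us}"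

lemma gen_relators_tail:
  "arrow_diagram L D \<Longrightarrow> h \<in> Hs \<Longrightarrow> Tail e \<in> set (strands D h) \<Longrightarrow> basis D \<in> gen_relators L Hs Ts"
  and gen_relators_head:
  "arrow_diagram L D \<Longrightarrow> t \<in> Ts \<Longrightarrow> strands D t = Head e # us \<Longrightarrow> basis D \<in> gen_relators L Hs Ts"
  unfolding gen_relators_def by blast+

lemma gen_relators_empty [simp]: "gen_relators L {} {} = relators L"
  by (simp add: gen_relators_def)

lemma relators_subset: "relators L \<subseteq> gen_relators L Hs Ts"
  by (auto simp: gen_relators_def)

lemma gen_relators_mono: "Hs \<subseteq> Hs' \<Longrightarrow> Ts \<subseteq> Ts' \<Longrightarrow> gen_relators L Hs Ts \<subseteq> gen_relators L Hs' Ts'"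
  unfolding gen_relators_def by blast

lemma ht_relators_eq: "ht_relators H T = gen_relators (ht H T) (HStr ` H) (TStr ` T)"
proof
  show "ht_relators H T \<subseteq> gen_relators (ht H T) (HStr ` H) (TStr ` T)"
  proof
    fix x assume "x \<in> ht_relators H T"
    then show "x \<in> gen_relators (ht H T) (HStr ` H) (TStr ` T)"
    proof cases
      case aw
      then show ?thesis using relators_subset by blast
    next
      case (tail_on_head_strand D e a)
      then have "a \<in> H" by (fastforce simp: arrow_diagram_def ht_def)
      then show ?thesis using tail_on_head_strand by (auto intro: gen_relators_tail)
    next
      case (CP D a e us)
      then have "a \<in> T" by (fastforce simp: arrow_diagram_def ht_def)
      then show ?thesis using CP by (auto intro: gen_relators_head)
    qed
  qed
  show "gen_relators (ht H T) (HStr ` H) (TStr ` T) \<subseteq> ht_relators H T"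
    by (auto simp: gen_relators_def intro: ht_relators.intros)
qed

lemma finsupp_relators: "g \<in> relators L \<Longrightarrow> finsupp g"
  by (auto elim!: relators.cases)

lemma finsupp_gen_relators: "g \<in> gen_relators L Hs Ts \<Longrightarrow> finsupp g"
  by (auto simp: gen_relators_def finsupp_relators)

text \<open>The common shape of \<open>STU1\<close> and \<open>STU2\<close>.\<close>

inductive bracket :: "endpoint \<Rightarrow> endpoint \<Rightarrow> endpoint \<Rightarrow> nat \<times> nat \<times> nat \<Rightarrow> nat \<Rightarrow> bool" where
  "bracket (Head p) (Head q) (Head r) (p, q, r) r"
| "bracket (Head p) (Tail e) (Tail f) (f, p, e) f"

lemma STU_relator:
  assumes "bracket x y z v r" "arrow_diagram L (Diag w V)" "w a = us @ [x, y] @ vs" "r \<notin> edges (Diag w V)"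
  shows "basis (Diag w V) - basis (Diag (w(a := us @ [y, x] @ vs)) V)
    - basis (Diag (w(a := us @ [z] @ vs)) (insert v V)) \<in> relators L"
  using assms by (cases) (auto intro: relators.STU1[simplified] relators.STU2[simplified])

lemma STU_span:
  assumes "bracket x y z v r" "arrow_diagram L (Diag w V)" "w a = us @ [x, y] @ vs" "r \<notin> edges (Diag w V)"
    and "w1 = w(a := us @ [y, x] @ vs)" "w2 = w(a := us @ [z] @ vs)"
  shows "basis (Diag w V) - basis (Diag w1 V) - basis (Diag w2 (insert v V)) \<in> comb.span (relators L)"
  using STU_relator[OF assms(1-4)] assms(5,6) by (simp add: comb.span_base)

lemma TC_span:
  assumes "arrow_diagram L (Diag w V)" "w a = us @ [Tail d, Tail e] @ vs"
    and "w1 = w(a := us @ [Tail e, Tail d] @ vs)"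
  shows "basis (Diag w V) - basis (Diag w1 V) \<in> comb.span (relators L)"
  using relators.TC[OF assms(1-2)] assms(3) by (simp add: comb.span_base)

lemma relators_STU_cases [consumes 1, case_names iso AS IHX STU TC]:
  assumes "g \<in> relators L"
  obtains D f where "g = basis D - basis (rename f D)" "arrow_diagram L D" "inj f"
  | w p q r V where "g = basis (Diag w (insert (p, q, r) V)) + basis (Diag w (insert (q, p, r) V))"
      "arrow_diagram L (Diag w (insert (p, q, r) V))" "(p, q, r) \<notin> V"
  | w p q m r e V where "g = basis (Diag w ({(p, q, m), (m, r, e)} \<union> V))
        + basis (Diag w ({(q, r, m), (m, p, e)} \<union> V)) + basis (Diag w ({(r, p, m), (m, q, e)} \<union> V))"
      "arrow_diagram L (Diag w ({(p, q, m), (m, r, e)} \<union> V))" "m \<noteq> e" "(p, q, m) \<notin> V" "(m, r, e) \<notin> V"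
  | x y z v w V a us vs r where "g = basis (Diag w V) - basis (Diag (w(a := us @ [y, x] @ vs)) V)
        - basis (Diag (w(a := us @ [z] @ vs)) (insert v V))"
      "bracket x y z v r" "arrow_diagram L (Diag w V)" "w a = us @ [x, y] @ vs" "r \<notin> edges (Diag w V)"
  | w V a us d e vs where "g = basis (Diag w V) - basis (Diag (w(a := us @ [Tail e, Tail d] @ vs)) V)"
      "arrow_diagram L (Diag w V)" "w a = us @ [Tail d, Tail e] @ vs"
  using assms by (cases; metis bracket.intros)

section \<open>Strand operations\<close>

text \<open>
  A strand operation rewrites the strands of a diagram into a formal combination, keeping its
  vertices. Outside the active strands \<open>A\<close> nothing happens.
\<close>

definition strand_op :: "(('l \<Rightarrow> endpoint list) \<Rightarrow> (rat \<times> ('l \<Rightarrow> endpoint list)) multiset) \<Rightarrow> 'l diag \<Rightarrow> 'l comb" where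
  "strand_op \<phi> D = (\<Sum>(c, w)\<in>#\<phi> (strands D). scale c (basis (Diag w (verts D))))"

locale strand_operation =
  fixes L L' A :: "'l set"
    and \<phi> :: "('l \<Rightarrow> endpoint list) \<Rightarrow> (rat \<times> ('l \<Rightarrow> endpoint list)) multiset"
  assumes finL: "finite L" "finite L'"
    and sub: "L - A \<subseteq> L'"
    and vanishing: "vanishing L w \<Longrightarrow> (c, w') \<in># \<phi> w \<Longrightarrow> vanishing L' w'"
    and ends: "vanishing L w \<Longrightarrow> (c, w') \<in># \<phi> w \<Longrightarrow> ends L' w' = ends L w"
    and rename: "\<phi> (\<lambda>l. map (rename_end f) (w l)) = image_mset (\<lambda>(c, w'). (c, \<lambda>l. map (rename_end f) (w' l))) (\<phi> w)"
    and inactive: "x \<in> L \<Longrightarrow> x \<notin> A \<Longrightarrow> \<phi> (w(x := m)) = image_mset (\<lambda>(c, w'). (c, w'(x := m))) (\<phi> w)"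
begin

lemma inactive_eq: "x \<in> L \<Longrightarrow> x \<notin> A \<Longrightarrow> (c, w') \<in># \<phi> w \<Longrightarrow> w' x = w x"
proof -
  assume a: "x \<in> L" "x \<notin> A" "(c, w') \<in># \<phi> w"
  then have "(c, w') \<in># image_mset (\<lambda>(c, w'). (c, w'(x := w x))) (\<phi> w)"
    using inactive[of x w "w x"] by simp
  then show "w' x = w x" by auto
qed

lemma arrow:
  assumes "arrow_diagram L (Diag w V)" "(c, w') \<in># \<phi> w"
  shows "arrow_diagram L' (Diag w' V)"
proof -
  have "vanishing L w" using vanishing_simps(2)[OF assms(1)] by simp
  then show ?thesis
    using arrow_diagram_cong_ends[OF finL _ vanishing ends] assms by blast
qed

lemma edges:
  assumes "vanishing L w" "(c, w') \<in># \<phi> w"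
  shows "edges (Diag w' V) = edges (Diag w V)"
  using edges_cong_ends[OF finL _ vanishing ends] assms by blast

lemma degree:
  assumes "vanishing L w" "(c, w') \<in># \<phi> w"
  shows "degree (Diag w' V) = degree (Diag w V)"
  using degree_cong_ends[OF finL _ vanishing ends] assms by blast

lemma finsupp [simp]: "finsupp (strand_op \<phi> D)"
  by (simp add: strand_op_def case_prod_unfold)

lemma support:
  assumes "strand_op \<phi> D E \<noteq> 0"
  obtains c w where "(c, w) \<in># \<phi> (strands D)" "E = Diag w (verts D)"
proof -
  have "\<exists>(c, w)\<in>#M. E = Diag w (verts D)"
    if "(\<Sum>(c, w)\<in>#M. scale c (basis (Diag w (verts D)))) E \<noteq> 0" for M
    using that by (induction M) (auto simp: basis_def pointwise split: if_splits)
  then show thesis using assms that unfolding strand_op_def by blast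
qed

lemma homogeneous: "homogeneous L L' (strand_op \<phi>)"
  unfolding homogeneous_def
proof (intro allI impI conjI)
  fix D E assume D: "arrow_diagram L D" "strand_op \<phi> D E \<noteq> 0"
  then obtain c w where w: "(c, w) \<in># \<phi> (strands D)" "E = Diag w (verts D)" by (elim support)
  show "arrow_diagram L' E" using D w arrow[of "strands D" "verts D"] by simp
  show "degree E = degree D" using D w degree[of "strands D" c w "verts D"] by simp
qed simp

lemma lin_relator_lift:
  assumes "\<And>c w'. (c, w') \<in># \<phi> w \<Longrightarrow> K w' \<in> comb.span G"
  shows "(\<Sum>(c, w')\<in>#\<phi> w. scale c (K w')) \<in> comb.span G"
proof -
  have "(\<Sum>(c, w')\<in>#M. scale c (K w')) \<in> comb.span G" if "set_mset M \<subseteq> set_mset (\<phi> w)" for M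
    using that by (induction M) (auto intro!: comb.span_zero comb.span_add comb.span_scale assms)
  then show ?thesis by blast
qed

lemma lin_relators:
  assumes STU: "\<And>x y z v r w V a us vs. bracket x y z v r \<Longrightarrow> arrow_diagram L (Diag w V) \<Longrightarrow> a \<in> A \<Longrightarrow> a \<in> L \<Longrightarrow>
        w a = us @ [x, y] @ vs \<Longrightarrow> r \<notin> edges (Diag w V) \<Longrightarrow>
        strand_op \<phi> (Diag w V) - strand_op \<phi> (Diag (w(a := us @ [y, x] @ vs)) V)
          - strand_op \<phi> (Diag (w(a := us @ [z] @ vs)) (insert v V)) \<in> comb.span (relators L')"
    and TC: "\<And>w V x us d e vs. arrow_diagram L (Diag w V) \<Longrightarrow> x \<in> A \<Longrightarrow> x \<in> L \<Longrightarrow>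
        w x = us @ [Tail d, Tail e] @ vs \<Longrightarrow>
        strand_op \<phi> (Diag w V) - strand_op \<phi> (Diag (w(x := us @ [Tail e, Tail d] @ vs)) V)
          \<in> comb.span (relators L')"
    and g: "g \<in> relators L"
  shows "lin (strand_op \<phi>) g \<in> comb.span (relators L')"
proof -
  have xL: "x \<in> L" if "arrow_diagram L (Diag w V)" "w x \<noteq> []" for w V x
    using vanishing_simps(2)[OF that(1)] that(2) by (auto simp: vanishing_def)
  note lsimps = lin_add lin_diff locfin_finsupp
  show ?thesis using g
  proof (cases rule: relators_STU_cases)
    case (iso D f)
    have "strand_op \<phi> (rename f D) =
        (\<Sum>(c, w)\<in>#\<phi> (strands D). scale c (basis (rename f (Diag w (verts D)))))"
      by (simp add: strand_op_def rename_def rename image_mset.compositionality comp_def case_prod_unfold)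
    then have "lin (strand_op \<phi>) g =
        (\<Sum>(c, w)\<in>#\<phi> (strands D). scale c (basis (Diag w (verts D)) - basis (rename f (Diag w (verts D)))))"
      by (simp add: iso lsimps strand_op_def sum_mset_diff comb.scale_right_diff_distrib case_prod_unfold)
    also have "\<dots> \<in> comb.span (relators L')"
      using arrow[of "strands D" "verts D"] iso
      by (intro lin_relator_lift comb.span_base relators.iso) auto
    finally show ?thesis .
  next
    case (AS w p q r V)
    have "lin (strand_op \<phi>) g =
        (\<Sum>(c, w)\<in>#\<phi> w. scale c (basis (Diag w (insert (p, q, r) V)) + basis (Diag w (insert (q, p, r) V))))"
      by (simp add: AS lsimps strand_op_def sum_mset.distrib[symmetric] comb.scale_right_distrib case_prod_unfold)
    also have "\<dots> \<in> comb.span (relators L')"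
      using arrow AS by (intro lin_relator_lift comb.span_base relators.AS) auto
    finally show ?thesis .
  next
    case (IHX w p q m r e V)
    have "lin (strand_op \<phi>) g =
        (\<Sum>(c, w)\<in>#\<phi> w. scale c (basis (Diag w ({(p, q, m), (m, r, e)} \<union> V))
          + basis (Diag w ({(q, r, m), (m, p, e)} \<union> V)) + basis (Diag w ({(r, p, m), (m, q, e)} \<union> V))))"
      unfolding IHX
      by (simp add: lsimps strand_op_def sum_mset.distrib[symmetric] comb.scale_right_distrib case_prod_unfold)
    also have "\<dots> \<in> comb.span (relators L')"
      using arrow IHX by (intro lin_relator_lift comb.span_base relators.IHX) auto
    finally show ?thesis .
  next
    case (STU x y z v w V a us vs r)
    have a: "a \<in> L" using xL[of w V a] STU by simp
    show ?thesis
    proof (cases "a \<in> A")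
      case True
      then show ?thesis using assms(1)[of x y z v r w V a us vs] STU a by (simp add: lsimps)
    next
      case False
      have "lin (strand_op \<phi>) g = (\<Sum>(c, w)\<in>#\<phi> w. scale c (basis (Diag w V)
          - basis (Diag (w(a := us @ [y, x] @ vs)) V)
          - basis (Diag (w(a := us @ [z] @ vs)) (insert v V))))"
        unfolding STU
        by (simp add: lsimps strand_op_def inactive[OF a False] image_mset.compositionality comp_def
            sum_mset_diff comb.scale_right_diff_distrib case_prod_unfold)
      also have "\<dots> \<in> comb.span (relators L')"
        using arrow[of w] STU inactive_eq[OF a False, of _ _ w] edges[of w] vanishing_simps(2)[OF STU(3)]
        by (intro lin_relator_lift comb.span_base STU_relator[OF STU(2)]) auto
      finally show ?thesis .
    qed
  next
    case (TC w V a us d e vs)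
    have a: "a \<in> L" using xL[of w V a] TC by simp
    show ?thesis
    proof (cases "a \<in> A")
      case True
      then show ?thesis using assms(2)[of w V a us d e vs] TC a by (simp add: lsimps)
    next
      case False
      have "lin (strand_op \<phi>) g = (\<Sum>(c, w)\<in>#\<phi> w. scale c (basis (Diag w V)
          - basis (Diag (w(a := us @ [Tail e, Tail d] @ vs)) V)))"
        unfolding TC
        by (simp add: lsimps strand_op_def inactive[OF a False] image_mset.compositionality comp_def
            sum_mset_diff comb.scale_right_diff_distrib case_prod_unfold)
      also have "\<dots> \<in> comb.span (relators L')"
        using arrow[of w] TC inactive_eq[OF a False, of _ _ w]
        by (intro lin_relator_lift comb.span_base relators.TC) auto
      finally show ?thesis .
    qed
  qed
qed

lemma lin_gen_relators:
  assumes rel: "\<And>g. g \<in> relators L \<Longrightarrow> lin (strand_op \<phi>) g \<in> comb.span (relators L')"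
    and killed: "\<And>D h e. arrow_diagram L D \<Longrightarrow> h \<in> Hs \<inter> A \<Longrightarrow> Tail e \<in> set (strands D h) \<Longrightarrow> strand_op \<phi> D = 0"
      "\<And>D t e us. arrow_diagram L D \<Longrightarrow> t \<in> Ts \<inter> A \<Longrightarrow> strands D t = Head e # us \<Longrightarrow> strand_op \<phi> D = 0"
    and z: "z \<in> comb.span (gen_relators L Hs Ts)"
  shows "lin (strand_op \<phi>) z \<in> comb.span (gen_relators L' (Hs - A) (Ts - A))"
  using z
proof (rule lin_span_span)
  let ?G = "gen_relators L' (Hs - A) (Ts - A)"
  fix g assume "g \<in> gen_relators L Hs Ts"
  then consider "g \<in> relators L"
    | D h e where "g = basis D" "arrow_diagram L D" "h \<in> Hs" "Tail e \<in> set (strands D h)"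
    | D t e us where "g = basis D" "arrow_diagram L D" "t \<in> Ts" "strands D t = Head e # us"
    by (auto simp: gen_relators_def)
  then show "lin (strand_op \<phi>) g \<in> comb.span ?G"
  proof cases
    case 1
    then show ?thesis using rel comb.span_mono[OF relators_subset] by blast
  next
    case 2
    then have h: "h \<in> L" by (cases "h \<in> L") (auto simp: arrow_diagram_def)
    show ?thesis
    proof (cases "h \<in> A")
      case True
      then show ?thesis using killed(1)[of D h e] 2 by (simp add: comb.span_zero)
    next
      case False
      show ?thesis unfolding 2 lin_basis strand_op_def
      proof (intro lin_relator_lift comb.span_base)
        fix c w assume w: "(c, w) \<in># \<phi> (strands D)"
        show "basis (Diag w (verts D)) \<in> ?G"
          using arrow[of "strands D" "verts D", OF _ w] inactive_eq[OF h False w] 2 False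
          by (auto simp: gen_relators_def intro!: exI[of _ h] exI[of _ e])
      qed
    qed
  next
    case 3
    then have h: "t \<in> L" by (cases "t \<in> L") (auto simp: arrow_diagram_def)
    show ?thesis
    proof (cases "t \<in> A")
      case True
      then show ?thesis using killed(2)[of D t e us] 3 by (simp add: comb.span_zero)
    next
      case False
      show ?thesis unfolding 3 lin_basis strand_op_def
      proof (intro lin_relator_lift comb.span_base)
        fix c w assume w: "(c, w) \<in># \<phi> (strands D)"
        show "basis (Diag w (verts D)) \<in> ?G"
          using arrow[of "strands D" "verts D", OF _ w] inactive_eq[OF h False w] 3 False
          by (auto simp: gen_relators_def intro!: exI[of _ t] exI[of _ e])
      qed
    qed
  qed
qed (rule finsupp_gen_relators)

end

section \<open>Distributing the ends of a strand\<close>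

fun lifts :: "'e list \<Rightarrow> ('e list \<times> 'e list) multiset" where
  "lifts [] = {#([], [])#}"
| "lifts (x # xs) = {#(x # fst p, snd p). p \<in># lifts xs#} + {#(fst p, x # snd p). p \<in># lifts xs#}"

lemma lifts_mset: "p \<in># lifts w \<Longrightarrow> mset (fst p) + mset (snd p) = mset w"
  by (induction w arbitrary: p) auto

lemma lifts_map: "lifts (map g w) = {#(map g (fst p), map g (snd p)). p \<in># lifts w#}"
  by (induction w) (simp_all add: image_mset.compositionality comp_def)

lemma sum_lifts_append:
  "(\<Sum>p\<in>#lifts (xs @ ys). F p) =
     (\<Sum>p\<in>#lifts xs. \<Sum>q\<in>#lifts ys. F (fst p @ fst q, snd p @ snd q))"
  for F :: "_ \<Rightarrow> 'c :: comm_monoid_add"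
  by (induction xs arbitrary: F) (simp_all add: image_mset.compositionality comp_def)

lemma sum_lifts_mid:
  "(\<Sum>p\<in>#lifts (us @ ms @ vs). F p) =
     (\<Sum>p\<in>#lifts us. \<Sum>q\<in>#lifts vs. \<Sum>m\<in>#lifts ms. F (fst p @ fst m @ fst q, snd p @ snd m @ snd q))"
  for F :: "_ \<Rightarrow> 'c :: comm_monoid_add"
  by (simp add: sum_lifts_append) (subst (2) sum_mset.swap, simp)

lemma lifts_nths:
  "{#(nths xs I, nths xs (- I)). I \<in># mset_set (Pow {..<length xs})#} = lifts xs"
proof (induction xs)
  case (Cons x xs)
  let ?P = "Pow {..<length xs}"
  have *: "Pow {..<length (x # xs)} = (\<lambda>I. insert 0 (Suc ` I)) ` ?P \<union> (\<lambda>I. Suc ` I) ` ?P"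
  proof -
    have "{..<length (x # xs)} = insert 0 (Suc ` {..<length xs})"
      by (simp add: lessThan_Suc_eq_insert_0)
    moreover have "Pow (Suc ` {..<length xs}) = (\<lambda>I. Suc ` I) ` ?P" using image_Pow_surj by metis
    ultimately show ?thesis by (simp add: Pow_insert image_image Un_commute)
  qed
  have inj: "inj_on (\<lambda>I. insert 0 (Suc ` I)) ?P" "inj_on (\<lambda>I. Suc ` I) ?P"
    by (auto simp: inj_on_def inj_image_eq_iff insert_eq_iff dest: injD[OF inj_Suc])
  have "mset_set (Pow {..<length (x # xs)}) =
      {#insert 0 (Suc ` I). I \<in># mset_set ?P#} + {#Suc ` I. I \<in># mset_set ?P#}"
    unfolding * using inj by (subst mset_set_Union) (auto simp: image_mset_mset_set)
  then show ?case
    by (simp add: image_mset.compositionality comp_def nths_Cons Cons.IH[symmetric] image_iff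
        Compl_eq[symmetric])
qed simp

lemma span_sum_mset:
  "(\<And>p. p \<in># M \<Longrightarrow> f p \<in> comb.span G) \<Longrightarrow> (\<Sum>p\<in>#M. f p) \<in> comb.span G"
  by (induction M) (auto intro: comb.span_add comb.span_zero)

lemma scale_simps:
  "scale 1 x = x" "scale 0 x = 0" "scale (- c) x = - scale c x" "scale c (scale d x) = scale (c * d) x"
  by (auto simp: fun_eq_iff pointwise)

section \<open>Doubling a strand\<close>

definition dbl :: "'l \<Rightarrow> 'l \<Rightarrow> 'l \<Rightarrow> ('l \<Rightarrow> endpoint list) \<Rightarrow> (rat \<times> ('l \<Rightarrow> endpoint list)) multiset" where
  "dbl a b c w = {#(1, w(a := [], b := fst p, c := snd p)). p \<in># lifts (w a)#}"

lemma strand_op_dbl: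
  "strand_op (dbl a b c) (Diag w V) = (\<Sum>p\<in>#lifts (w a). basis (Diag (w(a := [], b := fst p, c := snd p)) V))"
  by (simp add: strand_op_def dbl_def image_mset.compositionality comp_def scale_simps)

lemma total_dDelta: "total (dDelta a b c D) = strand_op (dbl a b c) D"
  by (simp add: total_def dDelta_def strand_op_def dbl_def lifts_nths[symmetric]
      image_mset.compositionality comp_def scale_simps)

context
  fixes L :: "'l set" and a b c :: 'l
  assumes L: "finite L" "a \<notin> L" "b \<notin> L" "c \<notin> L" "a \<noteq> b" "a \<noteq> c" "b \<noteq> c"
begin

lemma ends_dbl:
  assumes "vanishing (insert a L) w" "mset u + mset v = mset (w a)"
  shows "vanishing (insert b (insert c L)) (w(a := [], b := u, c := v))"
    and "ends (insert b (insert c L)) (w(a := [], b := u, c := v)) = ends (insert a L) w"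
  using L assms by (auto simp: vanishing_def)

lemma strand_operation_dbl: "strand_operation (insert a L) (insert b (insert c L)) {a} (dbl a b c)"
proof
  fix w w' :: "'l \<Rightarrow> endpoint list" and k
  assume w: "vanishing (insert a L) w" "(k, w') \<in># dbl a b c w"
  then obtain p where "p \<in># lifts (w a)" "w' = w(a := [], b := fst p, c := snd p)"
    by (auto simp: dbl_def)
  then show "vanishing (insert b (insert c L)) w'" "ends (insert b (insert c L)) w' = ends (insert a L) w"
    using ends_dbl[OF w(1) lifts_mset] by simp_all
next
  fix w :: "'l \<Rightarrow> endpoint list" and f
  show "dbl a b c (\<lambda>l. map (rename_end f) (w l)) =
    {#case x of (c, w') \<Rightarrow> (c, \<lambda>l. map (rename_end f) (w' l)). x \<in># dbl a b c w#}"
    by (auto simp: dbl_def lifts_map image_mset.compositionality comp_def fun_eq_iff intro!: image_mset_cong)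
next
  fix w :: "'l \<Rightarrow> endpoint list" and x m
  assume "x \<in> insert a L" "x \<notin> {a}"
  then show "dbl a b c (w(x := m)) = {#case y of (k, w') \<Rightarrow> (k, w'(x := m)). y \<in># dbl a b c w#}"
    using L by (auto simp: dbl_def image_mset.compositionality comp_def fun_eq_iff intro!: image_mset_cong)
qed (use L in auto)

lemma arrow_dbl:
  assumes "arrow_diagram (insert a L) (Diag w V)" "mset u + mset v = mset (w a)"
  shows "arrow_diagram (insert b (insert c L)) (Diag (w(a := [], b := u, c := v)) V)"
    and "edges (Diag (w(a := [], b := u, c := v)) V) = edges (Diag w V)"
proof -
  have v: "vanishing (insert a L) w" using vanishing_simps(2)[OF assms(1)] by simp
  have f: "finite (insert a L)" "finite (insert b (insert c L))" using L by auto
  show "arrow_diagram (insert b (insert c L)) (Diag (w(a := [], b := u, c := v)) V)"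
    using arrow_diagram_cong_ends[OF f v ends_dbl[OF v assms(2)]] assms(1) by simp
  show "edges (Diag (w(a := [], b := u, c := v)) V) = edges (Diag w V)"
    using edges_cong_ends[OF f v ends_dbl[OF v assms(2)]] by simp
qed

lemma lin_dbl_relators:
  assumes "g \<in> relators (insert a L)"
  shows "lin (strand_op (dbl a b c)) g \<in> comb.span (relators (insert b (insert c L)))"
proof (rule strand_operation.lin_relators[OF strand_operation_dbl _ _ assms])
  let ?G = "comb.span (relators (insert b (insert c L)))"
  fix w V a' us vs
  assume D: "arrow_diagram (insert a L) (Diag w V)" and "a' \<in> {a}"
  then have a': "a' = a" by simp
  define k where "k V u v = basis (Diag (w(a := [], b := u, c := v)) V)" for V u v
  have K: "strand_op (dbl a b c) (Diag (w(a := us @ ms @ vs)) V) =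
      (\<Sum>P\<in>#lifts us. \<Sum>Q\<in>#lifts vs. \<Sum>M\<in>#lifts ms.
         k V (fst P @ fst M @ fst Q) (snd P @ snd M @ snd Q))" for ms V
    by (simp add: strand_op_dbl sum_lifts_mid k_def)
  have m: "mset us = mset (fst P) + mset (snd P)" "mset vs = mset (fst Q) + mset (snd Q)"
    if "P \<in># lifts us" "Q \<in># lifts vs" for P Q
    using that lifts_mset by metis+
  {
    fix x y z v r
    assume *: "bracket x y z v r" "w a' = us @ [x, y] @ vs" "r \<notin> edges (Diag w V)"
    have w: "w = w(a := us @ [x, y] @ vs)" using * a' by auto
    show "strand_op (dbl a b c) (Diag w V) - strand_op (dbl a b c) (Diag (w(a' := us @ [y, x] @ vs)) V)
          - strand_op (dbl a b c) (Diag (w(a' := us @ [z] @ vs)) (insert v V)) \<in> ?G"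
      unfolding a' K arg_cong[where f = "\<lambda>w. strand_op (dbl a b c) (Diag w V)", OF w] sum_mset_diff
    proof (intro span_sum_mset)
      fix P Q assume PQ: "P \<in># lifts us" "Q \<in># lifts vs"
      have "k V (fst P @ [x, y] @ fst Q) (snd P @ snd Q) - k V (fst P @ [y, x] @ fst Q) (snd P @ snd Q)
          - k (insert v V) (fst P @ [z] @ fst Q) (snd P @ snd Q) \<in> ?G"
        unfolding k_def using * a' m[OF PQ] L
        by (intro STU_span[where a = b, OF *(1)] arrow_dbl[OF D]) (auto simp: arrow_dbl[OF D] fun_eq_iff)
      moreover
      have "k V (fst P @ fst Q) (snd P @ [x, y] @ snd Q) - k V (fst P @ fst Q) (snd P @ [y, x] @ snd Q)
          - k (insert v V) (fst P @ fst Q) (snd P @ [z] @ snd Q) \<in> ?G"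
        unfolding k_def using * a' m[OF PQ] L
        by (intro STU_span[where a = c, OF *(1)] arrow_dbl[OF D]) (auto simp: arrow_dbl[OF D] fun_eq_iff)
      ultimately have "(k V (fst P @ [x, y] @ fst Q) (snd P @ snd Q) - k V (fst P @ [y, x] @ fst Q) (snd P @ snd Q)
          - k (insert v V) (fst P @ [z] @ fst Q) (snd P @ snd Q))
          + (k V (fst P @ fst Q) (snd P @ [x, y] @ snd Q) - k V (fst P @ fst Q) (snd P @ [y, x] @ snd Q)
          - k (insert v V) (fst P @ fst Q) (snd P @ [z] @ snd Q)) \<in> ?G"
        by (rule comb.span_add)
      then show "(\<Sum>M\<in>#lifts [x, y]. k V (fst P @ fst M @ fst Q) (snd P @ snd M @ snd Q))
          - (\<Sum>M\<in>#lifts [y, x]. k V (fst P @ fst M @ fst Q) (snd P @ snd M @ snd Q))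
          - (\<Sum>M\<in>#lifts [z]. k (insert v V) (fst P @ fst M @ fst Q) (snd P @ snd M @ snd Q)) \<in> ?G"
        by (simp add: algebra_simps)
    qed
  }
  {
    fix d e
    assume *: "w a' = us @ [Tail d, Tail e] @ vs"
    have w: "w = w(a := us @ [Tail d, Tail e] @ vs)" using * a' by auto
    show "strand_op (dbl a b c) (Diag w V) - strand_op (dbl a b c) (Diag (w(a' := us @ [Tail e, Tail d] @ vs)) V) \<in> ?G"
      unfolding a' K arg_cong[where f = "\<lambda>w. strand_op (dbl a b c) (Diag w V)", OF w] sum_mset_diff
    proof (intro span_sum_mset)
      fix P Q assume PQ: "P \<in># lifts us" "Q \<in># lifts vs"
      have "k V (fst P @ [Tail d, Tail e] @ fst Q) (snd P @ snd Q)
          - k V (fst P @ [Tail e, Tail d] @ fst Q) (snd P @ snd Q) \<in> ?G"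
        unfolding k_def using * a' m[OF PQ] L
        by (intro TC_span[where a = b] arrow_dbl[OF D]) (auto simp: fun_eq_iff)
      moreover
      have "k V (fst P @ fst Q) (snd P @ [Tail d, Tail e] @ snd Q)
          - k V (fst P @ fst Q) (snd P @ [Tail e, Tail d] @ snd Q) \<in> ?G"
        unfolding k_def using * a' m[OF PQ] L
        by (intro TC_span[where a = c] arrow_dbl[OF D]) (auto simp: fun_eq_iff)
      ultimately have "(k V (fst P @ [Tail d, Tail e] @ fst Q) (snd P @ snd Q)
          - k V (fst P @ [Tail e, Tail d] @ fst Q) (snd P @ snd Q))
          + (k V (fst P @ fst Q) (snd P @ [Tail d, Tail e] @ snd Q)
          - k V (fst P @ fst Q) (snd P @ [Tail e, Tail d] @ snd Q)) \<in> ?G"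
        by (rule comb.span_add)
      then show "(\<Sum>M\<in>#lifts [Tail d, Tail e]. k V (fst P @ fst M @ fst Q) (snd P @ snd M @ snd Q))
          - (\<Sum>M\<in>#lifts [Tail e, Tail d]. k V (fst P @ fst M @ fst Q) (snd P @ snd M @ snd Q)) \<in> ?G"
        by (simp add: algebra_simps)
    qed
  }
qed

lemma lin_dbl_gen_relators:
  assumes "z \<in> comb.span (gen_relators (insert a L) Hs Ts)" "a \<notin> Hs" "a \<notin> Ts"
  shows "lin (strand_op (dbl a b c)) z \<in> comb.span (gen_relators (insert b (insert c L)) Hs Ts)"
  using strand_operation.lin_gen_relators[OF strand_operation_dbl lin_dbl_relators, of Hs Ts z] assms
  by simp

end

section \<open>Stitching two strands\<close>

definition stc :: "'l \<Rightarrow> 'l \<Rightarrow> 'l \<Rightarrow> ('l \<Rightarrow> endpoint list) \<Rightarrow> (rat \<times> ('l \<Rightarrow> endpoint list)) multiset" where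
  "stc h t a w = {#(1, w(h := [], t := [], a := w h @ w t))#}"

lemma strand_op_stc: "strand_op (stc h t a) D = basis (dm h t a D)"
  by (simp add: strand_op_def stc_def dm_def scale_simps)

context
  fixes L :: "'l set" and h t a :: 'l
  assumes L: "finite L" "a \<notin> L" "h \<notin> L" "t \<notin> L" "a \<noteq> h" "a \<noteq> t" "h \<noteq> t"
begin

lemma strand_operation_stc: "strand_operation (insert h (insert t L)) (insert a L) {h, t} (stc h t a)"
proof
  fix w w' :: "'l \<Rightarrow> endpoint list" and k
  assume "vanishing (insert h (insert t L)) w" "(k, w') \<in># stc h t a w"
  then show "vanishing (insert a L) w'" "ends (insert a L) w' = ends (insert h (insert t L)) w"
    using L by (auto simp: stc_def vanishing_def)
next
  fix w :: "'l \<Rightarrow> endpoint list" and f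
  show "stc h t a (\<lambda>l. map (rename_end f) (w l)) =
    {#case x of (c, w') \<Rightarrow> (c, \<lambda>l. map (rename_end f) (w' l)). x \<in># stc h t a w#}"
    by (simp add: stc_def fun_eq_iff)
next
  fix w :: "'l \<Rightarrow> endpoint list" and x m
  assume "x \<in> insert h (insert t L)" "x \<notin> {h, t}"
  then have "x \<noteq> h" "x \<noteq> t" "x \<noteq> a" using L by auto
  then show "stc h t a (w(x := m)) = {#case y of (k, w') \<Rightarrow> (k, w'(x := m)). y \<in># stc h t a w#}"
    by (simp add: stc_def fun_upd_twist)
qed (use L in auto)

lemma lin_stc_relators:
  assumes "g \<in> relators (insert h (insert t L))"
  shows "lin (strand_op (stc h t a)) g \<in> comb.span (relators (insert a L))"
proof (rule strand_operation.lin_relators[OF strand_operation_stc _ _ assms])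
  fix w V x us vs
  assume D: "arrow_diagram (insert h (insert t L)) (Diag w V)" and x: "x \<in> {h, t}"
  let ?w = "w(h := [], t := [], a := w h @ w t)"
  have v: "vanishing (insert h (insert t L)) w" using vanishing_simps(2)[OF D] by simp
  have i: "(1, ?w) \<in># stc h t a w" by (simp add: stc_def)
  have D': "arrow_diagram (insert a L) (Diag ?w V)"
    using strand_operation.arrow[OF strand_operation_stc D i] .
  have e: "edges (Diag ?w V) = edges (Diag w V)"
    using strand_operation.edges[OF strand_operation_stc v i] .
  define us' where "us' = (if x = h then us else w h @ us)"
  define vs' where "vs' = (if x = h then vs @ w t else vs)"
  have *: "(w(x := m))(h := [], t := [], a := (w(x := m)) h @ (w(x := m)) t) = ?w(a := us' @ ms @ vs')"
    if "m = us @ ms @ vs" for m ms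
    using x L that by (auto simp: us'_def vs'_def fun_eq_iff)
  have w': "?w a = us' @ ms @ vs'" if "w x = us @ ms @ vs" for ms
    using x L that by (auto simp: us'_def vs'_def)
  show "strand_op (stc h t a) (Diag w V) - strand_op (stc h t a) (Diag (w(x := us @ [y, y'] @ vs)) V)
      - strand_op (stc h t a) (Diag (w(x := us @ [z] @ vs)) (insert v V)) \<in> comb.span (relators (insert a L))"
    if "bracket y' y z v r" "w x = us @ [y', y] @ vs" "r \<notin> edges (Diag w V)" for y' y z v r
    unfolding strand_op_stc dm_def diag.sel *[OF refl]
    using that(3) e by (intro STU_span[OF that(1) D' w'[OF that(2)]]) (auto simp del: fun_upd_apply)
  show "strand_op (stc h t a) (Diag w V) - strand_op (stc h t a) (Diag (w(x := us @ [Tail e, Tail d] @ vs)) V)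
      \<in> comb.span (relators (insert a L))"
    if "w x = us @ [Tail d, Tail e] @ vs" for d e
    unfolding strand_op_stc dm_def diag.sel *[OF refl]
    by (intro TC_span[OF D' w'[OF that(1)]]) auto
qed

lemma lin_stc_gen_relators:
  assumes "z \<in> comb.span (gen_relators (insert h (insert t L)) Hs Ts)" "{h, t} \<inter> Hs = {}" "{h, t} \<inter> Ts = {}"
  shows "lin (strand_op (stc h t a)) z \<in> comb.span (gen_relators (insert a L) Hs Ts)"
proof -
  have "Hs \<inter> {h, t} = {}" "Ts \<inter> {h, t} = {}" "Hs - {h, t} = Hs" "Ts - {h, t} = Ts"
    using assms(2,3) by auto
  then show ?thesis
    using strand_operation.lin_gen_relators[OF strand_operation_stc lin_stc_relators, of Hs Ts z] assms(1)
    by simp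
qed

end

section \<open>Moving heads to the bottom of a tail strand\<close>

fun keep :: "endpoint list \<Rightarrow> rat" where
  "keep [] = 1"
| "keep (Head e # u) = keep u"
| "keep (Tail e # u) = 0"

fun antipode_sign :: "endpoint list \<Rightarrow> rat" where
  "antipode_sign [] = 1"
| "antipode_sign (Head e # u) = - antipode_sign u"
| "antipode_sign (Tail e # u) = 0"

lemma keep_append [simp]: "keep (u @ v) = keep u * keep v"
  by (induction u rule: keep.induct) auto

lemma antipode_sign_append [simp]: "antipode_sign (u @ v) = antipode_sign u * antipode_sign v"
  by (induction u rule: keep.induct) auto

lemma keep_map [simp]: "keep (map (rename_end f) u) = keep u"
  by (induction u rule: keep.induct) auto

lemma antipode_sign_map [simp]: "antipode_sign (map (rename_end f) u) = antipode_sign u"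
  by (induction u rule: keep.induct) auto

lemma keep_Tail: "Tail e \<in> set u \<Longrightarrow> keep u = 0"
  by (induction u rule: keep.induct) auto

lemma keep_no_Tail: "(\<And>e. Tail e \<notin> set u) \<Longrightarrow> keep u = 1"
  by (induction u rule: keep.induct) auto

text \<open>
  The antipode identity of the shuffle Hopf algebra: splitting a word as \<open>x, u, v\<close> with \<open>x\<close> and
  \<open>u\<close> consisting of heads and gluing \<open>x\<close> to the reversal of \<open>u\<close> with sign cancels
  everything except \<open>x = u = []\<close>; here \<open>G\<close> keeps the two parts \<open>x @ rev u\<close> and \<open>v\<close> apart.
\<close>

lemma antipode:
  "(\<Sum>p\<in>#lifts w. \<Sum>q\<in>#lifts (snd p). scale (keep (fst p) * antipode_sign (fst q)) (G (fst p @ rev (fst q)) (snd q)))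
     = (G [] w :: 'l comb)"
proof (induction w arbitrary: G)
  case (Cons x w)
  show ?case
  proof (cases x)
    case (Head e)
    have "(\<Sum>p\<in>#lifts w. \<Sum>q\<in>#lifts (snd p). scale (keep (fst p) * antipode_sign (fst q)) (G (x # fst p @ rev (fst q)) (snd q)))
      = G [x] w" using Cons.IH[of "\<lambda>u v. G (x # u) v"] by simp
    moreover have "(\<Sum>p\<in>#lifts w. \<Sum>q\<in>#lifts (snd p). scale (keep (fst p) * antipode_sign (fst q)) (- G (fst p @ rev (fst q) @ [x]) (snd q)))
      = - G [x] w" using Cons.IH[of "\<lambda>u v. - G (u @ [x]) v"] by simp
    moreover have "(\<Sum>p\<in>#lifts w. \<Sum>q\<in>#lifts (snd p). scale (keep (fst p) * antipode_sign (fst q)) (G (fst p @ rev (fst q)) (x # snd q)))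
      = G [] (x # w)" using Cons.IH[of "\<lambda>u v. G u (x # v)"] by simp
    ultimately show ?thesis
      by (simp add: Head image_mset.compositionality comp_def sum_mset.distrib scale_simps)
  next
    case (Tail e)
    show ?thesis using Cons.IH[of "\<lambda>u v. G u (x # v)"]
      by (simp add: Tail image_mset.compositionality comp_def sum_mset.distrib scale_simps)
  qed
qed (simp add: scale_simps)

lemma antipode_no_Head:
  "(\<And>e. Head e \<notin> set w) \<Longrightarrow>
    (\<Sum>p\<in>#lifts w. scale (antipode_sign (fst p)) (G (fst p) (snd p))) = (G [] w :: 'l comb)"
proof (induction w arbitrary: G)
  case (Cons x w)
  then obtain e where "x = Tail e" by (cases x) auto
  then show ?case using Cons.IH[of "\<lambda>u v. G u (x # v)"] Cons.prems
    by (simp add: image_mset.compositionality comp_def scale_simps)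
qed (simp add: scale_simps)

definition srt :: "'l \<Rightarrow> 'l \<Rightarrow> ('l \<Rightarrow> endpoint list) \<Rightarrow> (rat \<times> ('l \<Rightarrow> endpoint list)) multiset" where
  "srt h t w = {#(keep (w h) * antipode_sign (fst p), w(t := rev (fst p) @ snd p)). p \<in># lifts (w t)#}"

lemma strand_op_srt:
  "strand_op (srt h t) (Diag w V) = (\<Sum>p\<in>#lifts (w t).
     scale (keep (w h) * antipode_sign (fst p)) (basis (Diag (w(t := rev (fst p) @ snd p)) V)))"
  by (simp add: strand_op_def srt_def image_mset.compositionality comp_def)

lemma srt_tail: "Tail e \<in> set (strands D h) \<Longrightarrow> strand_op (srt h t) D = 0"
  by (cases D) (simp add: strand_op_srt keep_Tail scale_simps)

text \<open>The lowest head is either moved, as the last one, or stays where it is, with opposite signs.\<close>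

lemma srt_head: "strands D t = Head e # us \<Longrightarrow> strand_op (srt h t) D = 0"
  by (cases D) (simp add: strand_op_srt image_mset.compositionality comp_def sum_mset.distrib[symmetric] scale_simps)

lemma srt_sorted:
  assumes "\<And>e. Tail e \<notin> set (strands D h)" "\<And>e. Head e \<notin> set (strands D t)"
  shows "strand_op (srt h t) D = basis D"
  using assms antipode_no_Head[of "strands D t" "\<lambda>u v. basis (Diag ((strands D)(t := rev u @ v)) (verts D))"]
  by (cases D) (simp add: strand_op_srt keep_no_Tail)

context
  fixes L :: "'l set" and h t :: 'l
  assumes L: "finite L" "t \<in> L" "h \<noteq> t"
begin

lemma strand_operation_srt: "strand_operation L L {h, t} (srt h t)"
proof
  fix w w' :: "'l \<Rightarrow> endpoint list" and k
  assume w: "vanishing L w" "(k, w') \<in># srt h t w"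
  then obtain p where "p \<in># lifts (w t)" "w' = w(t := rev (fst p) @ snd p)"
    by (auto simp: srt_def)
  then show "vanishing L w'" "ends L w' = ends L w"
    using L w(1) lifts_mset[of p "w t"] by (auto intro!: ends_update_perm simp: vanishing_def)
next
  fix w :: "'l \<Rightarrow> endpoint list" and f
  show "srt h t (\<lambda>l. map (rename_end f) (w l)) =
    {#case x of (c, w') \<Rightarrow> (c, \<lambda>l. map (rename_end f) (w' l)). x \<in># srt h t w#}"
    by (auto simp: srt_def lifts_map image_mset.compositionality comp_def fun_eq_iff rev_map intro!: image_mset_cong)
next
  fix w :: "'l \<Rightarrow> endpoint list" and x m
  assume "x \<in> L" "x \<notin> {h, t}"
  then have "x \<noteq> h" "x \<noteq> t" by auto
  then show "srt h t (w(x := m)) = {#case y of (k, w') \<Rightarrow> (k, w'(x := m)). y \<in># srt h t w#}"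
    by (simp add: srt_def image_mset.compositionality comp_def fun_upd_twist[of x t])
qed (use L in auto)

lemma lin_srt_relators:
  assumes "g \<in> relators L"
  shows "lin (strand_op (srt h t)) g \<in> comb.span (relators L)"
proof (rule strand_operation.lin_relators[OF strand_operation_srt _ _ assms])
  let ?G = "comb.span (relators L)"
  fix w V a us vs
  assume D: "arrow_diagram L (Diag w V)" and a: "a \<in> {h, t}"
  have arrow: "arrow_diagram L (Diag (w(t := m)) V)" "edges (Diag (w(t := m)) V) = edges (Diag w V)"
    if "mset m = mset (w t)" for m
    using that D by (simp_all add: arrow_diagram_update_perm edges_update_perm del: fun_upd_apply)
  define k where "k V m = basis (Diag (w(t := m)) V)" for V m
  have K: "strand_op (srt h t) (Diag (w(t := us @ ms @ vs)) V) =
      (\<Sum>P\<in>#lifts us. \<Sum>Q\<in>#lifts vs. \<Sum>M\<in>#lifts ms.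
         scale (keep (w h) * antipode_sign (fst P @ fst M @ fst Q))
          (k V (rev (fst P @ fst M @ fst Q) @ snd P @ snd M @ snd Q)))" for ms V
    using L by (simp add: strand_op_srt sum_lifts_mid k_def)
  define kh where "kh V m n = basis (Diag (w(t := n, h := m)) V)" for V m n
  have Kh: "strand_op (srt h t) (Diag (w(h := m)) V) =
      (\<Sum>P\<in>#lifts (w t). scale (keep m * antipode_sign (fst P)) (kh V m (rev (fst P) @ snd P)))" for m V
    using L by (simp add: strand_op_srt kh_def fun_upd_twist[of h t])
  have m: "mset us = mset (fst P) + mset (snd P)" "mset vs = mset (fst Q) + mset (snd Q)"
    if "P \<in># lifts us" "Q \<in># lifts vs" for P Q
    using that lifts_mset by metis+
  {
    fix x y z v r
    assume *: "bracket x y z v r" "w a = us @ [x, y] @ vs" "r \<notin> edges (Diag w V)"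
    have w: "w = w(a := us @ [x, y] @ vs)" using * by auto
    show "strand_op (srt h t) (Diag w V) - strand_op (srt h t) (Diag (w(a := us @ [y, x] @ vs)) V)
          - strand_op (srt h t) (Diag (w(a := us @ [z] @ vs)) (insert v V)) \<in> ?G"
    proof (cases "a = t")
      case True
      let ?A = "\<lambda>P Q. rev (fst Q) @ rev (fst P) @ snd P" and ?B = "\<lambda>P Q. rev (fst P) @ snd P @ snd Q"
      show ?thesis
        unfolding True K arg_cong[where f = "\<lambda>w. strand_op (srt h t) (Diag w V)", OF w[unfolded True]] sum_mset_diff
      proof (intro span_sum_mset)
        fix P Q assume PQ: "P \<in># lifts us" "Q \<in># lifts vs"
        define R1 where "R1 = k V (rev (fst Q) @ [x, y] @ ?B P Q) - k V (rev (fst Q) @ [y, x] @ ?B P Q)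
          - k (insert v V) (rev (fst Q) @ [z] @ ?B P Q)"
        define R2 where "R2 = k V (?A P Q @ [x, y] @ snd Q) - k V (?A P Q @ [y, x] @ snd Q)
          - k (insert v V) (?A P Q @ [z] @ snd Q)"
        have R: "k V (A @ [x, y] @ B) - k V (A @ [y, x] @ B) - k (insert v V) (A @ [z] @ B) \<in> ?G"
          if "mset A + mset B = mset us + mset vs" for A B
        proof -
          have m': "mset (A @ [x, y] @ B) = mset (w t)" using that * True by simp
          show ?thesis unfolding k_def
            by (rule STU_span[where a = t, OF *(1) arrow(1)[OF m']]) (use arrow(2)[OF m'] *(3) in simp_all)
        qed
        have "R1 \<in> ?G" unfolding R1_def by (rule R) (simp add: m[OF PQ])
        moreover have "R2 \<in> ?G" unfolding R2_def by (rule R) (simp add: m[OF PQ])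
        moreover define c where "c = keep (w h) * antipode_sign (fst P) * antipode_sign (fst Q)"
        ultimately have 1: "scale c R2 - scale c R1 \<in> ?G" and 2: "scale c R2 \<in> ?G"
          by (auto intro: comb.span_diff comb.span_scale)
        from *(1)
        show "(\<Sum>M\<in>#lifts [x, y]. scale (keep (w h) * antipode_sign (fst P @ fst M @ fst Q))
            (k V (rev (fst P @ fst M @ fst Q) @ snd P @ snd M @ snd Q)))
          - (\<Sum>M\<in>#lifts [y, x]. scale (keep (w h) * antipode_sign (fst P @ fst M @ fst Q))
            (k V (rev (fst P @ fst M @ fst Q) @ snd P @ snd M @ snd Q)))
          - (\<Sum>M\<in>#lifts [z]. scale (keep (w h) * antipode_sign (fst P @ fst M @ fst Q))
            (k (insert v V) (rev (fst P @ fst M @ fst Q) @ snd P @ snd M @ snd Q))) \<in> ?G" (is "?X \<in> ?G")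
        proof cases
          case 1
          have "?X = scale c R2 - scale c R1"
            unfolding R1_def R2_def c_def by (rule ext) (simp add: 1 pointwise algebra_simps)
          then show ?thesis using \<open>scale c R2 - scale c R1 \<in> ?G\<close> by simp
        next
          case 2
          have "?X = scale c R2"
            unfolding R1_def R2_def c_def by (rule ext) (simp add: 2 pointwise algebra_simps)
          then show ?thesis using \<open>scale c R2 \<in> ?G\<close> by simp
        qed
      qed
    next
      case False
      then have ah: "a = h" using a by simp
      have e: "keep [y, x] = keep [x, y]" "keep [z] = keep [x, y]" using *(1) by (cases; simp)+
      show ?thesis
        unfolding ah Kh arg_cong[where f = "\<lambda>w. strand_op (srt h t) (Diag w V)", OF w[unfolded ah]]
          sum_mset_diff keep_append e comb.scale_right_diff_distrib[symmetric]
      proof (intro span_sum_mset comb.span_scale)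
        fix P assume "P \<in># lifts (w t)"
        then have "mset (rev (fst P) @ snd P) = mset (w t)" using lifts_mset[of P "w t"] by simp
        note arr = arrow[OF this]
        have eq: "w(t := n, h := us @ [x, y] @ vs) = w(t := n)" for n
          using * ah L by (auto simp: fun_eq_iff)
        show "kh V (us @ [x, y] @ vs) (rev (fst P) @ snd P) - kh V (us @ [y, x] @ vs) (rev (fst P) @ snd P)
           - kh (insert v V) (us @ [z] @ vs) (rev (fst P) @ snd P) \<in> ?G"
          unfolding kh_def eq
          by (rule STU_span[where a = h and us = us and vs = vs, OF *(1) arr(1)])
            (use * ah L arr(2) in simp_all)
      qed
    qed
  }
  {
    fix d e
    assume *: "w a = us @ [Tail d, Tail e] @ vs"
    have w: "w = w(a := us @ [Tail d, Tail e] @ vs)" using * by auto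
    show "strand_op (srt h t) (Diag w V) - strand_op (srt h t) (Diag (w(a := us @ [Tail e, Tail d] @ vs)) V) \<in> ?G"
    proof (cases "a = t")
      case True
      let ?A = "\<lambda>P Q. rev (fst Q) @ rev (fst P) @ snd P"
      show ?thesis
        unfolding True K arg_cong[where f = "\<lambda>w. strand_op (srt h t) (Diag w V)", OF w[unfolded True]] sum_mset_diff
      proof (intro span_sum_mset)
        fix P Q assume PQ: "P \<in># lifts us" "Q \<in># lifts vs"
        define R where "R = k V (?A P Q @ [Tail d, Tail e] @ snd Q) - k V (?A P Q @ [Tail e, Tail d] @ snd Q)"
        have m': "mset (?A P Q @ [Tail d, Tail e] @ snd Q) = mset (w t)" using m[OF PQ] * True by simp
        have "R \<in> ?G" unfolding R_def k_def
          by (rule TC_span[where a = t and us = "?A P Q" and vs = "snd Q" and d = d and e = e, OF arrow(1)[OF m']]) simp_all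
        moreover define c where "c = keep (w h) * antipode_sign (fst P) * antipode_sign (fst Q)"
        ultimately have 1: "scale c R \<in> ?G" by (auto intro: comb.span_scale)
        show "(\<Sum>M\<in>#lifts [Tail d, Tail e]. scale (keep (w h) * antipode_sign (fst P @ fst M @ fst Q))
            (k V (rev (fst P @ fst M @ fst Q) @ snd P @ snd M @ snd Q)))
          - (\<Sum>M\<in>#lifts [Tail e, Tail d]. scale (keep (w h) * antipode_sign (fst P @ fst M @ fst Q))
            (k V (rev (fst P @ fst M @ fst Q) @ snd P @ snd M @ snd Q))) \<in> ?G" (is "?X \<in> ?G")
        proof -
          have "?X = scale c R"
            unfolding R_def c_def by (rule ext) (simp add: pointwise algebra_simps)
          then show ?thesis using 1 by simp
        qed
      qed
    next
      case False
      then have "a = h" using a by simp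
      then show ?thesis using * srt_tail[of d _ h t] by (simp add: comb.span_zero)
    qed
  }
qed

lemma lin_srt_gen_relators:
  assumes "z \<in> comb.span (gen_relators L Hs Ts)" "h \<notin> Ts" "t \<notin> Hs"
  shows "lin (strand_op (srt h t)) z \<in> comb.span (gen_relators L (Hs - {h}) (Ts - {t}))"
proof -
  have "Hs - {h, t} = Hs - {h}" "Ts - {h, t} = Ts - {t}" using assms by auto
  then show ?thesis
    using strand_operation.lin_gen_relators[OF strand_operation_srt lin_srt_relators, of Hs Ts z] assms
    by (auto intro: srt_tail srt_head)
qed

end

lemma lin_scale_comb: "lin F (scale c x) = scale c (lin F x)"
  for F :: "'l diag \<Rightarrow> 'm comb"
  by (rule ext) (simp add: lin_scale pointwise)

lemma stc_srt_dbl: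
  assumes "w h = []" "w t = []" "h \<noteq> t" "a \<noteq> h" "a \<noteq> t"
  shows "lin (strand_op (stc h t a)) (lin (strand_op (srt h t)) (strand_op (dbl a h t) (Diag w V))) = basis (Diag w V)"
proof -
  have [simp]: "finsupp (strand_op (srt h t) D)" for D :: "'a diag"
    by (cases D) (simp add: strand_op_srt)
  let ?G = "\<lambda>u v. basis (Diag (w(a := u @ v)) V)"
  have w: "w(a := x, h := y, t := z, h := [], t := [], a := m) = w(a := m)" for x y z m
    using assms by (auto simp: fun_eq_iff)
  have w': "w(a := x, h := y, t := z, t := z', h := [], t := [], a := m) = w(a := m)" for x y z z' m
    using assms by (auto simp: fun_eq_iff)
  have "lin (strand_op (stc h t a)) (lin (strand_op (srt h t)) (strand_op (dbl a h t) (Diag w V)))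
      = (\<Sum>p\<in>#lifts (w a). \<Sum>q\<in>#lifts (snd p). scale (keep (fst p) * antipode_sign (fst q))
          (?G (fst p @ rev (fst q)) (snd q)))"
    using assms w w' by (simp add: strand_op_dbl lin_sum_mset strand_op_srt lin_scale_comb strand_op_stc dm_def)
  also have "\<dots> = ?G [] (w a)" by (rule antipode)
  finally show ?thesis by simp
qed

lemma lifts_no_Head:
  assumes "\<And>e. Head e \<notin> set ts"
  shows "\<exists>M. lifts ts = add_mset ([], ts) M \<and> (\<forall>p\<in>#M. \<exists>e. Tail e \<in> set (fst p))"
  using assms
proof (induction ts)
  case (Cons x ts)
  then obtain M e where M: "lifts ts = add_mset ([], ts) M" "\<forall>p\<in>#M. \<exists>e. Tail e \<in> set (fst p)"
    and x: "x = Tail e" by (cases x) auto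
  show ?case
    by (rule exI[of _ "{#(x # fst p, snd p). p \<in># lifts ts#} + {#(fst p, x # snd p). p \<in># M#}"])
       (use M x in \<open>fastforce simp: image_iff\<close>)
qed simp

lemma lifts_sorted:
  assumes "\<And>e. Tail e \<notin> set hs" "\<And>e. Head e \<notin> set ts"
  shows "\<exists>M. lifts (hs @ ts) = add_mset (hs, ts) M \<and>
    (\<forall>p\<in>#M. (\<exists>e. Tail e \<in> set (fst p)) \<or> (\<exists>e us. snd p = Head e # us))"
  using assms
proof (induction hs)
  case Nil
  then show ?case using lifts_no_Head[of ts] by auto
next
  case (Cons x hs)
  then obtain M e where M: "lifts (hs @ ts) = add_mset (hs, ts) M"
      "\<forall>p\<in>#M. (\<exists>e. Tail e \<in> set (fst p)) \<or> (\<exists>e us. snd p = Head e # us)"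
    and x: "x = Head e" by (cases x) auto
  show ?case
    by (rule exI[of _ "{#(x # fst p, snd p). p \<in># M#} + {#(fst p, x # snd p). p \<in># lifts (hs @ ts)#}"])
       (use M x in \<open>fastforce simp: image_iff\<close>)
qed

lemma dbl_stc:
  assumes L: "finite L" "a \<notin> L" "h \<notin> L" "t \<notin> L" "a \<noteq> h" "a \<noteq> t" "h \<noteq> t"
    and D: "arrow_diagram (insert h (insert t L)) D"
    and sorted: "\<And>e. Tail e \<notin> set (strands D h)" "\<And>e. Head e \<notin> set (strands D t)"
  shows "strand_op (dbl a h t) (dm h t a D) - basis D
    \<in> comb.span (gen_relators (insert h (insert t L)) {h} {t})"
proof -
  let ?G = "gen_relators (insert h (insert t L)) {h} {t}"
  obtain w V where DV: "D = Diag w V" by (cases D)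
  have wa: "w a = []" using D L unfolding DV by (auto simp: arrow_diagram_def)
  let ?w = "w(h := [], t := [], a := w h @ w t)"
  have "arrow_diagram (insert a L) (Diag ?w V)"
    using strand_operation.arrow[OF strand_operation_stc, of L a h t w V 1 ?w] L D
    by (simp add: stc_def DV)
  note arrow = arrow_dbl(1)[OF L(1,2,3,4,5,6,7) this]
  have w': "w(a := [], h := u, t := v) = w(h := u, t := v)" for u v
    using L wa by (auto simp: fun_eq_iff)
  have w: "?w(a := [], h := u, t := v) = w(h := u, t := v)" for u v
    using L wa by (auto simp: fun_eq_iff)
  obtain M where M: "lifts (w h @ w t) = add_mset (w h, w t) M"
      "\<forall>p\<in>#M. (\<exists>e. Tail e \<in> set (fst p)) \<or> (\<exists>e us. snd p = Head e # us)"
    using lifts_sorted sorted unfolding DV diag.sel by metis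
  have 1: "strand_op (dbl a h t) (dm h t a D) = (\<Sum>p\<in>#lifts (w h @ w t). basis (Diag (w(h := fst p, t := snd p)) V))"
    using L by (simp add: strand_op_dbl dm_def DV w w')
  have "strand_op (dbl a h t) (dm h t a D) - basis D = (\<Sum>p\<in>#M. basis (Diag (w(h := fst p, t := snd p)) V))"
    unfolding 1 by (simp add: M(1) DV)
  also have "\<dots> \<in> comb.span ?G"
  proof (intro span_sum_mset comb.span_base)
    fix p assume p: "p \<in># M"
    then have "mset (fst p) + mset (snd p) = mset (?w a)"
      using lifts_mset[of p "w h @ w t"] M(1) by simp
    from arrow[OF this] have "arrow_diagram (insert h (insert t L)) (Diag (w(h := fst p, t := snd p)) V)"
      unfolding w .
    note arr = this
    from M(2) p consider e where "Tail e \<in> set (fst p)" | e us where "snd p = Head e # us" by blast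
    then show "basis (Diag (w(h := fst p, t := snd p)) V) \<in> ?G"
    proof cases
      case 1
      then show ?thesis using L by (intro gen_relators_tail[OF arr, of h]) auto
    next
      case 2
      then show ?thesis using L by (intro gen_relators_head[OF arr, of t]) auto
    qed
  qed
  finally show ?thesis .
qed

section \<open>All strands at once\<close>

lemma finsupp_span: "z \<in> comb.span (gen_relators L Hs Ts) \<Longrightarrow> finsupp z"
  using lin_span[of z "gen_relators L Hs Ts" "\<lambda>_. True" basis] finsupp_gen_relators by blast

lemma homogeneous_lin:
  assumes "homogeneous L L' F" "homogeneous L' L'' G"
  shows "homogeneous L L'' (\<lambda>D. lin G (F D))"
  unfolding homogeneous_def
proof (intro allI impI conjI)
  fix D assume D: "arrow_diagram L D"
  then show "finsupp (lin G (F D))"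
    using assms by (intro finsupp_lin) (auto simp: homogeneous_def)
  fix E assume "lin G (F D) E \<noteq> 0"
  then have "{D'. F D D' \<noteq> 0 \<and> G D' E \<noteq> 0} \<noteq> {}" unfolding lin_def by (metis (no_types, lifting) sum.empty)
  then obtain D' where "F D D' \<noteq> 0" "G D' E \<noteq> 0" by blast
  then have "arrow_diagram L'' E \<and> degree E = degree D"
    using assms D unfolding homogeneous_def by metis
  then show "arrow_diagram L'' E" "degree E = degree D" by simp_all
qed

definition fresh_labels :: "'a label set \<Rightarrow> 'a set \<Rightarrow> bool" where
  "fresh_labels L A \<longleftrightarrow> finite L \<and> L \<inter> (Str ` A \<union> ht A A) = {}"

lemma fresh_labels_insert:
  assumes "fresh_labels L (insert a A)" "a \<notin> A"
  shows "fresh_labels (insert (Str a) L) A" "fresh_labels (insert (HStr a) (insert (TStr a) L)) A"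
    "Str a \<notin> L" "HStr a \<notin> L" "TStr a \<notin> L"
  using assms by (auto simp: fresh_labels_def ht_def)

lemma ht_insert: "L \<union> ht (insert a A) (insert a A) = insert (HStr a) (insert (TStr a) (L \<union> ht A A))"
  by (auto simp: ht_def)

lemma not_in_ht [simp]: "Str a \<notin> ht A B" "HStr a \<in> ht A B \<longleftrightarrow> a \<in> A" "TStr a \<in> ht A B \<longleftrightarrow> a \<in> B"
  by (auto simp: ht_def)

lemma finite_ht [simp]: "finite A \<Longrightarrow> finite B \<Longrightarrow> finite (ht A B)"
  by (simp add: ht_def)

abbreviation dbl_label :: "'a \<Rightarrow> 'a label diag \<Rightarrow> 'a label comb" where
  "dbl_label a \<equiv> strand_op (dbl (Str a) (HStr a) (TStr a))"

abbreviation stc_label :: "'a \<Rightarrow> 'a label diag \<Rightarrow> 'a label comb" where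
  "stc_label a \<equiv> strand_op (stc (HStr a) (TStr a) (Str a))"

abbreviation srt_label :: "'a \<Rightarrow> 'a label diag \<Rightarrow> 'a label comb" where
  "srt_label a \<equiv> strand_op (srt (HStr a) (TStr a))"

definition doubled :: "'a set \<Rightarrow> 'a label diag \<Rightarrow> 'a label comb" where
  "doubled A D = total (double_diag A D)"

definition stitched :: "'a set \<Rightarrow> 'a label diag \<Rightarrow> 'a label comb" where
  "stitched A D = basis (stitch_diag A D)"

lemma finsupp_doubled [simp]: "finsupp (doubled A D)"
  by (simp add: doubled_def)

lemma doubled_empty [simp]: "doubled {} = basis"
  by (simp add: doubled_def double_diag_def fun_eq_iff)

lemma stitched_empty [simp]: "stitched {} = basis"
  by (simp add: stitched_def stitch_diag_def fun_eq_iff)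

lemma doubled_insert:
  assumes "finite A" "a \<notin> A"
  shows "doubled (insert a A) D = lin (dbl_label a) (doubled A D)"
  using assms
  by (simp add: doubled_def double_diag_insert double_step_def total_sum_mset total_dDelta lin_total
      image_mset.compositionality comp_def)

lemma double_fold_sum:
  assumes "finite A"
  shows "Finite_Set.fold double_step M A = (\<Sum>D\<in>#M. double_diag A D)"
proof -
  interpret comp_fun_commute double_step by unfold_locales (rule double_step_commute)
  show ?thesis using assms
  proof (induction A arbitrary: M)
    case empty
    show ?case by (induction M) (simp_all add: double_diag_def)
  next
    case (insert a A)
    then have "Finite_Set.fold double_step M (insert a A) = double_step a (\<Sum>D\<in>#M. double_diag A D)"
      by simp
    also have "\<dots> = (\<Sum>D\<in>#M. double_step a (double_diag A D))"
      by (simp add: double_step_def sum_mset_UN_mset image_mset.compositionality comp_def)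
    finally show ?case using insert.hyps by (simp add: double_diag_insert)
  qed
qed

lemma doubled_insert':
  assumes "finite A" "a \<notin> A"
  shows "doubled (insert a A) D = lin (doubled A) (dbl_label a D)"
proof -
  interpret comp_fun_commute double_step by unfold_locales (rule double_step_commute)
  have "double_diag (insert a A) D = Finite_Set.fold double_step (double_step a {#D#}) A"
    unfolding double_diag_def by (rule fold_insert2[OF assms])
  also have "\<dots> = (\<Sum>E\<in>#dDelta (Str a) (HStr a) (TStr a) D. double_diag A E)"
    by (simp add: double_fold_sum[OF assms(1)] double_step_def)
  finally show ?thesis
    by (simp add: doubled_def total_sum_mset flip: total_dDelta) (simp add: lin_total flip: doubled_def)
qed

lemma stitched_insert:
  assumes "finite A" "a \<notin> A"
  shows "stitched (insert a A) D = lin (stc_label a) (stitched A D)"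
  using assms by (simp add: stitched_def stitch_diag_insert strand_op_stc)

context
  fixes L :: "'a label set" and A :: "'a set" and a
  assumes fresh: "fresh_labels L (insert a A)" and A: "finite A" "a \<notin> A"
begin

lemma fresh_facts:
  "finite (L \<union> ht A A)" "Str a \<notin> L \<union> ht A A" "HStr a \<notin> L \<union> ht A A" "TStr a \<notin> L \<union> ht A A"
  "finite (L \<union> Str ` A)" "Str a \<notin> L \<union> Str ` A" "HStr a \<notin> L \<union> Str ` A" "TStr a \<notin> L \<union> Str ` A"
  using fresh A by (auto simp: fresh_labels_def ht_def)

lemma operation_dbl_label:
  "strand_operation (insert (Str a) (L \<union> ht A A)) (L \<union> ht (insert a A) (insert a A)) {Str a}
     (dbl (Str a) (HStr a) (TStr a))"
  unfolding ht_insert using fresh_facts by (intro strand_operation_dbl) auto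

lemma operation_stc_label:
  "strand_operation (insert (HStr a) (insert (TStr a) (L \<union> Str ` A))) (insert (Str a) (L \<union> Str ` A)) {HStr a, TStr a}
     (stc (HStr a) (TStr a) (Str a))"
  using fresh_facts by (intro strand_operation_stc) auto

lemma dbl_label_relators:
  assumes "z \<in> comb.span (gen_relators (insert (Str a) (L \<union> ht A A)) Hs Ts)" "Str a \<notin> Hs" "Str a \<notin> Ts"
  shows "lin (dbl_label a) z \<in> comb.span (gen_relators (L \<union> ht (insert a A) (insert a A)) Hs Ts)"
  unfolding ht_insert using fresh_facts assms by (intro lin_dbl_gen_relators) auto

end

lemma homogeneous_doubled:
  assumes "finite A" "fresh_labels L A"
  shows "homogeneous (L \<union> Str ` A) (L \<union> ht A A) (doubled A)"
  using assms
proof (induction A arbitrary: L)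
  case empty
  then show ?case by (simp add: homogeneous_basis ht_def)
next
  case (insert a A)
  show ?case
    unfolding doubled_insert[OF insert.hyps(1,2)]
  proof (rule homogeneous_lin)
    show "homogeneous (L \<union> Str ` insert a A) (insert (Str a) (L \<union> ht A A)) (doubled A)"
      using insert.IH[OF fresh_labels_insert(1)[OF insert.prems insert.hyps(2)]] by simp
    show "homogeneous (insert (Str a) (L \<union> ht A A)) (L \<union> ht (insert a A) (insert a A)) (dbl_label a)"
      by (rule strand_operation.homogeneous[OF operation_dbl_label[OF insert.prems insert.hyps(1,2)]])
  qed
qed

lemma homogeneous_stitched:
  assumes "finite A" "fresh_labels L A"
  shows "homogeneous (L \<union> ht A A) (L \<union> Str ` A) (stitched A)"
  using assms
proof (induction A arbitrary: L)
  case empty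
  then show ?case by (simp add: homogeneous_basis ht_def)
next
  case (insert a A)
  show ?case
    unfolding stitched_insert[OF insert.hyps(1,2)]
  proof (rule homogeneous_lin)
    show "homogeneous (L \<union> ht (insert a A) (insert a A)) (insert (HStr a) (insert (TStr a) (L \<union> Str ` A))) (stitched A)"
      using insert.IH[OF fresh_labels_insert(2)[OF insert.prems insert.hyps(2)]] by (simp add: ht_insert)
    show "homogeneous (insert (HStr a) (insert (TStr a) (L \<union> Str ` A))) (L \<union> Str ` insert a A) (stc_label a)"
      using strand_operation.homogeneous[OF operation_stc_label[OF insert.prems insert.hyps(1,2)]] by simp
  qed
qed

lemma lin_doubled_relators:
  assumes "finite A" "fresh_labels L A" "z \<in> comb.span (gen_relators (L \<union> Str ` A) Hs Ts)"
    and "Hs \<inter> Str ` A = {}" "Ts \<inter> Str ` A = {}"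
  shows "lin (doubled A) z \<in> comb.span (gen_relators (L \<union> ht A A) Hs Ts)"
  using assms
proof (induction A arbitrary: L)
  case empty
  then show ?case by (simp add: ht_def lin_id finsupp_span)
next
  case (insert a A)
  have "lin (doubled (insert a A)) z = lin (dbl_label a) (lin (doubled A) z)"
    unfolding doubled_insert[OF insert.hyps(1,2)] using finsupp_span[OF insert.prems(2)]
    by (simp add: lin_lin)
  also have "\<dots> \<in> comb.span (gen_relators (L \<union> ht (insert a A) (insert a A)) Hs Ts)"
    using insert.IH[OF fresh_labels_insert(1)[OF insert.prems(1) insert.hyps(2)]] insert.prems(2-)
    by (intro dbl_label_relators[OF insert.prems(1) insert.hyps(1,2)]) auto
  finally show ?case .
qed

lemma lin_stitched_relators:
  assumes "finite A" "fresh_labels L A" "z \<in> comb.span (relators (L \<union> ht A A))"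
  shows "lin (stitched A) z \<in> comb.span (relators (L \<union> Str ` A))"
  using assms
proof (induction A arbitrary: L)
  case empty
  then show ?case using finsupp_span[of z _ "{}" "{}"] by (simp add: ht_def lin_id)
next
  case (insert a A)
  have z: "finsupp z" using finsupp_span[of z _ "{}" "{}"] insert.prems by simp
  have "lin (stitched (insert a A)) z = lin (stc_label a) (lin (stitched A) z)"
    unfolding stitched_insert[OF insert.hyps(1,2)] by (simp add: lin_lin z stitched_def)
  also have "\<dots> \<in> comb.span (gen_relators (insert (Str a) (L \<union> Str ` A)) {} {})"
    using insert.IH[OF fresh_labels_insert(2)[OF insert.prems(1) insert.hyps(2)]] insert.prems(2-)
      fresh_facts[OF insert.prems(1) insert.hyps(1,2)]
    by (intro lin_stc_gen_relators) (auto simp: ht_insert)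
  finally show ?case by simp
qed

text \<open>Peeling off one strand after the other, as \<open>stc\<close> after \<open>srt\<close> undoes \<open>dbl\<close>.\<close>

lemma doubled_inj:
  assumes "finite A" "fresh_labels L A" "finsupp x" "\<And>D. x D \<noteq> 0 \<Longrightarrow> arrow_diagram (L \<union> Str ` A) D"
    and "lin (doubled A) x \<in> comb.span (gen_relators (L \<union> ht A A) (HStr ` A) (TStr ` A))"
  shows "x \<in> comb.span (relators (L \<union> Str ` A))"
  using assms
proof (induction A arbitrary: L)
  case empty
  then show ?case by (simp add: ht_def lin_id)
next
  case (insert a A)
  note fresh = fresh_facts[OF insert.prems(1) insert.hyps(1,2)]
  let ?y = "lin (doubled A) x"
  have fl: "fresh_labels (insert (Str a) L) A"
    using fresh_labels_insert(1)[OF insert.prems(1) insert.hyps(2)] .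
  have y: "finsupp ?y" using insert.prems by (simp add: finsupp_lin)
  have y_arrow: "arrow_diagram (insert (Str a) (L \<union> ht A A)) E" if "?y E \<noteq> 0" for E
  proof -
    have "{D. x D \<noteq> 0 \<and> doubled A D E \<noteq> 0} \<noteq> {}"
      using that unfolding lin_def by (metis (no_types, lifting) sum.empty)
    then show ?thesis
      using homogeneous_doubled[OF insert.hyps(1) fl] insert.prems(3) by (auto simp: homogeneous_def)
  qed
  have d: "lin (dbl_label a) ?y = lin (doubled (insert a A)) x"
    unfolding doubled_insert[OF insert.hyps(1,2)] using insert.prems by (simp add: lin_lin)
  have minus: "HStr ` insert a A - {HStr a} = HStr ` A" "TStr ` insert a A - {TStr a} = TStr ` A"
    using insert.hyps by auto
  have "lin (srt_label a) (lin (dbl_label a) ?y) \<in> comb.span (gen_relators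
      (L \<union> ht (insert a A) (insert a A)) (HStr ` insert a A - {HStr a}) (TStr ` insert a A - {TStr a}))"
    using insert.prems fresh by (intro lin_srt_gen_relators) (auto simp: d ht_insert)
  then have s: "lin (stc_label a) (lin (srt_label a) (lin (dbl_label a) ?y))
      \<in> comb.span (gen_relators (insert (Str a) (L \<union> ht A A)) (HStr ` A) (TStr ` A))"
    using fresh insert.hyps unfolding minus ht_insert by (intro lin_stc_gen_relators) auto
  have fin: "finsupp (dbl_label a E)" "finsupp (srt_label a E)" for E :: "'a label diag"
    by (cases E; simp add: strand_op_dbl strand_op_srt)+
  have fin': "finsupp (lin (srt_label a) (dbl_label a E))" for E :: "'a label diag"
    using fin by (intro finsupp_lin)
  have "lin (stc_label a) (lin (srt_label a) (lin (dbl_label a) ?y))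
      = lin (\<lambda>D. lin (stc_label a) (lin (srt_label a) (dbl_label a D))) ?y"
    using fin fin' y by (simp add: lin_lin)
  also have "\<dots> = ?y"
  proof (rule lin_id[OF y])
    fix D assume "?y D \<noteq> 0"
    then have "strands D (HStr a) = []" "strands D (TStr a) = []"
      using y_arrow fresh by (auto simp: arrow_diagram_def)
    then show "lin (stc_label a) (lin (srt_label a) (dbl_label a D)) = basis D"
      by (cases D) (simp add: stc_srt_dbl)
  qed
  finally have "?y \<in> comb.span (gen_relators (insert (Str a) L \<union> ht A A) (HStr ` A) (TStr ` A))"
    using s by simp
  then show ?case using insert.IH[OF fl insert.prems(2)] insert.prems(3) by simp
qed

lemma sorted_relators:
  assumes "finite A" "finite L" "TStr ` A \<subseteq> L" "finsupp x"
    and "\<And>D a e. x D \<noteq> 0 \<Longrightarrow> a \<in> A \<Longrightarrow> Tail e \<notin> set (strands D (HStr a)) \<and> Head e \<notin> set (strands D (TStr a))"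
    and "x \<in> comb.span (gen_relators L (HStr ` A) (TStr ` A))"
  shows "x \<in> comb.span (relators L)"
  using assms
proof (induction A)
  case (insert a A)
  have minus: "HStr ` insert a A - {HStr a} = HStr ` A" "TStr ` insert a A - {TStr a} = TStr ` A"
    using insert.hyps by auto
  have "lin (srt_label a) x = x"
    using insert.prems by (intro lin_id srt_sorted) auto
  moreover have "lin (srt_label a) x \<in> comb.span (gen_relators L (HStr ` insert a A - {HStr a}) (TStr ` insert a A - {TStr a}))"
    using insert.prems by (intro lin_srt_gen_relators) auto
  ultimately show ?case using insert unfolding minus by auto
qed simp

lemma stitch_diag_other:
  assumes "finite A" "l \<notin> Str ` A" "l \<notin> ht A A"
  shows "strands (stitch_diag A D) l = strands D l"
  using assms
proof (induction A)
  case (insert a A)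
  then show ?case by (auto simp: stitch_diag_insert dm_def ht_def)
qed (simp add: stitch_diag_def)

lemma doubled_stitch:
  assumes "finite A" "fresh_labels L A" "arrow_diagram (L \<union> ht A A) D"
    and "\<And>a e. a \<in> A \<Longrightarrow> Tail e \<notin> set (strands D (HStr a)) \<and> Head e \<notin> set (strands D (TStr a))"
  shows "doubled A (stitch_diag A D) - basis D
    \<in> comb.span (gen_relators (L \<union> ht A A) (HStr ` A) (TStr ` A))"
  using assms
proof (induction A arbitrary: L)
  case empty
  then show ?case by (simp add: stitch_diag_def comb.span_zero)
next
  case (insert a A)
  note fresh = fresh_facts[OF insert.prems(1) insert.hyps(1,2)]
  let ?L = "insert (HStr a) (insert (TStr a) L)"
  let ?G = "comb.span (gen_relators (L \<union> ht (insert a A) (insert a A)) (HStr ` insert a A) (TStr ` insert a A))"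
  let ?D = "stitch_diag A D"
  have fl: "fresh_labels ?L A"
    using fresh_labels_insert(2)[OF insert.prems(1) insert.hyps(2)] .
  have L: "?L \<union> ht A A = L \<union> ht (insert a A) (insert a A)" by (simp add: ht_insert)
  have D: "arrow_diagram (?L \<union> ht A A) D" using insert.prems unfolding L by simp
  have D': "arrow_diagram (insert (HStr a) (insert (TStr a) (L \<union> Str ` A))) ?D"
    using homogeneous_stitched[OF insert.hyps(1) fl] D
    by (auto simp: homogeneous_def stitched_def basis_def)
  have same: "strands ?D (HStr a) = strands D (HStr a)" "strands ?D (TStr a) = strands D (TStr a)"
    using insert.hyps by (auto intro: stitch_diag_other)
  have "dbl_label a (dm (HStr a) (TStr a) (Str a) ?D) - basis ?D
      \<in> comb.span (gen_relators (insert (HStr a) (insert (TStr a) (L \<union> Str ` A))) {HStr a} {TStr a})"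
    using fresh D' insert.prems(3) by (intro dbl_stc) (auto simp: same)
  then have "lin (doubled A) (dbl_label a (dm (HStr a) (TStr a) (Str a) ?D) - basis ?D)
      \<in> comb.span (gen_relators (?L \<union> ht A A) {HStr a} {TStr a})"
    by (intro lin_doubled_relators[OF insert.hyps(1) fl]) auto
  also have "lin (doubled A) (dbl_label a (dm (HStr a) (TStr a) (Str a) ?D) - basis ?D) =
      doubled (insert a A) (stitch_diag (insert a A) D) - doubled A ?D"
  proof -
    have "finsupp (dbl_label a E)" for E :: "'a label diag" by (cases E) (simp add: strand_op_dbl)
    then show ?thesis
      by (simp add: doubled_insert'[OF insert.hyps(1,2)] stitch_diag_insert[OF insert.hyps(1,2)]
          lin_diff locfin_finsupp)
  qed
  finally have 1: "doubled (insert a A) (stitch_diag (insert a A) D) - doubled A ?D \<in> ?G"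
    unfolding L by (rule subsetD[OF comb.span_mono[OF gen_relators_mono], rotated 2]) auto
  have "doubled A ?D - basis D \<in> comb.span (gen_relators (?L \<union> ht A A) (HStr ` A) (TStr ` A))"
    using insert.IH[OF fl D] insert.prems by auto
  then have 2: "doubled A ?D - basis D \<in> ?G"
    unfolding L by (rule subsetD[OF comb.span_mono[OF gen_relators_mono], rotated 2]) auto
  from comb.span_add[OF 1 2] show ?case by simp
qed

section \<open>Sorting diagrams\<close>

lemma card_insert_filter:
  assumes "finite V" "(p, q, r) \<notin> V"
  shows "card {(a, b, c) \<in> insert (p, q, r) V. P a b c} = card {(a, b, c) \<in> V. P a b c} + (if P p q r then 1 else 0)"
proof -
  have "{(a, b, c) \<in> insert (p, q, r) V. P a b c} =
      (if P p q r then insert (p, q, r) {(a, b, c) \<in> V. P a b c} else {(a, b, c) \<in> V. P a b c})"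
    by auto
  moreover have "finite {(a, b, c) \<in> V. P a b c}"
    using assms(1) by (rule rev_finite_subset) auto
  ultimately show ?thesis using assms(2) by auto
qed

lemma finite_edges:
  assumes "finite L" "arrow_diagram L D"
  shows "finite (edges D)"
proof -
  let ?M = "ends L (strands D)"
  have "on_skeleton D = {e. Head e \<in># ?M \<or> Tail e \<in># ?M}"
    using on_skeleton_ends[OF assms(1) vanishing_simps(2)[OF assms(2)], of "verts D"] by simp
  also have "\<dots> = Head -` set_mset ?M \<union> Tail -` set_mset ?M" by auto
  also have "finite \<dots>" by (intro finite_UnI finite_vimageI) (auto intro: injI)
  finally show ?thesis using assms(2) by (auto simp: edges_def arrow_diagram_def)
qed

context
  fixes L :: "'l set" and w :: "'l \<Rightarrow> endpoint list" and V a us e p vs f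
  assumes L: "finite L" and D: "arrow_diagram L (Diag w V)"
    and w: "w a = us @ [Tail e, Head p] @ vs" and f: "f \<notin> edges (Diag w V)"
begin

lemma STU2_facts:
  "finite V" "(f, p, e) \<notin> V" "a \<in> L" "f \<noteq> e" "f \<noteq> p" "e \<in> edges (Diag w V)" "p \<in> edges (Diag w V)"
  "vanishing L w"
proof -
  show "finite V" using D by (simp add: arrow_diagram_def)
  show "(f, p, e) \<notin> V" using f by (force simp: edges_def)
  show "a \<in> L" using D w by (force simp: arrow_diagram_def)
  have "Tail e \<in> set (w a)" "Head p \<in> set (w a)" using w by auto
  then show "e \<in> edges (Diag w V)" "p \<in> edges (Diag w V)"
    unfolding edges_def on_skeleton_def diag.sel by blast+
  then show "f \<noteq> e" "f \<noteq> p" using f by auto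
  show "vanishing L w" using vanishing_simps(2)[OF D] by simp
qed

lemma STU2_ends:
  "ends L (w(a := us @ [Tail f] @ vs)) + {#Tail e, Head p#} = ends L w + {#Tail f#}"
proof -
  obtain L0 where L0: "L = insert a L0" "a \<notin> L0" using mk_disjoint_insert[OF STU2_facts(3)] by blast
  then have "finite L0" using L by simp
  show ?thesis
    unfolding L0(1) ends_insert[OF \<open>finite L0\<close> L0(2)] ends_update[OF L0(2)] fun_upd_same w by simp
qed

lemma degree_STU2: "degree (Diag (w(a := us @ [Tail f] @ vs)) (insert (f, p, e) V)) = degree (Diag w V)"
proof -
  note facts = STU2_facts
  have "size (ends L (w(a := us @ [Tail f] @ vs))) + 2 = size (ends L w) + 1"
    using arg_cong[OF STU2_ends, of size] by simp
  then show ?thesis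
    using L facts by (simp add: degree_ends[of L] vanishing_update)
qed

lemma arrow_STU2: "arrow_diagram L (Diag (w(a := us @ [Tail f] @ vs)) (insert (f, p, e) V))"
proof -
  note facts = STU2_facts
  let ?D = "Diag w V" and ?w = "w(a := us @ [Tail f] @ vs)"
  let ?D' = "Diag ?w (insert (f, p, e) V)"
  have van: "vanishing L ?w" using facts by (simp add: vanishing_update)
  have ends: "count (ends L ?w) x + (if x = Tail e then 1 else 0) + (if x = Head p then 1 else 0)
      = count (ends L w) x + (if x = Tail f then 1 else 0)" for x
    using arg_cong[OF STU2_ends, of "\<lambda>M. count M x"] by (auto split: if_splits)
  have skel: "on_skeleton ?D = {x. Head x \<in># ends L w \<or> Tail x \<in># ends L w}"
    "on_skeleton ?D' = {x. Head x \<in># ends L ?w \<or> Tail x \<in># ends L ?w}"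
    using L facts van by (simp_all add: on_skeleton_ends)
  have skel': "x \<in> on_skeleton ?D \<Longrightarrow> x \<in> on_skeleton ?D' \<or> x = e \<or> x = p" for x
    using ends[of "Head x"] ends[of "Tail x"] unfolding skel
    by (auto simp: not_in_iff count_greater_zero_iff[symmetric] split: if_splits simp del: count_greater_zero_iff)
  have skel_f: "f \<in> on_skeleton ?D'"
    using ends[of "Tail f"] facts unfolding skel by (auto simp: not_in_iff)
  have "x \<in> on_skeleton ?D' \<Longrightarrow> x \<in> on_skeleton ?D \<or> x = f" for x
    using ends[of "Head x"] ends[of "Tail x"] unfolding skel
    by (auto simp: not_in_iff count_greater_zero_iff[symmetric] split: if_splits simp del: count_greater_zero_iff)
  then have edges': "x \<in> edges ?D' \<Longrightarrow> x \<in> edges ?D \<or> x = f" for x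
    using facts(6,7) unfolding edges_def by auto
  have out: "departures L ?D x = 0 \<and> arrivals L ?D x = 0" if "x \<notin> edges ?D" for x
  proof -
    have "Head x \<notin># ends L w" "Tail x \<notin># ends L w"
      using that L facts(8) by (auto simp: edges_def on_skeleton_ends)
    moreover have "card {(p, q, r) \<in> V. r = x} = 0" "card {(p, q, r) \<in> V. q = x} = 0"
      "card {(p, q, r) \<in> V. p = x} = 0"
      using that by (fastforce simp: edges_def card_eq_0_iff)+
    ultimately show ?thesis
      by (simp add: departures_def arrivals_def count_list_ends not_in_iff)
  qed
  have dep: "departures L ?D' x = departures L ?D x + (if x = f then 1 else 0)"
    and arr: "arrivals L ?D' x = arrivals L ?D x + (if x = f then 1 else 0)" for x
    unfolding departures_def arrivals_def diag.sel count_list_ends card_insert_filter[OF facts(1,2)]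
    using ends[of "Tail x"] ends[of "Head x"] facts(4,5) by (auto split: if_splits simp del: fun_upd_apply)
  have one: "departures L ?D' x = 1 \<and> arrivals L ?D' x = 1" if "x \<in> edges ?D'" for x
  proof (cases "x = f")
    case True
    then show ?thesis using out[OF f] unfolding dep arr by simp
  next
    case False
    then show ?thesis using edges'[OF that] D unfolding dep arr arrow_diagram_def by simp
  qed
  have conn: "\<exists>x'\<in>on_skeleton ?D'. (x, x') \<in> (adjacent_edges ?D')\<^sup>*" if x: "x \<in> edges ?D'" for x
  proof (cases "x = f")
    case True
    then show ?thesis using skel_f by blast
  next
    case False
    then have xD: "x \<in> edges ?D" using edges'[OF x] by simp
    have conn: "\<forall>x\<in>edges ?D. \<exists>x'\<in>on_skeleton ?D. (x, x') \<in> (adjacent_edges ?D)\<^sup>*"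
      using D unfolding arrow_diagram_def by (elim conjE)
    obtain x' where x': "x' \<in> on_skeleton ?D" "(x, x') \<in> (adjacent_edges ?D)\<^sup>*"
      using bspec[OF conn xD] by (elim bexE)
    have "adjacent_edges ?D \<subseteq> adjacent_edges ?D'" unfolding adjacent_edges_def diag.sel by blast
    then have path: "(x, x') \<in> (adjacent_edges ?D')\<^sup>*" using x'(2) by (rule subsetD[OF rtrancl_mono])
    have step: "(e, f) \<in> adjacent_edges ?D'" "(p, f) \<in> adjacent_edges ?D'"
      unfolding adjacent_edges_def diag.sel by simp_all
    from skel'[OF x'(1)] show ?thesis
    proof (elim disjE)
      assume "x' \<in> on_skeleton ?D'"
      then show ?thesis using path by (rule rev_bexI)
    next
      assume "x' = e"
      then show ?thesis using skel_f rtrancl_into_rtrancl[OF path] step(1) by (intro bexI[of _ f]) simp_all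
    next
      assume "x' = p"
      then show ?thesis using skel_f rtrancl_into_rtrancl[OF path] step(2) by (intro bexI[of _ f]) simp_all
    qed
  qed
  show ?thesis
    unfolding arrow_diagram_def
  proof (intro conjI)
    show "\<forall>l. l \<notin> L \<longrightarrow> strands ?D' l = []" using van by (simp add: vanishing_def)
    show "finite (verts ?D')" using facts by simp
    show "\<forall>x\<in>edges ?D'. departures L ?D' x = 1 \<and> arrivals L ?D' x = 1" using one by (rule ballI)
    show "\<forall>x\<in>edges ?D'. \<exists>x'\<in>on_skeleton ?D'. (x, x') \<in> (adjacent_edges ?D')\<^sup>*" using conn by (rule ballI)
  qed
qed

end

text \<open>Decreases when \<open>STU2\<close> slides a head below a tail, in both resulting diagrams.\<close>

fun head_positions :: "nat \<Rightarrow> endpoint list \<Rightarrow> nat" where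
  "head_positions k [] = 0"
| "head_positions k (Head e # u) = k + head_positions (Suc k) u"
| "head_positions k (Tail e # u) = head_positions (Suc k) u"

lemma head_positions_append:
  "head_positions k (u @ v) = head_positions k u + head_positions (k + length u) v"
  by (induction k u rule: head_positions.induct) auto

lemma head_positions_mono: "head_positions k u \<le> head_positions (Suc k) u"
proof (induction u arbitrary: k)
  case (Cons x u)
  then show ?case by (cases x) (auto simp: add_mono intro: le_SucI)
qed simp

lemma head_positions_less:
  "head_positions 0 (us @ [Head p, Tail e] @ vs) < head_positions 0 (us @ [Tail e, Head p] @ vs)"
  "head_positions 0 (us @ [Tail f] @ vs) < head_positions 0 (us @ [Tail e, Head p] @ vs)"
  using head_positions_mono[of "Suc (length us)" vs] by (simp_all add: head_positions_append)

lemma tail_strand_cases: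
  obtains "\<And>e. Head e \<notin> set w" | e us where "w = Head e # us"
  | us e p vs where "w = us @ [Tail e, Head p] @ vs"
proof -
  have "(\<forall>e. Head e \<notin> set w) \<or> (\<exists>e us. w = Head e # us) \<or> (\<exists>us e p vs. w = us @ [Tail e, Head p] @ vs)"
  proof (induction w)
    case (Cons x w)
    show ?case
    proof (cases x)
      case (Tail e)
      from Cons consider "\<forall>e. Head e \<notin> set w" | p vs where "w = Head p # vs"
        | us e p vs where "w = us @ [Tail e, Head p] @ vs" by blast
      then show ?thesis
      proof cases
        case (2 p vs)
        then have "x # w = [] @ [Tail e, Head p] @ vs" using Tail by simp
        then show ?thesis by blast
      next
        case (3 us e' p vs)
        then have "x # w = (x # us) @ [Tail e', Head p] @ vs" by simp
        then show ?thesis by blast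
      qed (use Tail in auto)
    qed auto
  qed simp
  then show thesis using that by blast
qed

lemma sorting:
  assumes S: "finite S" and D: "arrow_diagram (ht S S) D"
  shows "\<exists>y. finsupp y \<and> (\<forall>E. y E \<noteq> 0 \<longrightarrow> arrow_diagram (ht S S) E \<and> sorted_diag E \<and> degree E = degree D)
    \<and> basis D - y \<in> comb.span (ht_relators S S)"
  using D
proof (induction "\<Sum>a\<in>S. head_positions 0 (strands D (TStr a))" arbitrary: D rule: less_induct)
  case less
  obtain w V where DV: "D = Diag w V" by (cases D)
  have zero: ?case if "basis D \<in> ht_relators S S"
    using that by (intro exI[of _ 0]) (simp add: pointwise comb.span_base)
  consider a e where "Tail e \<in> set (w (HStr a))"
    | a e us where "w (TStr a) = Head e # us"
    | a us e p vs where "w (TStr a) = us @ [Tail e, Head p] @ vs"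
    | "\<And>a e. Tail e \<notin> set (w (HStr a))" "\<And>a e. Head e \<notin> set (w (TStr a))"
    by (metis tail_strand_cases)
  then show ?case
  proof cases
    case (1 a e)
    then show ?thesis using zero ht_relators.tail_on_head_strand[OF less.prems] by (simp add: DV)
  next
    case (2 a e us)
    then show ?thesis using zero ht_relators.CP[OF less.prems] by (simp add: DV)
  next
    case (3 a us e p vs)
    have fin: "finite (ht S S)" using S by simp
    have wD: "arrow_diagram (ht S S) (Diag w V)" using less.prems DV by simp
    obtain f where f: "f \<notin> edges (Diag w V)"
      using finite_edges[OF fin wD] ex_new_if_finite[OF infinite_UNIV_nat] by blast
    have a: "a \<in> S" using STU2_facts(3)[OF fin wD 3 f] by simp
    let ?w1 = "w(TStr a := us @ [Head p, Tail e] @ vs)" and ?w2 = "w(TStr a := us @ [Tail f] @ vs)"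
    let ?D1 = "Diag ?w1 V" and ?D2 = "Diag ?w2 (insert (f, p, e) V)"
    have perm: "mset (us @ [Head p, Tail e] @ vs) = mset (w (TStr a))" using 3 by simp
    have D1: "arrow_diagram (ht S S) ?D1" "degree ?D1 = degree D" "f \<notin> edges ?D1"
      using wD f arrow_diagram_update_perm[where w = w and l = "TStr a", OF perm]
        degree_update_perm[where w = w and l = "TStr a", OF perm]
        edges_update_perm[where w = w and l = "TStr a", OF perm]
      by (simp_all add: DV del: fun_upd_apply)
    have D2: "arrow_diagram (ht S S) ?D2" "degree ?D2 = degree D"
      using arrow_STU2[OF fin wD 3 f] degree_STU2[OF fin wD 3 f] DV by simp_all
    have less': "(\<Sum>b\<in>S. head_positions 0 ((w(TStr a := m)) (TStr b))) < (\<Sum>b\<in>S. head_positions 0 (strands D (TStr b)))"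
      if "head_positions 0 m < head_positions 0 (w (TStr a))" for m
      using that a S by (intro sum_strict_mono_ex1) (auto simp: DV)
    obtain y1 where y1: "finsupp y1"
        "\<And>E. y1 E \<noteq> 0 \<Longrightarrow> arrow_diagram (ht S S) E \<and> sorted_diag E \<and> degree E = degree D"
        "basis ?D1 - y1 \<in> comb.span (ht_relators S S)"
      using less.hyps[of ?D1, OF _ D1(1)] less'[of "us @ [Head p, Tail e] @ vs"] head_positions_less(1) D1(2)
      unfolding 3 diag.sel by metis
    obtain y2 where y2: "finsupp y2"
        "\<And>E. y2 E \<noteq> 0 \<Longrightarrow> arrow_diagram (ht S S) E \<and> sorted_diag E \<and> degree E = degree D"
        "basis ?D2 - y2 \<in> comb.span (ht_relators S S)"
      using less.hyps[of ?D2, OF _ D2(1)] less'[of "us @ [Tail f] @ vs"] head_positions_less(2) D2(2)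
      unfolding 3 diag.sel by metis
    have R: "basis ?D1 - basis D - basis ?D2 \<in> ht_relators S S"
    proof (rule ht_relators.aw)
      have eq: "w = ?w1(TStr a := us @ [Tail e, Head p] @ vs)" using 3 by auto
      have "basis ?D1 - basis (Diag (?w1(TStr a := us @ [Tail e, Head p] @ vs)) V)
          - basis (Diag (?w1(TStr a := us @ [Tail f] @ vs)) (insert (f, p, e) V)) \<in> relators (ht S S)"
        using D1 by (intro relators.STU2) auto
      then show "basis ?D1 - basis D - basis ?D2 \<in> relators (ht S S)"
        unfolding DV eq[symmetric] by simp
    qed
    have "(basis ?D1 - y1) - (basis ?D2 - y2) - (basis ?D1 - basis D - basis ?D2) \<in> comb.span (ht_relators S S)"
      by (rule comb.span_diff[OF comb.span_diff[OF y1(3) y2(3)] comb.span_base[OF R]])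
    then have "basis D - (y1 - y2) \<in> comb.span (ht_relators S S)" by (simp add: algebra_simps)
    moreover have "arrow_diagram (ht S S) E \<and> sorted_diag E \<and> degree E = degree D" if "(y1 - y2) E \<noteq> 0" for E
      using that y1(2)[of E] y2(2)[of E] by (cases "y1 E = 0") (auto simp: pointwise)
    ultimately show ?thesis using y1(1) y2(1) by (intro exI[of _ "y1 - y2"]) auto
  next
    case 4
    then show ?thesis using less.prems
      by (intro exI[of _ "basis D"] conjI finsupp_basis) (auto simp: DV sorted_diag_def basis_def comb.span_zero)
  qed
qed

section \<open>The isomorphism and its inverse\<close>

lemma lin_basis_id: "lin basis x = x"
proof
  fix E show "lin basis x E = x E"
    by (subst lin_eval[where A = "{E}"]) (auto simp: basis_def split: if_splits)
qed

lemma lin_lin_chains: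
  fixes F :: "'m diag \<Rightarrow> 'n comb"
  assumes "homogeneous L L' G" "homogeneous L' L'' F" "x \<in> chains L"
  shows "lin F (lin G x) = lin (\<lambda>D. lin F (G D)) x"
proof
  fix E :: "'n diag"
  let ?d = "degree E"
  have "lin F (lin G x) E = degree_part ?d (lin F (lin G x)) E" by (simp add: degree_part_def)
  also have "\<dots> = lin F (lin G (degree_part ?d x)) E"
    using assms lin_degree_part lin_chains by metis
  also have "\<dots> = lin (\<lambda>D. lin F (G D)) (degree_part ?d x) E"
    using assms degree_part_arrow[OF assms(3)]
    by (subst lin_lin) (auto simp: finsupp_degree_part homogeneous_def)
  also have "\<dots> = degree_part ?d (lin (\<lambda>D. lin F (G D)) x) E"
    using lin_degree_part[OF homogeneous_lin[OF assms(1,2)] assms(3)] by simp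
  finally show "lin F (lin G x) E = lin (\<lambda>D. lin F (G D)) x E" by (simp add: degree_part_def)
qed

lemma lin_ext_double: "lin_ext (double_diag S) = lin (doubled S)"
  by (simp add: lin_ext_eq_lin doubled_def[abs_def])

lemma lin_ext_stitch: "lin_ext (\<lambda>D. {#stitch_diag S D#}) = lin (stitched S)"
  by (simp add: lin_ext_eq_lin stitched_def[abs_def])

context
  fixes S :: "'a set"
  assumes S: "finite S"
begin

lemma fresh_empty: "fresh_labels {} S"
  by (simp add: fresh_labels_def)

lemma doubled_homogeneous: "homogeneous (Str ` S) (ht S S) (doubled S)"
  using homogeneous_doubled[OF S fresh_empty] by simp

lemma stitched_homogeneous: "homogeneous (ht S S) (Str ` S) (stitched S)"
  using homogeneous_stitched[OF S fresh_empty] by simp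

lemma doubled_aw_rel:
  "(x, y) \<in> aw_rel (Str ` S) \<Longrightarrow> (lin (doubled S) x, lin (doubled S) y) \<in> aw_rel (ht S S)"
  unfolding aw_rel_def using lin_doubled_relators[OF S fresh_empty, where Hs = "{}" and Ts = "{}"]
  by (intro lin_mod_relators[OF doubled_homogeneous]) auto

lemma stitched_aw_rel:
  "(x, y) \<in> aw_rel (ht S S) \<Longrightarrow> (lin (stitched S) x, lin (stitched S) y) \<in> aw_rel (Str ` S)"
  unfolding aw_rel_def using lin_stitched_relators[OF S fresh_empty]
  by (intro lin_mod_relators[OF stitched_homogeneous]) auto

lemma aw_rel_subset: "aw_rel (ht S S) \<subseteq> ht_rel S S"
proof -
  have "comb.span (relators (ht S S)) \<subseteq> comb.span (ht_relators S S)"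
    by (intro comb.span_mono) (auto intro: ht_relators.aw)
  then show ?thesis unfolding aw_rel_def ht_rel_def mod_relators_def by auto
qed

lemma equivs:
  "equiv (chains (Str ` S)) (aw_rel (Str ` S))" "equiv (chains (ht S S)) (aw_rel (ht S S))"
  "equiv (chains (ht S S)) (ht_rel S S)"
  by (simp_all add: aw_rel_def ht_rel_def equiv_mod_relators)

lemma delta_class:
  assumes x: "x \<in> chains (Str ` S)"
  shows "delta S (aw_rel (Str ` S) `` {x}) = ht_rel S S `` {lin (doubled S) x}"
proof -
  let ?f = "lin (doubled S)"
  have fx: "?f x \<in> chains (ht S S)" using lin_chains[OF doubled_homogeneous x] .
  have "double S (aw_rel (Str ` S) `` {x}) = aw_rel (ht S S) `` {?f x}"
    unfolding double_def lin_ext_double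
    by (rule UN_equiv_class[OF equivs(1) _ x])
       (intro congruentI equiv_class_eq[OF equivs(2)] doubled_aw_rel)
  moreover have "ht_proj S S (aw_rel (ht S S) `` {?f x}) = ht_rel S S `` {?f x}"
    unfolding ht_proj_def
    by (rule UN_equiv_class[OF equivs(2) _ fx])
       (intro congruentI equiv_class_eq[OF equivs(3)] subsetD[OF aw_rel_subset])
  ultimately show ?thesis by (simp add: delta_def)
qed

lemma stitch_class:
  assumes x: "x \<in> chains (ht S S)"
  shows "stitch S (aw_rel (ht S S) `` {x}) = aw_rel (Str ` S) `` {lin (stitched S) x}"
  unfolding stitch_def lin_ext_stitch
  by (rule UN_equiv_class[OF equivs(2) _ x])
     (intro congruentI equiv_class_eq[OF equivs(1)] stitched_aw_rel)

lemma doubled_rel_inj: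
  assumes "x \<in> chains (Str ` S)" "y \<in> chains (Str ` S)"
    and "(lin (doubled S) x, lin (doubled S) y) \<in> ht_rel S S"
  shows "(x, y) \<in> aw_rel (Str ` S)"
proof -
  note lf = locfin_chains[OF doubled_homogeneous]
  have "degree_part d (x - y) \<in> comb.span (relators (Str ` S))" for d
  proof -
    have xy: "x - y \<in> chains (Str ` S)" using assms chains_diff by blast
    have "lin (doubled S) (degree_part d (x - y)) = degree_part d (lin (doubled S) x - lin (doubled S) y)"
      using assms lf xy by (simp add: lin_diff flip: lin_degree_part[OF doubled_homogeneous])
    then have "lin (doubled S) (degree_part d (x - y)) \<in> comb.span (gen_relators (ht S S) (HStr ` S) (TStr ` S))"
      using assms(3) by (simp add: ht_rel_def mod_relators_def ht_relators_eq)
    then show ?thesis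
      using doubled_inj[OF S fresh_empty finsupp_degree_part[OF xy, of d]] degree_part_arrow[OF xy, of d] by simp
  qed
  then show ?thesis using assms by (simp add: aw_rel_def mod_relators_def)
qed

lemma sorted_representative:
  assumes y: "y \<in> chains (ht S S)"
  obtains x where "x \<in> sorted_chains S S" "(y, x) \<in> ht_rel S S"
proof -
  define Y where "Y D = (SOME z. finsupp z
      \<and> (\<forall>E. z E \<noteq> 0 \<longrightarrow> arrow_diagram (ht S S) E \<and> sorted_diag E \<and> degree E = degree D)
      \<and> basis D - z \<in> comb.span (ht_relators S S))" for D
  have Y: "finsupp (Y D) \<and> (\<forall>E. Y D E \<noteq> 0 \<longrightarrow> arrow_diagram (ht S S) E \<and> sorted_diag E \<and> degree E = degree D)
      \<and> basis D - Y D \<in> comb.span (ht_relators S S)" if "arrow_diagram (ht S S) D" for D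
    unfolding Y_def using sorting[OF S that] by (rule someI_ex)
  then have hom: "homogeneous (ht S S) (ht S S) Y" by (auto simp: homogeneous_def)
  have "(lin basis y, lin Y y) \<in> ht_rel S S"
    unfolding ht_rel_def using Y by (intro mod_relatorsI_lin[OF homogeneous_basis hom y]) auto
  moreover have "sorted_diag E" if "lin Y y E \<noteq> 0" for E
  proof -
    have "{D. y D \<noteq> 0 \<and> Y D E \<noteq> 0} \<noteq> {}"
      using that unfolding lin_def by (metis (no_types, lifting) sum.empty)
    then show ?thesis using Y y by (auto simp: chains_def)
  qed
  ultimately show thesis
    using that[of "lin Y y"] lin_chains[OF hom y] by (auto simp: lin_basis_id sorted_chains_def)
qed

lemma doubled_stitched:
  assumes x: "x \<in> sorted_chains S S"
  shows "(lin (doubled S) (lin (stitched S) x), x) \<in> ht_rel S S"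
proof -
  have c: "x \<in> chains (ht S S)" and sorted: "\<And>D. x D \<noteq> 0 \<Longrightarrow> sorted_diag D"
    using x by (auto simp: sorted_chains_def)
  have "(lin (\<lambda>D. lin (doubled S) (stitched S D)) x, lin basis x) \<in> ht_rel S S"
    unfolding ht_rel_def
  proof (rule mod_relatorsI_lin[OF homogeneous_lin[OF stitched_homogeneous doubled_homogeneous] homogeneous_basis c])
    fix D assume "arrow_diagram (ht S S) D" "x D \<noteq> 0"
    then show "lin (doubled S) (stitched S D) - basis D \<in> comb.span (ht_relators S S)"
      using doubled_stitch[OF S fresh_empty, of D] sorted[of D]
      by (simp add: stitched_def sorted_diag_def ht_relators_eq)
  qed
  then show ?thesis
    by (simp add: lin_basis_id lin_lin_chains[OF stitched_homogeneous doubled_homogeneous c])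
qed

lemma sorted_rel:
  assumes "x \<in> sorted_chains S S" "y \<in> sorted_chains S S" "(x, y) \<in> ht_rel S S"
  shows "(x, y) \<in> aw_rel (ht S S)"
proof -
  have c: "x \<in> chains (ht S S)" "y \<in> chains (ht S S)"
    and sorted: "\<And>D. (x - y) D \<noteq> 0 \<Longrightarrow> sorted_diag D"
    using assms by (auto simp: sorted_chains_def pointwise) (metis)
  then have xy: "x - y \<in> chains (ht S S)" by (simp add: chains_diff)
  have "degree_part d (x - y) \<in> comb.span (relators (ht S S))" for d
  proof (rule sorted_relators[OF S])
    show "degree_part d (x - y) \<in> comb.span (gen_relators (ht S S) (HStr ` S) (TStr ` S))"
      using assms(3) by (simp add: ht_rel_def mod_relators_def ht_relators_eq)
    fix D a e assume "degree_part d (x - y) D \<noteq> 0"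
    then have "sorted_diag D" by (intro sorted) (simp add: degree_part_def split: if_splits)
    then show "Tail e \<notin> set (strands D (HStr a)) \<and> Head e \<notin> set (strands D (TStr a))"
      by (simp add: sorted_diag_def)
  qed (use S xy in \<open>auto simp: ht_def finsupp_degree_part\<close>)
  then show ?thesis using c by (simp add: aw_rel_def mod_relators_def)
qed

lemma delta_inj: "inj_on (delta S) (Aw (Str ` S))"
proof (rule inj_onI)
  fix X Y assume X: "X \<in> Aw (Str ` S)" "Y \<in> Aw (Str ` S)" "delta S X = delta S Y"
  then obtain x y where x: "x \<in> chains (Str ` S)" "X = aw_rel (Str ` S) `` {x}"
    and y: "y \<in> chains (Str ` S)" "Y = aw_rel (Str ` S) `` {y}"
    by (auto simp: Aw_def quotient_def)
  have "(lin (doubled S) x, lin (doubled S) y) \<in> ht_rel S S"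
    using X(3) x y eq_equiv_class_iff[OF equivs(3)] lin_chains[OF doubled_homogeneous]
    by (simp add: delta_class)
  then show "X = Y" using doubled_rel_inj x y equiv_class_eq[OF equivs(1)] by simp
qed

lemma class_add_eq:
  assumes "r = mod_relators L G" "x \<in> chains L" "y \<in> chains L"
  shows "class_add r (r `` {x}) (r `` {y}) = r `` {x + y}"
  unfolding class_add_def assms(1)
  by (rule UN_equiv_class2[OF equiv_mod_relators equiv_mod_relators _ assms(2,3)])
     (intro congruent2I' equiv_class_eq[OF equiv_mod_relators] mod_relators_add)

lemma class_scale_eq:
  assumes "r = mod_relators L G" "x \<in> chains L"
  shows "class_scale r c (r `` {x}) = r `` {scale c x}"
  unfolding class_scale_def assms(1)
  by (rule UN_equiv_class[OF equiv_mod_relators _ assms(2)])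
     (intro congruentI equiv_class_eq[OF equiv_mod_relators] mod_relators_scale)

lemma delta_stitch:
  assumes "x \<in> sorted_chains S S"
  shows "delta S (stitch S (aw_rel (ht S S) `` {x})) = ht_rel S S `` {x}"
    and "stitch S (aw_rel (ht S S) `` {x}) \<in> Aw (Str ` S)"
proof -
  have c: "x \<in> chains (ht S S)" using assms by (simp add: sorted_chains_def)
  have c': "lin (stitched S) x \<in> chains (Str ` S)" using lin_chains[OF stitched_homogeneous c] .
  show "delta S (stitch S (aw_rel (ht S S) `` {x})) = ht_rel S S `` {x}"
    using doubled_stitched[OF assms] equiv_class_eq[OF equivs(3)]
    by (simp add: stitch_class c delta_class c')
  show "stitch S (aw_rel (ht S S) `` {x}) \<in> Aw (Str ` S)"
    using c' by (auto simp: stitch_class c Aw_def intro: quotientI)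
qed

lemma delta_iso: "vector_space_iso (Aw (Str ` S)) (aw_rel (Str ` S)) (Aw_ht S S) (ht_rel S S) (delta S)"
  unfolding vector_space_iso_def
proof (intro conjI ballI allI)
  note lf = locfin_chains[OF doubled_homogeneous]
  have into: "delta S X \<in> Aw_ht S S" if "X \<in> Aw (Str ` S)" for X
    using that lin_chains[OF doubled_homogeneous] by (auto simp: Aw_def Aw_ht_def quotient_def delta_class)
  have onto: "Y \<in> delta S ` Aw (Str ` S)" if "Y \<in> Aw_ht S S" for Y
  proof -
    obtain y where y: "y \<in> chains (ht S S)" "Y = ht_rel S S `` {y}"
      using \<open>Y \<in> _\<close> by (auto simp: Aw_ht_def quotient_def)
    obtain x where x: "x \<in> sorted_chains S S" "(y, x) \<in> ht_rel S S"
      using sorted_representative[OF y(1)] by blast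
    then show ?thesis
      using delta_stitch[OF x(1)] y(2) equiv_class_eq[OF equivs(3) x(2)] by (metis image_eqI)
  qed
  show "bij_betw (delta S) (Aw (Str ` S)) (Aw_ht S S)"
    using delta_inj into onto by (auto simp: bij_betw_def)
  {
    fix X Y assume "X \<in> Aw (Str ` S)" "Y \<in> Aw (Str ` S)"
    then obtain x y where x: "x \<in> chains (Str ` S)" "X = aw_rel (Str ` S) `` {x}"
      and y: "y \<in> chains (Str ` S)" "Y = aw_rel (Str ` S) `` {y}"
      by (auto simp: Aw_def quotient_def)
    show "delta S (class_add (aw_rel (Str ` S)) X Y) = class_add (ht_rel S S) (delta S X) (delta S Y)"
      using x y lin_chains[OF doubled_homogeneous] lf
      by (simp add: class_add_eq[OF aw_rel_def] class_add_eq[OF ht_rel_def] delta_class chains_add lin_add)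
  }
  {
    fix c X assume "X \<in> Aw (Str ` S)"
    then obtain x where x: "x \<in> chains (Str ` S)" "X = aw_rel (Str ` S) `` {x}"
      by (auto simp: Aw_def quotient_def)
    show "delta S (class_scale (aw_rel (Str ` S)) c X) = class_scale (ht_rel S S) c (delta S X)"
      using x lin_chains[OF doubled_homogeneous]
      by (simp add: class_scale_eq[OF aw_rel_def] class_scale_eq[OF ht_rel_def] delta_class chains_scale lin_scale_comb)
  }
qed

lemma delta_inverse:
  assumes "D \<in> Aw_ht S S"
  shows "\<exists>D'. sorted_forms S D = {D'} \<and> inv_into (Aw (Str ` S)) (delta S) D = stitch S D'"
proof -
  obtain y where y: "y \<in> chains (ht S S)" "D = ht_rel S S `` {y}"
    using assms by (auto simp: Aw_ht_def quotient_def)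
  obtain x where x: "x \<in> sorted_chains S S" "(y, x) \<in> ht_rel S S"
    using sorted_representative[OF y(1)] by blast
  have D: "D = ht_rel S S `` {x}" using y(2) equiv_class_eq[OF equivs(3) x(2)] by simp
  have "aw_rel (ht S S) `` {x'} = aw_rel (ht S S) `` {x}" if "x' \<in> D \<inter> sorted_chains S S" for x'
    using that sorted_rel[OF x(1)] equiv_class_eq[OF equivs(2)] unfolding D by blast
  moreover have "x \<in> D \<inter> sorted_chains S S" using x y(2) by simp
  ultimately have "sorted_forms S D = {aw_rel (ht S S) `` {x}}"
    unfolding sorted_forms_def by blast
  moreover have "inv_into (Aw (Str ` S)) (delta S) D = stitch S (aw_rel (ht S S) `` {x})"
    using inv_into_f_eq[OF delta_inj delta_stitch(2)[OF x(1)]] delta_stitch(1)[OF x(1)] D by simp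
  ultimately show ?thesis by blast
qed

end

section \<open>The isomorphism is not multiplicative\<close>

text \<open>
  \<open>weight\<close> detects the tree with tails on the tail strands \<open>0\<close> and \<open>1\<close> and head on the head
  strand \<open>1\<close>. Its values on the other diagrams are forced by the relations: the first summand comes
  from \<open>STU1\<close>, the next two from \<open>STU2\<close> together with \<open>CP\<close>.
\<close>

definition tree_weight ::
  "endpoint list \<Rightarrow> endpoint list \<Rightarrow> endpoint list \<Rightarrow> (nat \<times> nat \<times> nat) set \<Rightarrow> rat" where
  "tree_weight t0 t1 h1 V =
     of_bool (\<exists>a b. a \<noteq> b \<and> V = {} \<and> t0 = [Tail a] \<and> t1 = [Tail b] \<and> h1 = [Head a, Head b])
   - of_bool (\<exists>a b. a \<noteq> b \<and> V = {} \<and> t0 = [Tail a, Head b] \<and> t1 = [Tail b] \<and> h1 = [Head a])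
   + of_bool (\<exists>a b. a \<noteq> b \<and> V = {} \<and> t0 = [Tail a] \<and> t1 = [Tail b, Head a] \<and> h1 = [Head b])
   + of_bool (\<exists>a b r. distinct [a, b, r] \<and> V = {(a, b, r)} \<and> t0 = [Tail a] \<and> t1 = [Tail b] \<and> h1 = [Head r])
   - of_bool (\<exists>a b r. distinct [a, b, r] \<and> V = {(b, a, r)} \<and> t0 = [Tail a] \<and> t1 = [Tail b] \<and> h1 = [Head r])"

definition weight :: "nat label diag \<Rightarrow> unit \<Rightarrow> rat" where
  "weight D _ = (if strands D (HStr 0) = []
     then tree_weight (strands D (TStr 0)) (strands D (TStr 1)) (strands D (HStr 1)) (verts D) else 0)"

abbreviation R2 :: "nat set" where "R2 \<equiv> {0, 1}"

lemma strand_label: "arrow_diagram L D \<Longrightarrow> strands D l \<noteq> [] \<Longrightarrow> l \<in> L"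
  using vanishing_simps(2)[of L D] by (auto simp: vanishing_def)

lemma ht_R2: "ht R2 R2 = {HStr 0, HStr 1, TStr 0, TStr 1}"
  by (auto simp: ht_def)

lemma append_eq_simps:
  "us @ x # y # vs = [a] \<longleftrightarrow> False"
  "us @ x # y # vs = [a, b] \<longleftrightarrow> us = [] \<and> x = a \<and> y = b \<and> vs = []"
  "us @ x # vs = [a] \<longleftrightarrow> us = [] \<and> x = a \<and> vs = []"
  by (auto simp: append_eq_Cons_conv)

lemma insert_eq_singleton: "v \<notin> V \<Longrightarrow> insert v V = {u} \<longleftrightarrow> V = {} \<and> v = u"
  by auto

lemma tree_weight_STU:
  assumes "bracket x y z v r" "v \<notin> V" "r \<notin> (\<lambda>x. case x of Head e \<Rightarrow> e | Tail e \<Rightarrow> e) ` {x, y}"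
  shows "tree_weight t0 t1 (us @ [x, y] @ vs) V - tree_weight t0 t1 (us @ [y, x] @ vs) V
      - tree_weight t0 t1 (us @ [z] @ vs) (insert v V) = 0"
    and "tree_weight t0 (us @ [x, y] @ vs) h1 V - tree_weight t0 (us @ [y, x] @ vs) h1 V
      - tree_weight t0 (us @ [z] @ vs) h1 (insert v V) = 0"
    and "tree_weight (us @ [x, y] @ vs) t1 h1 V - tree_weight (us @ [y, x] @ vs) t1 h1 V
      - tree_weight (us @ [z] @ vs) t1 h1 (insert v V) = 0"
  using assms
  by (cases; auto simp: tree_weight_def append_eq_simps insert_eq_singleton)+

lemma tree_weight_TC:
  "tree_weight t0 t1 (us @ [Tail d, Tail e] @ vs) V = 0"
  "tree_weight t0 (us @ [Tail d, Tail e] @ vs) h1 V = 0"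
  "tree_weight (us @ [Tail d, Tail e] @ vs) t1 h1 V = 0"
  by (auto simp: tree_weight_def append_eq_simps)

lemma tree_weight_AS:
  assumes "(p, q, r) \<notin> V" "(q, p, r) \<notin> V"
  shows "tree_weight t0 t1 h1 (insert (p, q, r) V) + tree_weight t0 t1 h1 (insert (q, p, r) V) = 0"
  using assms by (auto simp: tree_weight_def insert_eq_singleton)

lemma tree_weight_two: "u \<in> V \<Longrightarrow> v \<in> V \<Longrightarrow> u \<noteq> v \<Longrightarrow> tree_weight t0 t1 h1 V = 0"
  by (auto simp: tree_weight_def)

lemma tree_weight_killed:
  "tree_weight (Head e # us) t1 h1 V = 0"
  "tree_weight t0 (Head e # us) h1 V = 0"
  "Tail e \<in> set h1 \<Longrightarrow> tree_weight t0 t1 h1 V = 0"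
  by (auto simp: tree_weight_def)

lemma rename_end_eq:
  "rename_end f x = Head a \<longleftrightarrow> (\<exists>b. x = Head b \<and> a = f b)"
  "rename_end f x = Tail a \<longleftrightarrow> (\<exists>b. x = Tail b \<and> a = f b)"
  "Head a = rename_end f x \<longleftrightarrow> (\<exists>b. x = Head b \<and> a = f b)"
  by (cases x; auto)+

lemma tree_weight_rename:
  assumes "inj f"
  shows "tree_weight (map (rename_end f) t0) (map (rename_end f) t1) (map (rename_end f) h1)
      ((\<lambda>(p, q, r). (f p, f q, f r)) ` V) = tree_weight t0 t1 h1 V"
proof -
  let ?g = "\<lambda>(p, q, r). (f p, f q, f r)"
  have f: "f a = f b \<longleftrightarrow> a = b" for a b using assms by (simp add: inj_eq)
  have "inj ?g" using f by (auto intro!: injI)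
  then have "?g ` V = {?g v} \<longleftrightarrow> V = {v}" for v
    using inj_image_eq_iff[of ?g V "{v}"] by simp
  then have V: "?g ` V = {(f a, f b, f c)} \<longleftrightarrow> V = {(a, b, c)}" for a b c
    by (metis (no_types, lifting) case_prod_conv)
  show ?thesis
    unfolding tree_weight_def
    by (intro arg_cong2[where f = "(+)"] arg_cong2[where f = "(-)"] arg_cong[where f = of_bool])
       (auto simp: map_eq_Cons_conv rename_end_eq f V)
qed

lemma arrow_vertex_unique:
  assumes "arrow_diagram L D" "(p, q, r) \<in> verts D" "(p', q', r) \<in> verts D"
  shows "p' = p \<and> q' = q"
proof -
  let ?A = "{(a, b, c) \<in> verts D. c = r}"
  have "r \<in> edges D" using assms(2) by (force simp: edges_def)
  then have "departures L D r = 1" using assms(1) unfolding arrow_diagram_def by blast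
  then have "card ?A \<le> 1" unfolding departures_def by simp
  moreover have "finite ?A" using assms(1) by (auto simp: arrow_diagram_def elim: rev_finite_subset)
  moreover have "(p, q, r) \<in> ?A" "(p', q', r) \<in> ?A" using assms by auto
  ultimately show ?thesis by (metis (no_types, lifting) Pair_inject card_le_Suc0_iff_eq One_nat_def)
qed

lemma edges_strand:
  "x \<in> set (strands D l) \<Longrightarrow> (case x of Head e \<Rightarrow> e | Tail e \<Rightarrow> e) \<in> edges D"
  by (cases x) (auto simp: edges_def on_skeleton_def)

lemma bracket_fresh:
  "bracket x y z v r \<Longrightarrow> r \<notin> edges D \<Longrightarrow> v \<notin> verts D"
  by (cases rule: bracket.cases) (force simp: edges_def)+

lemma weight_relators:
  assumes "g \<in> ht_relators R2 R2"
  shows "lin weight g = 0"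
proof -
  note lsimps = lin_add lin_diff locfin_finsupp
  have "lin weight g () = 0"
    using assms
  proof cases
    case aw
    then show ?thesis
    proof (cases rule: relators_STU_cases)
      case (iso D f)
      then show ?thesis
        by (simp add: lsimps weight_def rename_def tree_weight_rename pointwise)
    next
      case (AS w p q r V)
      have "(q, p, r) \<notin> V"
        using arrow_vertex_unique[OF AS(2), of p q r q p] AS(3) by auto
      then show ?thesis using AS tree_weight_AS
        by (simp add: lsimps weight_def pointwise)
    next
      case (IHX w p q m r e V)
      have "weight (Diag w (insert (a, b, m) (insert (m, c, e) V))) () = 0" for a b c
        using IHX(3) tree_weight_two[of "(a, b, m)" _ "(m, c, e)"] by (simp add: weight_def)
      then show ?thesis by (simp add: IHX(1) lsimps pointwise)
    next
      case (STU x y z v w V a us vs r)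
      have a: "a \<in> {HStr 0, HStr 1, TStr 0, TStr 1}"
        using strand_label[OF STU(3), of a] STU(4) unfolding ht_R2 by simp
      have fresh: "v \<notin> V" "r \<notin> (\<lambda>x. case x of Head e \<Rightarrow> e | Tail e \<Rightarrow> e) ` {x, y}"
        using bracket_fresh[OF STU(2,5)] STU(4,5) edges_strand[of _ "Diag w V" a] by auto
      have "weight (Diag w V) () - weight (Diag (w(a := us @ [y, x] @ vs)) V) ()
          - weight (Diag (w(a := us @ [z] @ vs)) (insert v V)) () = 0"
        using a STU(4) tree_weight_STU(1)[OF STU(2) fresh, of "w (TStr 0)" "w (TStr 1)" us vs]
          tree_weight_STU(2)[OF STU(2) fresh, of "w (TStr 0)" us vs "w (HStr 1)"]
          tree_weight_STU(3)[OF STU(2) fresh, of us vs "w (TStr 1)" "w (HStr 1)"]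
        unfolding insert_iff empty_iff by (elim disjE) (simp_all add: weight_def)
      then show ?thesis by (simp add: STU(1) lsimps pointwise)
    next
      case (TC w V a us d e vs)
      have a: "a \<in> {HStr 0, HStr 1, TStr 0, TStr 1}"
        using strand_label[OF TC(2), of a] TC(3) unfolding ht_R2 by simp
      have "weight (Diag w V) () = 0 \<and> weight (Diag (w(a := us @ [Tail e, Tail d] @ vs)) V) () = 0"
        using a TC(3) tree_weight_TC[where us = us and vs = vs]
        unfolding insert_iff empty_iff by (elim disjE) (simp_all add: weight_def)
      then show ?thesis by (simp add: TC(1) lsimps pointwise)
    qed
  next
    case (tail_on_head_strand D e a)
    then have "strands D (HStr a) \<noteq> []" by auto
    from strand_label[OF tail_on_head_strand(2) this] have "a = 0 \<or> a = 1" by simp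
    then show ?thesis using tail_on_head_strand(3)
      by (elim disjE) (auto simp: tail_on_head_strand(1) weight_def tree_weight_killed)
  next
    case (CP D a e us)
    then have "a = 0 \<or> a = 1" using strand_label[OF CP(2), of "TStr a"] by simp
    then show ?thesis using CP(3)
      by (elim disjE) (simp_all add: CP(1) weight_def tree_weight_killed)
  qed
  then show ?thesis by (intro ext) (simp add: pointwise)
qed

text \<open>Functionals counting diagrams to which no relation other than renaming applies.\<close>

lemma rigid_relators:
  fixes P :: "nat label diag \<Rightarrow> bool"
  assumes g: "g \<in> ht_relators R2 R2"
    and P: "\<And>D. P D \<Longrightarrow> verts D = {} \<and> (\<forall>l\<in>ht R2 R2. length (strands D l) \<le> 1)
      \<and> (\<forall>a\<in>R2. \<forall>e. Tail e \<notin> set (strands D (HStr a)) \<and> Head e \<notin> set (strands D (TStr a)))"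
    and rename: "\<And>D f. inj f \<Longrightarrow> P (rename f D) \<longleftrightarrow> P D"
  shows "lin (\<lambda>D (_::unit). of_bool (P D)) g = 0"
proof -
  note lsimps = lin_add lin_diff locfin_finsupp
  have long: "\<not> P (Diag w V)" if "l \<in> ht R2 R2" "w l = us @ [x, y] @ vs" for w V l us x y vs
    using P[of "Diag w V"] that by fastforce
  have vert: "\<not> P (Diag w (insert v V))" for w v V
    using P[of "Diag w (insert v V)"] by auto
  have "lin (\<lambda>D (_::unit). of_bool (P D)) g () = (0::rat)"
    using g
  proof cases
    case aw
    then show ?thesis
    proof (cases rule: relators_STU_cases)
      case (iso D f)
      then show ?thesis by (simp add: lsimps rename pointwise)
    next
      case (AS w p q r V)
      then show ?thesis by (simp add: lsimps vert pointwise)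
    next
      case (IHX w p q m r e V)
      then show ?thesis by (simp add: lsimps vert pointwise)
    next
      case (STU x y z v w V a us vs r)
      have a: "a \<in> ht R2 R2" using strand_label[OF STU(3), of a] STU(4) by simp
      show ?thesis using long[OF a, of w us x y vs V] long[OF a, of "w(a := us @ [y, x] @ vs)" us y x vs V] STU(4)
        by (simp add: STU(1) lsimps vert pointwise)
    next
      case (TC w V a us d e vs)
      have a: "a \<in> ht R2 R2" using strand_label[OF TC(2), of a] TC(3) by simp
      show ?thesis using long[OF a, of w us "Tail d" "Tail e" vs V]
          long[OF a, of "w(a := us @ [Tail e, Tail d] @ vs)" us "Tail e" "Tail d" vs V] TC(3)
        by (simp add: TC(1) lsimps pointwise)
    qed
  next
    case (tail_on_head_strand D e a)
    then have "strands D (HStr a) \<noteq> []" by auto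
    from strand_label[OF tail_on_head_strand(2) this] have "a \<in> R2" by simp
    then show ?thesis using tail_on_head_strand P[of D] by auto
  next
    case (CP D a e us)
    then have "a \<in> R2" using strand_label[OF CP(2), of "TStr a"] by simp
    then have "\<not> P D" using CP P[of D] by force
    then show ?thesis using CP by simp
  qed
  then show ?thesis by (intro ext) (simp add: pointwise)
qed

lemma functional_ht_rel:
  fixes F :: "nat label diag \<Rightarrow> unit \<Rightarrow> rat"
  assumes kill: "\<And>g. g \<in> ht_relators R2 R2 \<Longrightarrow> lin F g = 0"
    and degree: "\<And>D. arrow_diagram (ht R2 R2) D \<Longrightarrow> F D () \<noteq> 0 \<Longrightarrow> degree D = d"
    and xy: "(x, y) \<in> ht_rel R2 R2"
  shows "lin F x = lin F y"
proof -
  have lf: "locfin F z" and deg: "lin F z = lin F (degree_part d z)" if z: "z \<in> chains (ht R2 R2)" for z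
  proof -
    have "{D. z D \<noteq> 0 \<and> F D E \<noteq> 0} \<subseteq> {D. z D \<noteq> 0 \<and> degree D = d}" for E
      using z degree by (auto simp: chains_def)
    moreover have "finite {D. z D \<noteq> 0 \<and> degree D = d}" using z by (simp add: chains_def)
    ultimately show "locfin F z" unfolding locfin_def by (meson finite_subset)
    show "lin F z = lin F (degree_part d z)"
    proof
      fix E :: unit
      have "{D. degree_part d z D \<noteq> 0 \<and> F D E \<noteq> 0} = {D. z D \<noteq> 0 \<and> F D E \<noteq> 0}"
        using z degree by (auto simp: chains_def degree_part_def)
      moreover have "degree_part d z D = z D" if "z D \<noteq> 0" "F D E \<noteq> 0" for D
        using that z degree[of D] by (auto simp: chains_def degree_part_def)
      ultimately show "lin F z E = lin F (degree_part d z) E"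
        unfolding lin_def by (intro sum.cong) auto
    qed
  qed
  have c: "x \<in> chains (ht R2 R2)" "y \<in> chains (ht R2 R2)"
    and s: "degree_part d (x - y) \<in> comb.span (ht_relators R2 R2)"
    using xy by (auto simp: ht_rel_def mod_relators_def)
  have "lin F (degree_part d (x - y)) = 0"
  proof (rule lin_span[OF s, of "\<lambda>a. a = 0" F, THEN conjunct2])
    fix g assume "g \<in> ht_relators R2 R2"
    then show "finsupp g \<and> lin F g = 0"
      using kill[of g] finsupp_gen_relators[of g] by (simp add: ht_relators_eq)
  qed (simp_all add: zero_fun_def plus_fun_def)
  then have "lin F (x - y) = 0" using deg[OF chains_diff[OF c]] by simp
  then show ?thesis using lin_diff[OF lf[OF c(1)] lf[OF c(2)]] by simp
qed


lemma inj_rename_end: "inj f \<Longrightarrow> inj (rename_end f)"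
proof (rule injI)
  fix x y assume "inj f" "rename_end f x = rename_end f y"
  then show "x = y" by (cases x; cases y) (simp_all add: inj_eq)
qed

lemma stack_inj:
  assumes "stack D1 D2 = stack E1 E2"
  shows "D1 = E1 \<and> D2 = E2"
proof -
  let ?f = "\<lambda>e::nat. 2 * e" and ?g = "\<lambda>e::nat. 2 * e + 1"
  define ev where "ev x = (case x of Head e \<Rightarrow> even e | Tail e \<Rightarrow> even e)" for x
  have ev: "ev (rename_end ?f x)" "\<not> ev (rename_end ?g x)" for x
    by (cases x; simp add: ev_def)+
  have filt: "filter ev (map (rename_end ?f) xs) = map (rename_end ?f) xs"
    "filter ev (map (rename_end ?g) xs) = []"
    "filter (\<lambda>x. \<not> ev x) (map (rename_end ?f) xs) = []"
    "filter (\<lambda>x. \<not> ev x) (map (rename_end ?g) xs) = map (rename_end ?g) xs" for xs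
    by (induction xs) (simp_all only: list.map filter.simps ev if_True if_False not_True_eq_False not_False_eq_True)
  have inj: "inj (rename_end ?f)" "inj (rename_end ?g)"
    by (rule inj_rename_end, rule injI, simp)+
  have s: "map (rename_end ?f) (strands D1 l) @ map (rename_end ?g) (strands D2 l)
      = map (rename_end ?f) (strands E1 l) @ map (rename_end ?g) (strands E2 l)" for l
    using assms by (simp add: stack_def rename_def Let_def fun_eq_iff)
  have "strands D1 l = strands E1 l" for l
    using arg_cong[OF s[of l], of "filter ev"] inj(1) unfolding filter_append filt by (simp add: inj_map_eq_map)
  moreover have "strands D2 l = strands E2 l" for l
    using arg_cong[OF s[of l], of "filter (\<lambda>x. \<not> ev x)"] inj(2) unfolding filter_append filt by (simp add: inj_map_eq_map)
  moreover
  let ?f3 = "\<lambda>(p, q, r). (?f p, ?f q, ?f r)" and ?g3 = "\<lambda>(p, q, r). (?g p, ?g q, ?g r)"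
  have v: "?f3 ` verts D1 \<union> ?g3 ` verts D2 = ?f3 ` verts E1 \<union> ?g3 ` verts E2"
    using assms by (simp add: stack_def rename_def Let_def)
  have inj3: "inj ?f3" "inj ?g3" by (rule injI, simp add: case_prod_unfold prod_eq_iff)+
  have disj: "?f3 u \<noteq> ?g3 u'" for u u' :: "nat \<times> nat \<times> nat"
  proof
    assume "?f3 u = ?g3 u'"
    from arg_cong[OF this, of "\<lambda>v. even (fst v)"] show False by (simp add: case_prod_unfold)
  qed
  have "?f3 u \<notin> ?g3 ` B" "?g3 u \<notin> ?f3 ` B" for u B
    by (rule notI, erule imageE, erule notE[OF disj] notE[OF disj[symmetric]])+
  then have f3: "?f3 u \<in> ?f3 ` A \<union> ?g3 ` B \<longleftrightarrow> u \<in> A" and g3: "?g3 u \<in> ?f3 ` A \<union> ?g3 ` B \<longleftrightarrow> u \<in> B" for u A B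
    using inj_image_mem_iff[OF inj3(1)] inj_image_mem_iff[OF inj3(2)]
    by (simp_all only: Un_iff simp_thms)
  have "verts D1 = verts E1"
    by (rule set_eqI) (subst (1 2) f3[symmetric], subst v, rule refl)
  moreover have "verts D2 = verts E2"
    by (rule set_eqI) (subst (1 2) g3[symmetric], subst v, rule refl)
  ultimately show ?thesis by (auto intro!: diag.expand)
qed

lemma stack_eq_iff: "stack D1 D2 = stack E1 E2 \<longleftrightarrow> D1 = E1 \<and> D2 = E2"
  using stack_inj[of D1 D2 E1 E2] by (elim iffI) simp

lemma stack_comb_stack: "stack_comb x y (stack D1 D2) = x D1 * y D2"
proof -
  have "{(E1, E2). x E1 \<noteq> 0 \<and> y E2 \<noteq> 0 \<and> stack E1 E2 = stack D1 D2} =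
      (if x D1 \<noteq> 0 \<and> y D2 \<noteq> 0 then {(D1, D2)} else {})"
    by (auto simp: stack_eq_iff)
  then show ?thesis unfolding stack_comb_def by (simp split: if_splits)
qed

lemma stack_comb_support:
  assumes "stack_comb x y E \<noteq> 0"
  obtains D1 D2 where "E = stack D1 D2" "x D1 \<noteq> 0" "y D2 \<noteq> 0"
proof -
  have "{(E1, E2). x E1 \<noteq> 0 \<and> y E2 \<noteq> 0 \<and> stack E1 E2 = E} \<noteq> {}"
    using assms unfolding stack_comb_def by (metis (no_types, lifting) sum.empty)
  then obtain v where "v \<in> {(E1, E2). x E1 \<noteq> 0 \<and> y E2 \<noteq> 0 \<and> stack E1 E2 = E}"
    unfolding ex_in_conv[symmetric] by (elim exE)
  then show thesis using that[of "fst v" "snd v"] by (simp add: case_prod_unfold)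
qed

lemma stack_comb_basis: "stack_comb (basis D1) (basis D2) = basis (stack D1 D2)"
proof
  fix E
  show "stack_comb (basis D1) (basis D2) E = basis (stack D1 D2) E"
  proof (cases "E = stack D1 D2")
    case True
    then show ?thesis by (simp add: stack_comb_stack) (simp add: basis_def)
  next
    case False
    have "stack_comb (basis D1) (basis D2) E = 0"
    proof (rule ccontr)
      assume "stack_comb (basis D1) (basis D2) E \<noteq> 0"
      then obtain E1 E2 where "E = stack E1 E2" "basis D1 E1 \<noteq> 0" "basis D2 E2 \<noteq> 0"
        by (rule stack_comb_support)
      then show False using False by (simp add: basis_def split: if_splits)
    qed
    then show ?thesis using False by (simp add: basis_def)
  qed
qed

definition arrow :: "'l \<Rightarrow> 'l \<Rightarrow> nat \<Rightarrow> 'l diag" where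
  "arrow s t e = Diag ((\<lambda>_. [])(s := [Tail e], t := [Head e])) {}"

lemma arrow_eq_iff: "s \<noteq> t \<Longrightarrow> arrow s t a = arrow s t b \<longleftrightarrow> a = b"
  by (auto simp: arrow_def dest: fun_cong[of _ _ s])

lemma sum_R2: "(\<Sum>l\<in>Str ` R2. h l) = h (Str 0) + (h (Str 1) :: nat)"
  by simp

lemma arrow_arrow_diagram:
  assumes "s \<noteq> t" "{s, t} = Str ` R2"
  shows "arrow_diagram (Str ` R2) (arrow s t e)"
proof -
  have "on_skeleton (arrow s t e) = {e}"
    using assms(1) by (auto simp: on_skeleton_def arrow_def split: if_splits)
  then show ?thesis
    using assms(1) unfolding arrow_diagram_def edges_def departures_def arrivals_def assms(2)[symmetric]
    by (auto simp: arrow_def card_eq_0_iff)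
qed

abbreviation A01 :: "nat label diag" where "A01 \<equiv> arrow (Str 0) (Str 1) 0"
abbreviation A10 :: "nat label diag" where "A10 \<equiv> arrow (Str 1) (Str 0) 0"

lemma stack_A01_A10:
  "stack A01 A10 = Diag ((\<lambda>_. [])(Str 0 := [Tail 0, Head 1], Str 1 := [Head 0, Tail 1])) {}"
  by (auto simp: stack_def arrow_def rename_def fun_eq_iff)

lemma arrow_diagram_stack: "arrow_diagram (Str ` R2) (stack A01 A10)" (is "arrow_diagram _ ?D")
proof -
  have "on_skeleton ?D = {0, 1}"
    unfolding stack_A01_A10
    by (subst on_skeleton_ends[of "Str ` R2"]) (auto simp: ends_def vanishing_def)
  moreover have v: "verts ?D = {}" unfolding stack_A01_A10 by (simp add: case_prod_unfold)
  ultimately have skel: "on_skeleton ?D = {0, 1}" "edges ?D = {0, 1}" by (simp_all add: edges_def)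
  show ?thesis
    unfolding arrow_diagram_def
  proof (intro conjI)
    show "\<forall>l. l \<notin> Str ` R2 \<longrightarrow> strands ?D l = []" unfolding stack_A01_A10 by (simp add: case_prod_unfold)
    show "\<forall>e\<in>edges ?D. departures (Str ` R2) ?D e = 1 \<and> arrivals (Str ` R2) ?D e = 1"
      unfolding skel departures_def arrivals_def sum_R2 unfolding stack_A01_A10 by (simp add: case_prod_unfold)
    show "\<forall>e\<in>edges ?D. \<exists>e'\<in>on_skeleton ?D. (e, e') \<in> (adjacent_edges ?D)\<^sup>*"
      unfolding skel by (rule ballI) (rule bexI, rule rtrancl_refl, assumption)
  qed (simp only: v finite.emptyI)
qed

lemma lin_doubled_R2:
  fixes F :: "nat label diag \<Rightarrow> unit \<Rightarrow> rat"
  shows "lin F (doubled R2 (Diag w V)) () = (\<Sum>p\<in>#lifts (w (Str 1)). \<Sum>q\<in>#lifts (w (Str 0)).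
    F (Diag (w(Str 1 := [], HStr 1 := fst p, TStr 1 := snd p, Str 0 := [], HStr 0 := fst q, TStr 0 := snd q)) V) ())"
proof -
  have fin: "finsupp (dbl_label a E)" for a and E :: "nat label diag"
    by (cases E) (simp add: strand_op_dbl)
  have app: "(\<Sum>p\<in>#M. h p) () = (\<Sum>p\<in>#M. h p ())" for M and h :: "'z \<Rightarrow> unit \<Rightarrow> rat"
    by (induction M) (auto simp: pointwise)
  have "doubled R2 (Diag w V) = lin (dbl_label 0) (dbl_label 1 (Diag w V))"
    by (simp add: doubled_insert)
  then show ?thesis
    by (simp add: strand_op_dbl lin_sum_mset app)
qed

lemma degree_R2:
  assumes "arrow_diagram (ht R2 R2) D"
  shows "degree D = (length (strands D (HStr 0)) + length (strands D (HStr 1))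
    + length (strands D (TStr 0)) + length (strands D (TStr 1)) + card (verts D)) div 2"
proof -
  have "size (ends (ht R2 R2) (strands D)) = length (strands D (HStr 0)) + length (strands D (HStr 1))
    + length (strands D (TStr 0)) + length (strands D (TStr 1))"
    unfolding ht_R2 by (simp add: ends_def)
  then show ?thesis
    using degree_ends[of "ht R2 R2" "strands D" "verts D"] vanishing_simps(2)[OF assms] by simp
qed

lemma eq_diag_R2:
  assumes "arrow_diagram (ht R2 R2) D" "arrow_diagram (ht R2 R2) E \<or> (\<forall>l. l \<notin> ht R2 R2 \<longrightarrow> strands E l = [])"
    "verts D = verts E" "\<And>l. l \<in> ht R2 R2 \<Longrightarrow> strands D l = strands E l"
  shows "D = E"
proof (rule diag.expand)
  have "strands D l = strands E l" for l
    using assms by (cases "l \<in> ht R2 R2") (auto simp: arrow_diagram_def)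
  then show "strands D = strands E \<and> verts D = verts E" using assms(3) by auto
qed


lemma split_arrows:
  assumes "map (rename_end (\<lambda>e. 2 * e)) x0 @ map (rename_end (\<lambda>e. 2 * e + 1)) y0 = [Tail a]"
    and "map (rename_end (\<lambda>e. 2 * e)) x1 @ map (rename_end (\<lambda>e. 2 * e + 1)) y1 = [Tail b]"
    and "map (rename_end (\<lambda>e. 2 * e)) xh @ map (rename_end (\<lambda>e. 2 * e + 1)) yh = [Head a, Head b]"
  shows "(\<exists>a' b'. x0 = [Tail a'] \<and> y0 = [] \<and> x1 = [] \<and> y1 = [Tail b'] \<and> xh = [Head a'] \<and> yh = [Head b'])
    \<or> (y0 = [] \<and> y1 = [] \<and> yh = []) \<or> (x0 = [] \<and> x1 = [] \<and> xh = [])"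
  using assms by (auto simp: append_eq_Cons_conv map_eq_Cons_conv rename_end_eq
      Suc_double_not_eq_double double_not_eq_Suc_double)

lemma split_tree:
  assumes "map (rename_end (\<lambda>e. 2 * e)) x0 @ map (rename_end (\<lambda>e. 2 * e + 1)) y0 = [Tail a]"
    and "map (rename_end (\<lambda>e. 2 * e)) x1 @ map (rename_end (\<lambda>e. 2 * e + 1)) y1 = [Tail b]"
    and "map (rename_end (\<lambda>e. 2 * e)) xh @ map (rename_end (\<lambda>e. 2 * e + 1)) yh = [Head r]"
    and "(\<lambda>(p, q, r). (2 * p, 2 * q, 2 * r)) ` V \<union> (\<lambda>(p, q, r). (2 * p + 1, 2 * q + 1, 2 * r + 1)) ` W = {(c, d, r)}"
    and "{c, d} = {a, b}"
  shows "(y0 = [] \<and> y1 = [] \<and> yh = [] \<and> W = {}) \<or> (x0 = [] \<and> x1 = [] \<and> xh = [] \<and> V = {})"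
proof -
  have e: "even c \<and> even d \<and> even r" if nonempty: "V \<noteq> {}"
  proof -
    obtain p q s where "(p, q, s) \<in> V" using nonempty by (metis prod_cases3 ex_in_conv)
    then have "(2 * p, 2 * q, 2 * s) \<in> {(c, d, r)}" unfolding assms(4)[symmetric] by force
    then show ?thesis by auto
  qed
  have o: "odd c \<and> odd d \<and> odd r" if nonempty: "W \<noteq> {}"
  proof -
    obtain p q s where "(p, q, s) \<in> W" using nonempty by (metis prod_cases3 ex_in_conv)
    then have "(2 * p + 1, 2 * q + 1, 2 * s + 1) \<in> {(c, d, r)}" unfolding assms(4)[symmetric] by force
    then show ?thesis by auto
  qed
  have "V \<noteq> {} \<or> W \<noteq> {}" using assms(4) by auto
  then consider "V = {}" "odd a" "odd b" "odd r" | "W = {}" "even a" "even b" "even r"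
    using e o assms(5) by (auto simp: doubleton_eq_iff)
  then show ?thesis
    using assms(1-3) by cases (auto simp: append_eq_Cons_conv map_eq_Cons_conv rename_end_eq
      Suc_double_not_eq_double double_not_eq_Suc_double)
qed

definition no_ends :: "nat label diag \<Rightarrow> bool" where
  "no_ends D \<longleftrightarrow> verts D = {} \<and> (\<forall>l\<in>ht R2 R2. strands D l = [])"

definition is_arrow_11 :: "nat label diag \<Rightarrow> bool" where
  "is_arrow_11 D \<longleftrightarrow> verts D = {} \<and> strands D (HStr 0) = [] \<and> strands D (TStr 0) = []
     \<and> (\<exists>e. strands D (TStr 1) = [Tail e] \<and> strands D (HStr 1) = [Head e])"

lemma tree_weight_cases:
  assumes "tree_weight t0 t1 h1 V \<noteq> 0"
  obtains a b where "V = {}" "t0 = [Tail a]" "t1 = [Tail b]" "h1 = [Head a, Head b]"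
  | a b where "V = {}" "t0 = [Tail a, Head b]" "t1 = [Tail b]" "h1 = [Head a]"
  | a b where "V = {}" "t0 = [Tail a]" "t1 = [Tail b, Head a]" "h1 = [Head b]"
  | a b r where "V = {(a, b, r)}" "t0 = [Tail a]" "t1 = [Tail b]" "h1 = [Head r]"
  | a b r where "V = {(b, a, r)}" "t0 = [Tail a]" "t1 = [Tail b]" "h1 = [Head r]"
proof -
  have *: "P \<or> Q \<or> R \<or> S \<or> T"
    if "(of_bool P - of_bool Q + of_bool R + of_bool S - of_bool T :: rat) \<noteq> 0" for P Q R S T
    using that by (auto simp: of_bool_def split: if_splits)
  from *[OF assms[unfolded tree_weight_def]] show thesis using that by (elim disjE exE conjE) blast+
qed

lemma no_ends_ht_rel:
  assumes "(x, y) \<in> ht_rel R2 R2"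
  shows "lin (\<lambda>D (_::unit). of_bool (no_ends D)) x = (lin (\<lambda>D (_::unit). of_bool (no_ends D)) y :: unit \<Rightarrow> rat)"
proof (rule functional_ht_rel[OF rigid_relators _ assms])
  show "arrow_diagram (ht R2 R2) D \<Longrightarrow> of_bool (no_ends D) \<noteq> (0::rat) \<Longrightarrow> degree D = 0" for D
    by (auto simp: degree_R2 no_ends_def ht_R2)
qed (auto simp: no_ends_def ht_R2 rename_def)

lemma is_arrow_11_ht_rel:
  assumes "(x, y) \<in> ht_rel R2 R2"
  shows "lin (\<lambda>D (_::unit). of_bool (is_arrow_11 D)) x = (lin (\<lambda>D (_::unit). of_bool (is_arrow_11 D)) y :: unit \<Rightarrow> rat)"
proof (rule functional_ht_rel[OF rigid_relators _ assms])
  show "arrow_diagram (ht R2 R2) D \<Longrightarrow> of_bool (is_arrow_11 D) \<noteq> (0::rat) \<Longrightarrow> degree D = 1" for D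
    by (auto simp: degree_R2 is_arrow_11_def)
  show "is_arrow_11 (rename f D) \<longleftrightarrow> is_arrow_11 D" if "inj f" for D f
    using injD[OF that] by (fastforce simp: is_arrow_11_def rename_def map_eq_Cons_conv rename_end_eq)
qed (auto simp: is_arrow_11_def ht_def)

lemma weight_ht_rel:
  assumes "(x, y) \<in> ht_rel R2 R2"
  shows "lin weight x = lin weight y"
proof (rule functional_ht_rel[OF weight_relators _ assms])
  show "arrow_diagram (ht R2 R2) D \<Longrightarrow> weight D () \<noteq> 0 \<Longrightarrow> degree D = 2" for D
  proof -
    assume D: "arrow_diagram (ht R2 R2) D" "weight D () \<noteq> 0"
    then have h0: "strands D (HStr 0) = []"
      and tw: "tree_weight (strands D (TStr 0)) (strands D (TStr 1)) (strands D (HStr 1)) (verts D) \<noteq> 0"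
      by (auto simp: weight_def split: if_splits)
    from tw show "degree D = 2"
      unfolding degree_R2[OF D(1)] h0 by (cases rule: tree_weight_cases) simp_all
  qed
qed

lemma weight_doubled_stack: "lin weight (doubled R2 (stack A01 A10)) () = - 1"
  unfolding stack_A01_A10 lin_doubled_R2
  by (simp add: weight_def tree_weight_def)

lemma doubled_arrow_counts:
  "lin (\<lambda>D (_::unit). of_bool (no_ends D)) (doubled R2 A01) () = (0::rat)"
  "lin (\<lambda>D (_::unit). of_bool (no_ends D)) (doubled R2 A10) () = (0::rat)"
  "lin (\<lambda>D (_::unit). of_bool (is_arrow_11 D)) (doubled R2 A10) () = (0::rat)"
  unfolding arrow_def lin_doubled_R2 by (simp_all add: no_ends_def is_arrow_11_def ht_def)

lemma stack_strands:
  "strands (stack D1 D2) l = map (rename_end (\<lambda>e. 2 * e)) (strands D1 l) @ map (rename_end (\<lambda>e. 2 * e + 1)) (strands D2 l)"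
  "verts (stack D1 D2) = (\<lambda>(p, q, r). (2 * p, 2 * q, 2 * r)) ` verts D1
     \<union> (\<lambda>(p, q, r). (2 * p + 1, 2 * q + 1, 2 * r + 1)) ` verts D2"
  by (simp_all add: stack_def rename_def Let_def)

abbreviation B0 :: "nat \<Rightarrow> nat label diag" where "B0 \<equiv> arrow (TStr 0) (HStr 1)"
abbreviation B1 :: "nat \<Rightarrow> nat label diag" where "B1 \<equiv> arrow (TStr 1) (HStr 1)"

lemma weight_stack:
  assumes "arrow_diagram (ht R2 R2) D1" "sorted_diag D1" "\<not> no_ends D1"
    and "arrow_diagram (ht R2 R2) D2" "sorted_diag D2" "\<not> no_ends D2"
    and "weight (stack D1 D2) () \<noteq> 0"
  shows "\<exists>a b. D1 = B0 a \<and> D2 = B1 b"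
proof -
  let ?E = "stack D1 D2"
  have h0: "strands ?E (HStr 0) = []" and
    tw: "tree_weight (strands ?E (TStr 0)) (strands ?E (TStr 1)) (strands ?E (HStr 1)) (verts ?E) \<noteq> 0"
    using assms(7) by (auto simp: weight_def split: if_splits)
  have h0': "strands D1 (HStr 0) = []" "strands D2 (HStr 0) = []" using h0 by (simp_all add: stack_strands)
  have sorted: "Head e \<notin> set (strands ?E (TStr a))" for e a
    using assms(2,5) by (auto simp: stack_strands sorted_diag_def rename_end_eq image_iff)
  from tw show ?thesis
  proof (cases rule: tree_weight_cases)
    case (1 a b)
    then have V: "verts D1 = {}" "verts D2 = {}" by (simp_all add: stack_strands)
    from split_arrows[OF 1(2-4)[unfolded stack_strands]] show ?thesis
    proof (elim disjE exE)
      fix a' b'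
      assume *: "strands D1 (TStr 0) = [Tail a'] \<and> strands D2 (TStr 0) = [] \<and> strands D1 (TStr 1) = [] \<and>
        strands D2 (TStr 1) = [Tail b'] \<and> strands D1 (HStr 1) = [Head a'] \<and> strands D2 (HStr 1) = [Head b']"
      have "D1 = B0 a'" by (rule eq_diag_R2[OF assms(1)]) (use * V h0' in \<open>auto simp: ht_def arrow_def\<close>)
      moreover have "D2 = B1 b'" by (rule eq_diag_R2[OF assms(4)]) (use * V h0' in \<open>auto simp: ht_def arrow_def\<close>)
      ultimately show ?thesis by blast
    qed (use assms(3,6) V h0' in \<open>auto simp: no_ends_def ht_def\<close>)
  next
    case (2 a b)
    then show ?thesis using sorted[of b 0] by simp
  next
    case (3 a b)
    then show ?thesis using sorted[of a 1] by simp
  next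
    case (4 a b r)
    from split_tree[OF 4(2-4)[unfolded stack_strands] 4(1)[unfolded stack_strands] refl] show ?thesis
      using assms(3,6) h0' by (auto simp: no_ends_def ht_def)
  next
    case (5 a b r)
    from split_tree[OF 5(2-4)[unfolded stack_strands] 5(1)[unfolded stack_strands] insert_commute] show ?thesis
      using assms(3,6) h0' by (auto simp: no_ends_def ht_def)
  qed
qed

lemma weight_stack_comb:
  assumes x: "x \<in> sorted_chains R2 R2" "lin (\<lambda>D (_::unit). of_bool (no_ends D)) x () = (0::rat)"
    and y: "y \<in> sorted_chains R2 R2" "lin (\<lambda>D (_::unit). of_bool (no_ends D)) y () = (0::rat)"
      "lin (\<lambda>D (_::unit). of_bool (is_arrow_11 D)) y () = (0::rat)"
  shows "lin weight (stack_comb x y) () = 0"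
proof -
  have nonempty: "\<not> no_ends D" if z: "z \<in> sorted_chains R2 R2" "z D \<noteq> 0"
    "lin (\<lambda>D (_::unit). of_bool (no_ends D)) z () = (0::rat)" for z D
  proof
    assume D: "no_ends D"
    have "arrow_diagram (ht R2 R2) E" if "z E \<noteq> 0" for E
      using that z by (auto simp: sorted_chains_def chains_def)
    then have "D' = D" if "z D' \<noteq> 0" "no_ends D'" for D'
      using that D z(2) by (intro eq_diag_R2) (auto simp: no_ends_def)
    then have "lin (\<lambda>D (_::unit). of_bool (no_ends D)) z () = (\<Sum>D'\<in>{D}. z D' * of_bool (no_ends D'))"
      by (intro lin_eval) auto
    then show False using z D by simp
  qed
  have x_arrow: "arrow_diagram (ht R2 R2) D" "sorted_diag D" "\<not> no_ends D" if "x D \<noteq> 0" for D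
    using that x nonempty[OF x(1) that] by (auto simp: sorted_chains_def chains_def)
  have y_arrow: "arrow_diagram (ht R2 R2) D" "sorted_diag D" "\<not> no_ends D" if "y D \<noteq> 0" for D
    using that y nonempty[OF y(1) that] by (auto simp: sorted_chains_def chains_def)
  define I where "I = {a. x (B0 a) \<noteq> 0}"
  define J where "J = {b. y (B1 b) \<noteq> 0}"
  have deg: "degree (arrow s t e) = 1" if "s \<noteq> t" for s t :: "nat label" and e
  proof -
    have "{l. strands (arrow s t e) l \<noteq> []} = {s, t}" by (auto simp: arrow_def)
    then show ?thesis using that by (simp add: degree_def) (simp add: arrow_def)
  qed
  have fin: "finite {a. z (arrow s t a) \<noteq> 0}" if "z \<in> chains (ht R2 R2)" "s \<noteq> t" for z and s t :: "nat label"
  proof (rule finite_imageD)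
    have "arrow s t ` {a. z (arrow s t a) \<noteq> 0} \<subseteq> {D. z D \<noteq> 0 \<and> degree D = 1}" using deg that by auto
    then show "finite (arrow s t ` {a. z (arrow s t a) \<noteq> 0})"
      by (rule finite_subset) (use that in \<open>simp add: chains_def\<close>)
  qed (auto intro: inj_onI simp: arrow_eq_iff[OF that(2)])
  have IJ: "finite I" "finite J"
    using x(1) y(1) unfolding I_def J_def by (auto intro!: fin simp: sorted_chains_def)
  have w1: "weight (stack (B0 a) (B1 b)) () = 1" for a b
  proof -
    have "(2::nat) * a \<noteq> 2 * b + 1" by presburger
    then show ?thesis by (simp add: weight_def tree_weight_def stack_strands arrow_def)
  qed
  have "lin weight (stack_comb x y) () = (\<Sum>E\<in>(\<lambda>(a, b). stack (B0 a) (B1 b)) ` (I \<times> J). stack_comb x y E * weight E ())"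
  proof (rule lin_eval)
    show "{E. stack_comb x y E \<noteq> 0 \<and> weight E () \<noteq> 0} \<subseteq> (\<lambda>(a, b). stack (B0 a) (B1 b)) ` (I \<times> J)"
    proof
      fix E assume "E \<in> {E. stack_comb x y E \<noteq> 0 \<and> weight E () \<noteq> 0}"
      then obtain D1 D2 where D: "E = stack D1 D2" "x D1 \<noteq> 0" "y D2 \<noteq> 0" "weight E () \<noteq> 0"
        using stack_comb_support by (metis (mono_tags, lifting) mem_Collect_eq)
      then obtain a b where "D1 = B0 a" "D2 = B1 b"
        using weight_stack[OF x_arrow[OF D(2)] y_arrow[OF D(3)]] by auto
      then show "E \<in> (\<lambda>(a, b). stack (B0 a) (B1 b)) ` (I \<times> J)"
        using D by (auto simp: I_def J_def)
    qed
  qed (use IJ in auto)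
  also have "\<dots> = (\<Sum>(a, b)\<in>I \<times> J. x (B0 a) * y (B1 b))"
    by (subst sum.reindex) (auto intro!: inj_onI sum.cong simp: stack_comb_stack w1[simplified] arrow_eq_iff stack_eq_iff)
  also have "\<dots> = (\<Sum>a\<in>I. x (B0 a)) * (\<Sum>b\<in>J. y (B1 b))"
    by (simp add: sum_product sum.cartesian_product)
  also have "(\<Sum>b\<in>J. y (B1 b)) = 0"
  proof -
    have "lin (\<lambda>D (_::unit). of_bool (is_arrow_11 D)) y () = (\<Sum>D\<in>B1 ` J. y D * of_bool (is_arrow_11 D))"
    proof (rule lin_eval)
      show "{D. y D \<noteq> 0 \<and> of_bool (is_arrow_11 D) \<noteq> (0::rat)} \<subseteq> B1 ` J"
      proof
        fix D assume "D \<in> {D. y D \<noteq> 0 \<and> of_bool (is_arrow_11 D) \<noteq> (0::rat)}"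
        then have D: "y D \<noteq> 0" "is_arrow_11 D" by auto
        then obtain e where "strands D (TStr 1) = [Tail e]" "strands D (HStr 1) = [Head e]"
          by (auto simp: is_arrow_11_def)
        then have "D = B1 e"
          using D(2) by (intro eq_diag_R2[OF y_arrow(1)[OF D(1)]]) (auto simp: ht_def arrow_def is_arrow_11_def)
        then show "D \<in> B1 ` J" using D by (auto simp: J_def)
      qed
    qed (use IJ in auto)
    also have "\<dots> = (\<Sum>b\<in>J. y (B1 b))"
      by (subst sum.reindex) (auto intro!: inj_onI sum.cong simp: arrow_eq_iff, auto simp: is_arrow_11_def arrow_def)
    finally show ?thesis using y(3) by simp
  qed
  finally show ?thesis by simp
qed

lemma delta_not_multiplicative:
  defines "X \<equiv> aw_rel (Str ` R2) `` {basis A01}" and "Y \<equiv> aw_rel (Str ` R2) `` {basis A10}"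
  shows "X \<in> Aw (Str ` R2)" "Y \<in> Aw (Str ` R2)"
    and "delta R2 (aw_mult (Str ` R2) X Y) \<noteq> ht_mult R2 R2 (delta R2 X) (delta R2 Y)"
proof -
  have fin: "finite R2" by simp
  note refl = equiv_class_self[OF equivs(1)[OF fin]]
  have c: "basis A01 \<in> chains (Str ` R2)" "basis A10 \<in> chains (Str ` R2)"
    "basis (stack A01 A10) \<in> chains (Str ` R2)"
    by (rule chains_basis, rule arrow_arrow_diagram, simp, blast)+ (rule chains_basis, rule arrow_diagram_stack)
  show "X \<in> Aw (Str ` R2)" "Y \<in> Aw (Str ` R2)"
    unfolding X_def Y_def Aw_def using c by (auto intro: quotientI)
  let ?z = "doubled R2 (stack A01 A10)"
  have zc: "?z \<in> chains (ht R2 R2)"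
    using lin_chains[OF doubled_homogeneous[OF fin] c(3)] by simp
  have "basis (stack A01 A10) \<in> aw_mult (Str ` R2) X Y"
    unfolding aw_mult_def X_def Y_def
    using refl[OF c(1)] refl[OF c(2)] refl[OF c(3)] stack_comb_basis[of A01 A10] by (metis (no_types, lifting) UN_iff)
  then have "?z \<in> double R2 (aw_mult (Str ` R2) X Y)"
    unfolding double_def lin_ext_double
    by (rule UN_I) (use equiv_class_self[OF equivs(2)[OF fin] zc] in \<open>simp only: lin_basis\<close>)
  then have z: "?z \<in> delta R2 (aw_mult (Str ` R2) X Y)"
    unfolding delta_def comp_def ht_proj_def
    using equiv_class_self[OF equivs(3)[OF fin] zc] by (intro UN_I)
  have "?z \<notin> ht_mult R2 R2 (delta R2 X) (delta R2 Y)"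
  proof
    assume "?z \<in> ht_mult R2 R2 (delta R2 X) (delta R2 Y)"
    then obtain x y where x: "x \<in> delta R2 X" "x \<in> sorted_chains R2 R2"
      and y: "y \<in> delta R2 Y" "y \<in> sorted_chains R2 R2" and xy: "(stack_comb x y, ?z) \<in> ht_rel R2 R2"
      unfolding ht_mult_def by blast
    have x': "(doubled R2 A01, x) \<in> ht_rel R2 R2" and y': "(doubled R2 A10, y) \<in> ht_rel R2 R2"
      using x(1) y(1) delta_class[OF fin c(1)] delta_class[OF fin c(2)] unfolding X_def Y_def by simp_all
    have "lin weight (stack_comb x y) () = 0"
      using x(2) y(2) no_ends_ht_rel[OF x'] no_ends_ht_rel[OF y'] is_arrow_11_ht_rel[OF y'] doubled_arrow_counts
      by (intro weight_stack_comb) simp_all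
    then show False using weight_ht_rel[OF xy] weight_doubled_stack by simp
  qed
  with z show "delta R2 (aw_mult (Str ` R2) X Y) \<noteq> ht_mult R2 R2 (delta R2 X) (delta R2 Y)" by blast
qed

theorem proposition2p23:
  fixes S :: "'a set"
  assumes "finite S"
  shows "vector_space_iso (Aw (Str ` S)) (aw_rel (Str ` S)) (Aw_ht S S) (ht_rel S S) (delta S) \<and>
    (\<forall>D\<in>Aw_ht S S. \<exists>D'. sorted_forms S D = {D'} \<and>
        inv_into (Aw (Str ` S)) (delta S) D = stitch S D') \<and>
    (\<exists>R :: nat set. finite R \<and> (\<exists>X\<in>Aw (Str ` R). \<exists>Y\<in>Aw (Str ` R).
        delta R (aw_mult (Str ` R) X Y) \<noteq> ht_mult R R (delta R X) (delta R Y)))"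
proof (intro conjI ballI)
  show "\<exists>R :: nat set. finite R \<and> (\<exists>X\<in>Aw (Str ` R). \<exists>Y\<in>Aw (Str ` R).
      delta R (aw_mult (Str ` R) X Y) \<noteq> ht_mult R R (delta R X) (delta R Y))"
  proof (rule exI[of _ R2], rule conjI, simp)
    show "\<exists>X\<in>Aw (Str ` R2). \<exists>Y\<in>Aw (Str ` R2).
        delta R2 (aw_mult (Str ` R2) X Y) \<noteq> ht_mult R2 R2 (delta R2 X) (delta R2 Y)"
      by (rule bexI[OF _ delta_not_multiplicative(1)], rule bexI[OF _ delta_not_multiplicative(2)])
        (rule delta_not_multiplicative(3))
  qed
qed (rule delta_iso[OF assms], rule delta_inverse[OF assms])

end
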